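(* There is a polynomial-time algorithm that, given a simple undirected graph $G=(V,E)$ and a tree decomposition of $G$ of width $w$, computes a ternary expansion $G'=(V',E')$ of $G$ with $\mathrm{w}(G')\le w+1$. In particular, every simple undirected graph $G$ admits a ternary expansion $G'$ with $\mathrm{w}(G')\le \mathrm{w}(G)+1$.
   Context: All graphs are finite, simple and undirected. For a vertex $v$, $N(v)$ is its set of neighbors, $d(v)=|N(v)|$, and $\Delta(G)=\max_v d(v)$. A tree decomposition of $G$ is a tree $\mathcal{T}$ together with bags $B_t\subseteq V(G)$ for $t\in V(\mathcal{T})$ such that every vertex of $G$ lies in some bag, every edge of $G$ has both endpoints in some bag, and for each $u\in V(G)$ the tree vertices whose bags contain $u$ form a connected subtree; its width is $\max_t |B_t|-1$, and the treewidth $\mathrm{w}(G)$ is the minimum width over all tree decompositions of $G$. The splitting of a vertex $v$ with support $S\subseteq N(v)$ is the operation: add a new vertex $v'$, join $v'$ to $v$, and for each $s\in S$ remove the edge $sv$ and add the edge $sv'$. A graph $G'$ is an expansion of $G$ if it can be obtained from $G$ by a (possibly empty) sequence of splittings. An expansion $G'$ is ternary if $\Delta(G')\le 3$. *)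

theory Defs
  imports
    "Graph_Theory.Digraph_Component"
    "HOL-Library.Infinite_Typeclass"
    "HOL-Computational_Algebra.Polynomial"
begin

text \<open>
  Finite simple undirected graphs are \<^locale>\<open>pair_graph\<close>s: a finite vertex set with an
  irreflexive symmetric relation, each undirected edge being a pair of opposite arcs.
\<close>

definition neighbors :: "'a pair_pre_digraph \<Rightarrow> 'a \<Rightarrow> 'a set" where
  "neighbors G v = {u. (v, u) \<in> parcs G}"

definition deg :: "'a pair_pre_digraph \<Rightarrow> 'a \<Rightarrow> nat" where
  "deg G v = card (neighbors G v)"

text \<open>The inserted 0 only matters for the null graph.\<close>

definition max_degree :: "'a pair_pre_digraph \<Rightarrow> nat" where
  "max_degree G = Max (insert 0 (deg G ` pverts G))"

text \<open>
  The constant \<^const>\<open>tree\<close> of the library is not suitable for symmetric digraphs, where it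
  regards \<open>u, v, u\<close> as a cycle. The directed cycles of length at least 3 are exactly the
  cycles of the undirected graph. As \<^const>\<open>connected\<close> excludes the null graph, a tree has at
  least one vertex.
\<close>

definition undirected_tree :: "'t pair_pre_digraph \<Rightarrow> bool" where
  "undirected_tree T \<longleftrightarrow> pair_graph T \<and> connected (with_proj T) \<and>
     \<not> (\<exists>p. pre_digraph.cycle (with_proj T) p \<and> length p \<ge> 3)"

definition tree_decomposition ::
  "'a pair_pre_digraph \<Rightarrow> 't pair_pre_digraph \<Rightarrow> ('t \<Rightarrow> 'a set) \<Rightarrow> bool" where
  "tree_decomposition G T B \<longleftrightarrow>
     undirected_tree T \<and>
     (\<forall>t\<in>pverts T. B t \<subseteq> pverts G) \<and>
     (\<forall>v\<in>pverts G. \<exists>t\<in>pverts T. v \<in> B t) \<and>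
     (\<forall>(u, v)\<in>parcs G. \<exists>t\<in>pverts T. u \<in> B t \<and> v \<in> B t) \<and>
     (\<forall>u\<in>pverts G. connected (with_proj T \<restriction> {t \<in> pverts T. u \<in> B t}))"

text \<open>Integer-valued, because the null graph has width -1.\<close>

definition width :: "'t pair_pre_digraph \<Rightarrow> ('t \<Rightarrow> 'a set) \<Rightarrow> int" where
  "width T B = int (Max ((\<lambda>t. card (B t)) ` pverts T)) - 1"

text \<open>
  Every finite tree has an isomorphic copy on natural numbers, so fixing the type of the tree
  vertices does not affect the minimum.
\<close>

definition treewidth :: "'a pair_pre_digraph \<Rightarrow> int" where
  "treewidth G =
     (LEAST w. \<exists>(T :: nat pair_pre_digraph) B. tree_decomposition G T B \<and> width T B = w)"

text \<open>
  The new vertex is taken from the type of the old ones, so statements about the existence of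
  expansions need an infinite vertex type.
\<close>

definition split_vertex :: "'a pair_pre_digraph \<Rightarrow> 'a \<Rightarrow> 'a set \<Rightarrow> 'a \<Rightarrow> 'a pair_pre_digraph" where
  "split_vertex G v S v' =
     \<lparr> pverts = insert v' (pverts G),
       parcs = (parcs G - (S \<times> {v} \<union> {v} \<times> S)) \<union> {(v, v'), (v', v)} \<union> (S \<times> {v'} \<union> {v'} \<times> S) \<rparr>"

definition splitting :: "'a pair_pre_digraph \<Rightarrow> 'a pair_pre_digraph \<Rightarrow> bool" where
  "splitting G G' \<longleftrightarrow>
     (\<exists>v\<in>pverts G. \<exists>S\<subseteq>neighbors G v. \<exists>v'. v' \<notin> pverts G \<and> G' = split_vertex G v S v')"

definition expansion :: "'a pair_pre_digraph \<Rightarrow> 'a pair_pre_digraph \<Rightarrow> bool" where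
  "expansion G G' \<longleftrightarrow> splitting\<^sup>*\<^sup>* G G'"

definition ternary_expansion :: "'a pair_pre_digraph \<Rightarrow> 'a pair_pre_digraph \<Rightarrow> bool" where
  "ternary_expansion G G' \<longleftrightarrow> expansion G G' \<and> max_degree G' \<le> 3"

text \<open>
  Algorithms are programs of a first-order functional language over binary trees without
  labels (S-expressions over a single atom), in the style of the languages in Neil Jones,
  Computability and Complexity. A program is a list of function bodies, function number 0
  being the entry point. There is no primitive test for equality, no arithmetic, and no
  iteration apart from recursion.
\<close>

datatype sexp = Atom | Cell sexp sexp

datatype expr =
    Param nat
  | Quote_Atom
  | Cons_Cell expr expr
  | Head expr
  | Tail expr
  | If_Cell expr expr expr
  | Call nat "expr list"

type_synonym program = "expr list"

primrec sexp_head :: "sexp \<Rightarrow> sexp" where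
  "sexp_head Atom = Atom"
| "sexp_head (Cell x y) = x"

primrec sexp_tail :: "sexp \<Rightarrow> sexp" where
  "sexp_tail Atom = Atom"
| "sexp_tail (Cell x y) = y"

text \<open>
  Big-step semantics with running time: \<open>eval P \<rho> e v c\<close> means that expression \<open>e\<close> evaluates
  to \<open>v\<close> at cost \<open>c\<close> when the parameters of the enclosing function have the values \<open>\<rho>\<close>.
  The function \<^const>\<open>size\<close> counts the cells of a tree, shared subtrees being counted as often
  as they occur. Every evaluation step is charged with the size of the value that it yields.
  Hence the cost accounts for copying all values in full, and a Turing machine can simulate
  a run of cost \<open>c\<close> on input \<open>x\<close> in time polynomial in \<open>c\<close> and \<open>size x\<close>.
\<close>

inductive eval :: "program \<Rightarrow> sexp list \<Rightarrow> expr \<Rightarrow> sexp \<Rightarrow> nat \<Rightarrow> bool"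
  and evals :: "program \<Rightarrow> sexp list \<Rightarrow> expr list \<Rightarrow> sexp list \<Rightarrow> nat \<Rightarrow> bool"
  for P :: program
where
  Param: "i < length \<rho> \<Longrightarrow> eval P \<rho> (Param i) (\<rho> ! i) (1 + size (\<rho> ! i))"
| Quote_Atom: "eval P \<rho> Quote_Atom Atom (1 + size Atom)"
| Cons_Cell: "eval P \<rho> a x c \<Longrightarrow> eval P \<rho> b y d \<Longrightarrow>
    eval P \<rho> (Cons_Cell a b) (Cell x y) (c + d + 1 + size (Cell x y))"
| Head: "eval P \<rho> a x c \<Longrightarrow> eval P \<rho> (Head a) (sexp_head x) (c + 1 + size (sexp_head x))"
| Tail: "eval P \<rho> a x c \<Longrightarrow> eval P \<rho> (Tail a) (sexp_tail x) (c + 1 + size (sexp_tail x))"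
| If_Cell: "eval P \<rho> a x c \<Longrightarrow> eval P \<rho> (if x \<noteq> Atom then b1 else b2) y d \<Longrightarrow>
    eval P \<rho> (If_Cell a b1 b2) y (c + d + 1 + size y)"
| Call: "f < length P \<Longrightarrow> evals P \<rho> as xs c \<Longrightarrow> eval P xs (P ! f) y d \<Longrightarrow>
    eval P \<rho> (Call f as) y (c + d + 1 + size y)"
| evals_Nil: "evals P \<rho> [] [] 0"
| evals_Cons: "eval P \<rho> a x c \<Longrightarrow> evals P \<rho> as xs d \<Longrightarrow> evals P \<rho> (a # as) (x # xs) (c + d)"

inductive_cases eval_ParamE: "eval P \<rho> (Param i) v c"
inductive_cases eval_Quote_AtomE: "eval P \<rho> Quote_Atom v c"
inductive_cases eval_Cons_CellE: "eval P \<rho> (Cons_Cell a b) v c"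
inductive_cases eval_HeadE: "eval P \<rho> (Head a) v c"
inductive_cases eval_TailE: "eval P \<rho> (Tail a) v c"
inductive_cases eval_If_CellE: "eval P \<rho> (If_Cell a b1 b2) v c"
inductive_cases eval_CallE: "eval P \<rho> (Call f as) v c"
inductive_cases evals_NilE: "evals P \<rho> [] vs c"
inductive_cases evals_ConsE: "evals P \<rho> (a # as) vs c"

lemma eval_deterministic:
  "eval P \<rho> e v c \<Longrightarrow> (\<forall>v' c'. eval P \<rho> e v' c' \<longrightarrow> v' = v \<and> c' = c)"
  "evals P \<rho> es vs c \<Longrightarrow> (\<forall>vs' c'. evals P \<rho> es vs' c' \<longrightarrow> vs' = vs \<and> c' = c)"
proof (induction rule: eval_evals.inducts)
  case Param
  show ?case by (intro allI impI, erule eval_ParamE) simp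
next
  case Quote_Atom
  show ?case by (intro allI impI, erule eval_Quote_AtomE) simp
next
  case Cons_Cell
  show ?case by (intro allI impI, erule eval_Cons_CellE) (use Cons_Cell.IH in simp)
next
  case Head
  show ?case by (intro allI impI, erule eval_HeadE) (use Head.IH in simp)
next
  case Tail
  show ?case by (intro allI impI, erule eval_TailE) (use Tail.IH in simp)
next
  case If_Cell
  show ?case by (intro allI impI, erule eval_If_CellE) (use If_Cell.IH in simp)
next
  case Call
  show ?case by (intro allI impI, erule eval_CallE) (use Call.IH in simp)
next
  case evals_Nil
  show ?case by (intro allI impI, erule evals_NilE) simp
next
  case evals_Cons
  show ?case by (intro allI impI, erule evals_ConsE) (use evals_Cons.IH in simp)
qed

definition runs :: "program \<Rightarrow> sexp \<Rightarrow> sexp \<Rightarrow> nat \<Rightarrow> bool" where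
  "runs P x y c \<longleftrightarrow> P \<noteq> [] \<and> eval P [x] (P ! 0) y c"

text \<open>Natural numbers are encoded in binary, the least significant bit coming first.\<close>

fun enc_nat :: "nat \<Rightarrow> sexp" where
  "enc_nat n =
     (if n = 0 then Atom
      else Cell (if even n then Atom else Cell Atom Atom) (enc_nat (n div 2)))"

declare enc_nat.simps [simp del]

primrec enc_list :: "('b \<Rightarrow> sexp) \<Rightarrow> 'b list \<Rightarrow> sexp" where
  "enc_list f [] = Atom"
| "enc_list f (x # xs) = Cell (f x) (enc_list f xs)"

fun enc_pair :: "('b \<Rightarrow> sexp) \<Rightarrow> ('c \<Rightarrow> sexp) \<Rightarrow> 'b \<times> 'c \<Rightarrow> sexp" where
  "enc_pair f g (x, y) = Cell (f x) (g y)"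

text \<open>
  A graph is given by a list of its vertices and a list of its edges, in any order. Each
  undirected edge is listed once, in either orientation.
\<close>

definition encodes_graph :: "sexp \<Rightarrow> nat pair_pre_digraph \<Rightarrow> bool" where
  "encodes_graph x G \<longleftrightarrow>
     (\<exists>vs es. distinct vs \<and> set vs = pverts G \<and>
        distinct (map (\<lambda>(u, v). {u, v}) es) \<and> set es \<union> (set es)\<inverse> = parcs G \<and>
        x = Cell (enc_list enc_nat vs) (enc_list (enc_pair enc_nat enc_nat) es))"

lemma enc_nat_inject: "enc_nat m = enc_nat n \<Longrightarrow> m = n"
proof (induction m arbitrary: n rule: less_induct)
  case (less m)
  show ?case
  proof (cases "m = 0 \<or> n = 0")
    case True
    then show ?thesis
      using less.prems by (auto simp: enc_nat.simps[of m] enc_nat.simps[of n] split: if_splits)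
  next
    case False
    then have "enc_nat (m div 2) = enc_nat (n div 2)" "even m = even n"
      using less.prems by (auto simp: enc_nat.simps[of m] enc_nat.simps[of n] split: if_splits)
    moreover from this(1) have "m div 2 = n div 2"
      using less.IH[of "m div 2"] False by simp
    ultimately show ?thesis
      by (metis dvd_mult_div_cancel odd_two_times_div_two_succ)
  qed
qed

lemma enc_list_inject:
  "(\<And>x y. f x = f y \<Longrightarrow> x = y) \<Longrightarrow> enc_list f xs = enc_list f ys \<Longrightarrow> xs = ys"
proof (induction xs arbitrary: ys)
  case Nil
  then show ?case by (cases ys) auto
next
  case (Cons x xs)
  then show ?case by (cases ys) auto
qed

lemma enc_edge_inject:
  "enc_pair enc_nat enc_nat e = enc_pair enc_nat enc_nat e' \<Longrightarrow> e = e'"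
  by (cases e; cases e') (auto dest: enc_nat_inject)

lemma encodes_graph_unique:
  assumes "encodes_graph x G" "encodes_graph x H"
  shows "G = H"
proof -
  from assms obtain vs es where
    "set vs = pverts G" "set es \<union> (set es)\<inverse> = parcs G"
    "set vs = pverts H" "set es \<union> (set es)\<inverse> = parcs H"
    unfolding encodes_graph_def
    by (metis enc_list_inject enc_nat_inject enc_edge_inject sexp.inject)
  then show ?thesis by simp
qed

definition encodes_bags :: "sexp \<Rightarrow> nat pair_pre_digraph \<Rightarrow> (nat \<Rightarrow> nat set) \<Rightarrow> bool" where
  "encodes_bags x T B \<longleftrightarrow>
     (\<exists>bags. distinct (map fst bags) \<and> set (map fst bags) = pverts T \<and>
        (\<forall>(t, b)\<in>set bags. distinct b \<and> set b = B t) \<and>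
        x = enc_list (enc_pair enc_nat (enc_list enc_nat)) bags)"

definition encodes_instance ::
  "sexp \<Rightarrow> nat pair_pre_digraph \<Rightarrow> nat pair_pre_digraph \<Rightarrow> (nat \<Rightarrow> nat set) \<Rightarrow> bool" where
  "encodes_instance x G T B \<longleftrightarrow>
     (\<exists>g t b. encodes_graph g G \<and> encodes_graph t T \<and> encodes_bags b T B \<and>
        x = Cell g (Cell t b))"

end

(*
Every vertex v of G is replaced by a copy of the subtree of T formed by the bags that contain v.
The copies are grown while T is traversed. At any time, each visited bag t has a current
representative rep(t, u) of each of its vertices u. When a child s of t is visited, rep(t, u) gets
a new pendant neighbour for each u in both bags, which becomes the representative at both s and t.
An edge uv of G is inserted at some bag t that contains u and v: both representatives are replaced
by new pendant neighbours, which are then joined. Since a representative is abandoned as soon as it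
gets a pendant neighbour there, its degree plus the number of places where it is in use never exceeds 3.

To replace r = rep(t, u) by a new vertex x, one attaches the bag R + x to the bag that contains the
set R of the representatives at t. Bags attached in this way have at most one vertex more than
those of T, and they contain R - r + x again.

The splittings are not performed in the order in which the vertices are created: adding a pendant
neighbour is a splitting with empty support, and adding an edge between the copies of u and v turns
an expansion of H into an expansion of H + uv. So the process starts with the edgeless graph on V(G)
and adds the edges of G one by one.

The program needs no arithmetic, because the new vertices have names whose binary digits are all 1,
and these are longer than all names in the input.
*)

theory Submission
  imports Defs
begin

section \<open>Trees and tree decompositions\<close>

text \<open>The extra vertex per bag comes from replacing representatives one at a time: an attached
  bag holds the old and the new representative of a single vertex only. The construction is a pure
  function \<open>ternarize\<close> with the supply \<open>f\<close> of new vertices as a parameter.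
  For \<open>f = spare s\<close> it is what the program computes; for any injection that avoids the
  vertices of \<open>G\<close> it gives the existence claim over every infinite vertex type. The
  tree edges come in arbitrary order and orientation, so the traversal consists of repeated sweeps
  over their list, one per bag. The running time has to be bounded although every evaluation step is
  charged with the size of its value. A common bound \<open>N\<close> on all values reduces this to
  counting steps. Since the encoded state never shrinks, \<open>N\<close> only has to be compared
  with the input and a few final values, and these are bounded separately by counting
  operations.\<close>

lemma cycle_with_proj:
  "pre_digraph.cycle (with_proj T) p \<longleftrightarrow>
     (\<exists>u\<in>pverts T. set p \<subseteq> parcs T \<and> pcas u p u \<and> distinct (tl (pawalk_verts u p)) \<and> p \<noteq> [])"
  by (auto simp: pre_digraph.cycle_def pre_digraph.awalk_def cas_with_proj_eq awalk_verts_with_proj_eq)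

text \<open>Cuts loops: when a path is to be prefixed with an arc whose first vertex it already
  contains, the part from that vertex on takes its place.\<close>

lemma pcas_suffix:
  assumes "pcas y p b" "x \<in> set (pawalk_verts y p)" "distinct (pawalk_verts y p)"
  shows "\<exists>q. set q \<subseteq> set p \<and> pcas x q b \<and> distinct (pawalk_verts x q)"
  using assms
proof (induction p arbitrary: y)
  case Nil
  then show ?case by (intro exI[of _ "[]"]) auto
next
  case (Cons e p)
  show ?case
  proof (cases "x = fst e")
    case True
    then show ?thesis using Cons.prems by (intro exI[of _ "e # p"]) auto
  next
    case False
    then obtain q where "set q \<subseteq> set p" "pcas x q b" "distinct (pawalk_verts x q)"
      using Cons.IH[of "snd e"] Cons.prems by auto
    then show ?thesis by (intro exI[of _ q]) auto
  qed
qed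

lemma rtrancl_imp_path:
  "(a, b) \<in> R\<^sup>* \<Longrightarrow> \<exists>p. set p \<subseteq> R \<and> pcas a p b \<and> distinct (pawalk_verts a p)"
proof (induction rule: converse_rtrancl_induct)
  case base
  show ?case by (intro exI[of _ "[]"]) auto
next
  case (step x y)
  then obtain p where p: "set p \<subseteq> R" "pcas y p b" "distinct (pawalk_verts y p)" by auto
  show ?case
  proof (cases "x \<in> set (pawalk_verts y p)")
    case True
    then show ?thesis using pcas_suffix[OF p(2) True p(3)] p(1) by blast
  next
    case False
    then show ?thesis using p step(1) by (intro exI[of _ "(x, y) # p"]) auto
  qed
qed

lemma pcas_imp_rtrancl: "pcas a p b \<Longrightarrow> set p \<subseteq> R \<Longrightarrow> (a, b) \<in> R\<^sup>*"
  by (induction p arbitrary: a) (auto intro: converse_rtrancl_into_rtrancl)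

lemma pawalk_verts_fst: "pcas a p b \<Longrightarrow> pawalk_verts a p = map fst p @ [b]"
  by (induction p arbitrary: a) auto

lemma pawalk_verts_snd: "pcas a p b \<Longrightarrow> pawalk_verts a p = a # map snd p"
  by (induction p arbitrary: a) auto

lemma sym_parcs:
  assumes "pair_graph T" shows "sym (parcs T)"
proof -
  interpret pair_graph T by fact
  show ?thesis using pair_sym_arcs by (simp add: symmetric_def)
qed

lemma pair_graph_iff:
  "pair_graph T \<longleftrightarrow> finite (pverts T) \<and> parcs T \<subseteq> pverts T \<times> pverts T \<and> sym (parcs T) \<and> irrefl (parcs T)"
proof
  assume "pair_graph T"
  then interpret pair_graph T .
  show "finite (pverts T) \<and> parcs T \<subseteq> pverts T \<times> pverts T \<and> sym (parcs T) \<and> irrefl (parcs T)"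
    using pair_finite_verts in_arcsD1 in_arcsD2 sym_parcs[OF \<open>pair_graph T\<close>] pair_no_loops
    by (fastforce simp: irrefl_def)
next
  assume T: "finite (pverts T) \<and> parcs T \<subseteq> pverts T \<times> pverts T \<and> sym (parcs T) \<and> irrefl (parcs T)"
  then have "finite (parcs T)" by (meson finite_SigmaI finite_subset)
  with T show "pair_graph T"
    by unfold_locales (auto simp: irrefl_def symmetric_def)
qed

text \<open>A symmetric arc set is its own symmetrization, so \<open>connected\<close> turns into
  plain reachability inside \<open>X\<close>; the nonemptiness of \<open>X\<close> remains as a
  separate condition.\<close>

lemma connected_induce_iff:
  assumes "sym (parcs T)"
  shows "connected (with_proj T \<restriction> X) \<longleftrightarrow>
    X \<noteq> {} \<and> (\<forall>a\<in>X. \<forall>b\<in>X. (a, b) \<in> (parcs T \<inter> X \<times> X)\<^sup>*)"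
proof -
  have "(\<Union>e\<in>{e \<in> parcs T. fst e \<in> X \<and> snd e \<in> X}. {(fst e, snd e), (snd e, fst e)}) = parcs T \<inter> X \<times> X"
    using assms by (auto dest: symD)
  then have m: "mk_symmetric (with_proj T \<restriction> X) = \<lparr>pverts = X, parcs = parcs T \<inter> X \<times> X\<rparr>"
    by (simp add: mk_symmetric_def)
  have "rtrancl_on X (parcs T \<inter> X \<times> X) = (parcs T \<inter> X \<times> X)\<^sup>* \<inter> X \<times> X"
  proof (intro equalityI subrelI)
    fix a b assume "(a, b) \<in> rtrancl_on X (parcs T \<inter> X \<times> X)"
    then show "(a, b) \<in> (parcs T \<inter> X \<times> X)\<^sup>* \<inter> X \<times> X"
      by induction (auto intro: converse_rtrancl_into_rtrancl)
  next
    fix a b assume "(a, b) \<in> (parcs T \<inter> X \<times> X)\<^sup>* \<inter> X \<times> X"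
    then have "(a, b) \<in> (parcs T \<inter> X \<times> X)\<^sup>*" "a \<in> X" by auto
    then show "(a, b) \<in> rtrancl_on X (parcs T \<inter> X \<times> X)"
      by induction (auto intro: rtrancl_on_into_rtrancl_on)
  qed
  then show ?thesis
    by (auto simp: connected_def strongly_connected_def m reachable_def)
qed

lemma connected_with_proj_iff:
  assumes "pair_graph T"
  shows "connected (with_proj T) \<longleftrightarrow>
    pverts T \<noteq> {} \<and> (\<forall>a\<in>pverts T. \<forall>b\<in>pverts T. (a, b) \<in> (parcs T)\<^sup>*)"
proof -
  have s: "parcs T \<inter> pverts T \<times> pverts T = parcs T" using assms by (auto simp: pair_graph_iff)
  have "mk_symmetric (with_proj T \<restriction> pverts T) = mk_symmetric (with_proj T)"
  proof -
    have "{e \<in> parcs T. fst e \<in> pverts T \<and> snd e \<in> pverts T} = parcs T"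
      using assms by (fastforce simp: pair_graph_iff)
    then show ?thesis by (simp add: mk_symmetric_def)
  qed
  then have "connected (with_proj T) \<longleftrightarrow> connected (with_proj T \<restriction> pverts T)"
    by (simp add: connected_def)
  with connected_induce_iff[OF sym_parcs[OF assms], of "pverts T"] s show ?thesis by simp
qed

text \<open>A cycle of length at least 3 is an edge together with a return path that avoids it in
  both directions, so acyclicity means that every edge is a bridge. This form passes easily to a
  tree with a new leaf, and it is what the running intersection property rests on.\<close>

lemma acyclic_iff_bridges:
  assumes "pair_graph T"
  shows "(\<nexists>p. pre_digraph.cycle (with_proj T) p \<and> length p \<ge> 3) \<longleftrightarrow>
    (\<forall>(a, b)\<in>parcs T. (b, a) \<notin> (parcs T - {(a, b), (b, a)})\<^sup>*)"
proof (intro iffI notI ballI; clarify)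
  fix a b
  assume no: "\<nexists>p. pre_digraph.cycle (with_proj T) p \<and> length p \<ge> 3"
    and ab: "(a, b) \<in> parcs T" and ba: "(b, a) \<in> (parcs T - {(a, b), (b, a)})\<^sup>*"
  have ne: "a \<noteq> b" "b \<in> pverts T" "a \<in> pverts T" using ab assms by (auto simp: pair_graph_iff irrefl_def)
  obtain p where p: "set p \<subseteq> parcs T - {(a, b), (b, a)}" "pcas b p a" "distinct (pawalk_verts b p)"
    using rtrancl_imp_path[OF ba] by blast
  \<comment> \<open>The empty path does not lead from \<open>b\<close> to \<open>a\<close>, as
    \<open>a \<noteq> b\<close>, and the only path of length 1 is the arc \<open>(b, a)\<close>,
    which has been removed.\<close>
  have "length p \<ge> 2"
  proof -
    obtain e p' where ep: "p = e # p'" using p(2) ne by (cases p) auto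
    moreover have "p' \<noteq> []"
      using p(1,2) ep by (cases e) auto
    ultimately show ?thesis by (cases p') auto
  qed
  moreover have "pre_digraph.cycle (with_proj T) ((a, b) # p)"
    unfolding cycle_with_proj using p ab ne by (intro bexI[of _ a]) auto
  ultimately show False using no by force
next
  fix p
  assume br: "\<forall>(a, b)\<in>parcs T. (b, a) \<notin> (parcs T - {(a, b), (b, a)})\<^sup>*"
    and cyc: "pre_digraph.cycle (with_proj T) p" and len: "3 \<le> length p"
  obtain u where u: "set p \<subseteq> parcs T" "pcas u p u" "distinct (tl (pawalk_verts u p))"
    using cyc unfolding cycle_with_proj by auto
  obtain e q where pq: "p = e # q" using len by (cases p) auto
  obtain b where e: "e = (u, b)" using u(2) pq by (cases e) auto
  have q: "pcas b q u" "distinct (pawalk_verts b q)" using u pq e by auto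
  obtain e1 q1 where q1: "q = e1 # q1" "q1 \<noteq> []" using len pq by (cases q; cases "tl q") auto
  have f: "distinct (map fst q @ [u])" using q pawalk_verts_fst by metis
  have s: "distinct (b # map snd q)" using q pawalk_verts_snd by metis
  have "(u, b) \<notin> set q" using f by force
  \<comment> \<open>Here the length 3 matters. The path \<open>q\<close> leaves \<open>b\<close>
    only once, so \<open>(b, u)\<close> would be its first arc, and its second arc would leave
    \<open>u\<close>, the end of \<open>q\<close>.\<close>
  moreover have "(b, u) \<notin> set q"
  proof
    assume bu: "(b, u) \<in> set q"
    have "fst e1 = b" using q(1) q1 by auto
    moreover have "fst e1 \<notin> fst ` set q1" using f q1(1) by simp
    then have "(b, u) \<notin> set q1" using imageI[of "(b, u)" "set q1" fst] \<open>fst e1 = b\<close> by auto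
    ultimately have e1: "e1 = (b, u)" using bu q1 by auto
    obtain e2 q2 where q2: "q1 = e2 # q2" using q1 by (cases q1) auto
    have "fst e2 = u" using q(1) q1(1) q2 e1 by auto
    then show False using f q1(1) q2 by auto
  qed
  ultimately have "set q \<subseteq> parcs T - {(u, b), (b, u)}" using u(1) pq by auto
  from pcas_imp_rtrancl[OF q(1) this] br u(1) pq e show False by auto
qed

lemma undirected_tree_iff:
  "undirected_tree T \<longleftrightarrow> pair_graph T \<and> pverts T \<noteq> {} \<and>
     (\<forall>a\<in>pverts T. \<forall>b\<in>pverts T. (a, b) \<in> (parcs T)\<^sup>*) \<and>
     (\<forall>(a, b)\<in>parcs T. (b, a) \<notin> (parcs T - {(a, b), (b, a)})\<^sup>*)"
  unfolding undirected_tree_def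
  using acyclic_iff_bridges[of T] connected_with_proj_iff[of T] by blast

lemma undirected_tree_add_leaf:
  assumes T: "undirected_tree T" and t: "t \<in> pverts T" and s: "s \<notin> pverts T"
  shows "undirected_tree \<lparr>pverts = insert s (pverts T), parcs = parcs T \<union> {(s, t), (t, s)}\<rparr>"
    (is "undirected_tree ?T'")
proof -
  let ?R = "parcs T" and ?R' = "parcs T \<union> {(s, t), (t, s)}"
  have g: "pair_graph T" and conn: "\<And>a b. a \<in> pverts T \<Longrightarrow> b \<in> pverts T \<Longrightarrow> (a, b) \<in> ?R\<^sup>*"
    and br: "\<And>a b. (a, b) \<in> ?R \<Longrightarrow> (b, a) \<notin> (?R - {(a, b), (b, a)})\<^sup>*"
    using T by (auto simp: undirected_tree_iff)
  have R: "?R \<subseteq> pverts T \<times> pverts T" using g by (auto simp: pair_graph_iff)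
  have "pair_graph ?T'"
    using g t s by (auto simp: pair_graph_iff irrefl_def sym_def)
  moreover have "(a, t) \<in> ?R'\<^sup>* \<and> (t, a) \<in> ?R'\<^sup>*" if "a \<in> insert s (pverts T)" for a
  proof (cases "a = s")
    case False
    have "?R\<^sup>* \<subseteq> ?R'\<^sup>*" by (rule rtrancl_mono) auto
    then show ?thesis using conn t that False by auto
  qed auto
  then have "\<forall>a\<in>insert s (pverts T). \<forall>b\<in>insert s (pverts T). (a, b) \<in> ?R'\<^sup>*"
    by (meson rtrancl_trans)
  moreover have "(b, a) \<notin> (?R' - {(a, b), (b, a)})\<^sup>*" if "(a, b) \<in> ?R'" for a b
  proof
    assume ba: "(b, a) \<in> (?R' - {(a, b), (b, a)})\<^sup>*"
    from that consider "(a, b) \<in> ?R" | "a = s" "b = t" | "a = t" "b = s" by auto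
    then show False
    proof cases
      case 1
      \<comment> \<open>Contracting the new leaf onto \<open>t\<close> turns a walk that avoids an
        old edge of the larger tree into a walk of the old tree that avoids this edge.\<close>
      define \<phi> where "\<phi> x = (if x = s then t else x)" for x
      have "(\<phi> x, \<phi> y) \<in> (?R - {(a, b), (b, a)})\<^sup>*" if "(x, y) \<in> (?R' - {(a, b), (b, a)})\<^sup>*" for x y
        using that
      proof induction
        case (step y z)
        have "\<phi> y = \<phi> z \<or> (\<phi> y, \<phi> z) \<in> ?R - {(a, b), (b, a)}"
          using step(2) subsetD[OF R, of "(y, z)"] s by (auto simp: \<phi>_def)
        then show ?case using step(3) by (auto intro: rtrancl_into_rtrancl)
      qed simp
      from this[OF ba] have "(\<phi> b, \<phi> a) \<in> (?R - {(a, b), (b, a)})\<^sup>*" .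
      moreover have "\<phi> a = a" "\<phi> b = b" using subsetD[OF R 1] s by (auto simp: \<phi>_def)
      ultimately show False using br 1 by simp
    next
      case 2
      \<comment> \<open>Without the new edge no arc touches \<open>s\<close>, so \<open>s\<close>
        cannot be reached from \<open>t\<close>.\<close>
      have sub: "?R' - {(a, b), (b, a)} \<subseteq> ?R" using 2 by auto
      have "(t, s) \<in> ?R\<^sup>*" using ba rtrancl_mono[OF sub] 2 by auto
      then show False using R s t by (cases rule: rtranclE) auto
    next
      case 3
      have sub: "?R' - {(a, b), (b, a)} \<subseteq> ?R" using 3 by auto
      have "(s, t) \<in> ?R\<^sup>*" using ba rtrancl_mono[OF sub] 3 by auto
      then show False using R s t by (cases rule: converse_rtranclE) auto
    qed
  qed
  ultimately show ?thesis
    unfolding undirected_tree_iff pair_pre_digraph.select_convs by blast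
qed

text \<open>
  The families of bags of tree decompositions: they are built by attaching one bag at a time to
  an earlier one, which must contain all its old vertices (running intersection property).
\<close>

inductive bag_family :: "'a set set \<Rightarrow> bool" where
  single: "bag_family {C}"
| attach: "bag_family \<B> \<Longrightarrow> C \<in> \<B> \<Longrightarrow> D \<inter> \<Union>\<B> \<subseteq> C \<Longrightarrow> bag_family (insert D \<B>)"

lemma bag_family_nonempty: "bag_family \<B> \<Longrightarrow> \<B> \<noteq> {}"
  by (cases rule: bag_family.cases) auto

text \<open>Connectedness is stated by paths for every \<open>u\<close>, since
  \<open>connected\<close> would fail for those \<open>u\<close> that lie in no bag. The map
  \<open>B\<close> need not be injective: attaching a set that is already in the family creates
  another tree vertex with the same bag.\<close>

lemma bag_family_tree:
  "bag_family \<B> \<Longrightarrow> \<exists>(T :: nat pair_pre_digraph) B. undirected_tree T \<and> B ` pverts T = \<B> \<and>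
     (\<forall>u. \<forall>a\<in>{t \<in> pverts T. u \<in> B t}. \<forall>b\<in>{t \<in> pverts T. u \<in> B t}.
        (a, b) \<in> (parcs T \<inter> {t \<in> pverts T. u \<in> B t} \<times> {t \<in> pverts T. u \<in> B t})\<^sup>*)"
proof (induction rule: bag_family.induct)
  case (single C)
  have "undirected_tree \<lparr>pverts = {0 :: nat}, parcs = {}\<rparr>"
    by (simp add: undirected_tree_iff pair_graph_iff)
  then show ?case
    by (intro exI[of _ "\<lparr>pverts = {0 :: nat}, parcs = {}\<rparr>"] exI[of _ "\<lambda>_. C"]) auto
next
  case (attach \<B> C D)
  then obtain T :: "nat pair_pre_digraph" and B where T: "undirected_tree T" "B ` pverts T = \<B>"
    and conn: "\<And>u a b. a \<in> pverts T \<Longrightarrow> u \<in> B a \<Longrightarrow> b \<in> pverts T \<Longrightarrow> u \<in> B b \<Longrightarrow>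
        (a, b) \<in> (parcs T \<inter> {t \<in> pverts T. u \<in> B t} \<times> {t \<in> pverts T. u \<in> B t})\<^sup>*"
    by fastforce
  obtain t where t: "t \<in> pverts T" "B t = C" using attach T by auto
  have "finite (pverts T)" using T by (simp add: undirected_tree_iff pair_graph_iff)
  then obtain s where s: "s \<notin> pverts T" using ex_new_if_finite infinite_UNIV_nat by blast
  define T' where "T' = \<lparr>pverts = insert s (pverts T), parcs = parcs T \<union> {(s, t), (t, s)}\<rparr>"
  define B' where "B' = B(s := D)"
  have "undirected_tree T'" unfolding T'_def by (rule undirected_tree_add_leaf[OF T(1) t(1) s])
  moreover have "B' ` pverts T' = insert D \<B>" using T(2) s by (auto simp: T'_def B'_def)
  moreover have "(a, b) \<in> (parcs T' \<inter> {t \<in> pverts T'. u \<in> B' t} \<times> {t \<in> pverts T'. u \<in> B' t})\<^sup>*"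
    if ab: "a \<in> pverts T'" "u \<in> B' a" "b \<in> pverts T'" "u \<in> B' b" for u a b
  proof -
    let ?X = "{t \<in> pverts T. u \<in> B t}" and ?X' = "{t \<in> pverts T'. u \<in> B' t}"
    let ?R' = "parcs T' \<inter> ?X' \<times> ?X'"
    have sub: "parcs T \<inter> ?X \<times> ?X \<subseteq> ?R'" using s by (auto simp: T'_def B'_def)
    have old: "(x, y) \<in> ?R'\<^sup>*" if "x \<in> ?X" "y \<in> ?X" for x y
      using conn[of x u y] that rtrancl_mono[OF sub] by auto
    \<comment> \<open>If \<open>u\<close> is an old element of the new bag, it lies in
      \<open>C\<close>, and the leaf \<open>s\<close> is joined to the subtree of \<open>u\<close>
      through \<open>t\<close>. Otherwise the tree vertices of \<open>u\<close> are all old, or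
      \<open>s\<close> is the only one.\<close>
    show ?thesis
    proof (cases "u \<in> D \<and> u \<in> \<Union>\<B>")
      case True
      then have "t \<in> ?X" using attach.hyps t by auto
      have st: "(s, t) \<in> ?R'" "(t, s) \<in> ?R'" using True t s attach.hyps by (auto simp: T'_def B'_def)
      have "(x, t) \<in> ?R'\<^sup>* \<and> (t, x) \<in> ?R'\<^sup>*" if "x \<in> ?X'" for x
      proof (cases "x = s")
        case True
        then show ?thesis using st by auto
      next
        case False
        then have "x \<in> ?X" using that by (auto simp: T'_def B'_def)
        then show ?thesis using old \<open>t \<in> ?X\<close> by auto
      qed
      then have "(a, t) \<in> ?R'\<^sup>*" "(t, b) \<in> ?R'\<^sup>*" using ab by auto
      then show ?thesis by (rule rtrancl_trans)
    next
      case False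
      then consider "u \<notin> D" | "u \<notin> \<Union>\<B>" by auto
      then show ?thesis
      proof cases
        case 1
        then have "a \<in> ?X" "b \<in> ?X" using ab by (auto simp: T'_def B'_def split: if_splits)
        then show ?thesis by (rule old)
      next
        case 2
        then have "a = s" "b = s" using ab T(2) by (auto simp: T'_def B'_def split: if_splits)
        then show ?thesis by simp
      qed
    qed
  qed
  ultimately show ?case by (intro exI[of _ T'] exI[of _ B']) auto
qed

section \<open>Treewidth as an attained minimum, and the running intersection property\<close>

lemma width_ge: "width T B \<ge> -1"
  by (simp add: width_def)

text \<open>A \<open>LEAST\<close> over the integers need not be attained. Widths are at least -1,
  hence of the form \<open>n - 1\<close> with \<open>n\<close> natural, and among these
  \<open>n\<close> there is a least one.\<close>

lemma treewidth_eq: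
  fixes T :: "nat pair_pre_digraph"
  assumes "tree_decomposition G T B"
  shows "treewidth G \<le> width T B"
    and "\<exists>(T' :: nat pair_pre_digraph) B'. tree_decomposition G T' B' \<and> width T' B' = treewidth G"
proof -
  define P where "P w \<longleftrightarrow> (\<exists>(T :: nat pair_pre_digraph) B. tree_decomposition G T B \<and> width T B = w)" for w
  have P: "P (width T B)" using assms by (auto simp: P_def)
  have lower: "w \<ge> -1" if "P w" for w using that width_ge by (auto simp: P_def)
  define n where "n = (LEAST n. P (int n - 1))"
  have ex: "P (int (nat (w + 1)) - 1)" if "P w" for w
    using that lower[OF that] by simp
  have Pn: "P (int n - 1)" unfolding n_def by (rule LeastI) (rule ex[OF P])
  have le: "int n - 1 \<le> w" if "P w" for w
    using Least_le[of "\<lambda>n. P (int n - 1)", OF ex[OF that]] lower[OF that] by (simp add: n_def)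
  have "treewidth G = int n - 1"
    unfolding treewidth_def using Pn le by (intro Least_equality) (auto simp: P_def)
  then show "treewidth G \<le> width T B"
    and "\<exists>(T' :: nat pair_pre_digraph) B'. tree_decomposition G T' B' \<and> width T' B' = treewidth G"
    using Pn le[OF P] by (auto simp: P_def)
qed

lemma bag_family_tree_decomposition:
  assumes "bag_family \<B>" "\<Union>\<B> = pverts H" "parcs H \<subseteq> (\<Union>C\<in>\<B>. C \<times> C)"
    and card: "\<And>C. C \<in> \<B> \<Longrightarrow> int (card C) \<le> w + 1"
  shows "\<exists>(T :: nat pair_pre_digraph) B. tree_decomposition H T B \<and> width T B \<le> w"
proof -
  obtain T :: "nat pair_pre_digraph" and B where T: "undirected_tree T" "B ` pverts T = \<B>"
    and conn: "\<And>u a b. a \<in> {t \<in> pverts T. u \<in> B t} \<Longrightarrow> b \<in> {t \<in> pverts T. u \<in> B t} \<Longrightarrow>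
        (a, b) \<in> (parcs T \<inter> {t \<in> pverts T. u \<in> B t} \<times> {t \<in> pverts T. u \<in> B t})\<^sup>*"
    using bag_family_tree[OF assms(1)] by blast
  have g: "pair_graph T" and ne: "pverts T \<noteq> {}" using T by (auto simp: undirected_tree_iff)
  have fin: "finite (pverts T)" using g by (simp add: pair_graph_iff)
  have cov: "\<exists>t\<in>pverts T. u \<in> B t" if "u \<in> pverts H" for u using that assms(2) T(2) by auto
  have "tree_decomposition H T B"
    unfolding tree_decomposition_def
  proof (intro conjI ballI, goal_cases)
    case (4 x)
    then show ?case using assms(3) T(2) by fastforce
  next
    case (5 u)
    then show ?case
      using conn[of _ u] cov[of u] by (subst connected_induce_iff[OF sym_parcs[OF g]]) blast
  qed (use assms(2) T cov in auto)
  moreover have "width T B \<le> w"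
  proof -
    have "Max ((\<lambda>t. card (B t)) ` pverts T) \<in> (\<lambda>t. card (B t)) ` pverts T"
      using fin ne by (intro Max_in) auto
    then obtain t where "t \<in> pverts T" "Max ((\<lambda>t. card (B t)) ` pverts T) = card (B t)" by auto
    then show ?thesis using card[of "B t"] T(2) by (auto simp: width_def)
  qed
  ultimately show ?thesis by blast
qed

lemma treewidth_le_if_bag_family:
  assumes "bag_family \<B>" "\<Union>\<B> = pverts H" "parcs H \<subseteq> (\<Union>C\<in>\<B>. C \<times> C)"
    and "\<And>C. C \<in> \<B> \<Longrightarrow> int (card C) \<le> w + 1"
  shows "treewidth H \<le> w"
  using bag_family_tree_decomposition[OF assms] treewidth_eq(1) by fastforce

text \<open>For the minimum to be attained, some decomposition must exist; the single bag
  \<open>pverts G\<close> serves.\<close>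

lemma treewidth_attained:
  assumes "pair_graph G"
  shows "\<exists>(T :: nat pair_pre_digraph) B. tree_decomposition G T B \<and> width T B = treewidth G"
proof -
  have "\<exists>(T :: nat pair_pre_digraph) B. tree_decomposition G T B \<and> width T B \<le> int (card (pverts G)) - 1"
    using assms
    by (intro bag_family_tree_decomposition[of "{pverts G}"] bag_family.single)
      (auto simp: pair_graph_iff)
  then show ?thesis using treewidth_eq(2) by blast
qed

text \<open>\<open>W\<close> is a connected part of the tree, and the edge \<open>ab\<close> leaves
  it. If \<open>u\<close> were in \<open>B b\<close> and in some \<open>B x\<close> with
  \<open>x \<in> W\<close>, but not in \<open>B a\<close>, the subtree of \<open>u\<close> would
  lead from \<open>b\<close> to \<open>x\<close> past \<open>a\<close>, and \<open>W\<close> would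
  lead from \<open>x\<close> to \<open>a\<close> past \<open>b\<close>. Together these walks bypass
  the bridge \<open>ab\<close>.\<close>

lemma tree_decomposition_running_intersection:
  assumes td: "tree_decomposition G T B" and W: "W \<subseteq> pverts T" and ab: "(a, b) \<in> parcs T"
    and b: "b \<notin> W" and conn: "\<And>x. x \<in> W \<Longrightarrow> (x, a) \<in> (parcs T \<inter> W \<times> W)\<^sup>*"
  shows "B b \<inter> \<Union>(B ` W) \<subseteq> B a"
proof (intro subsetI, rule ccontr)
  fix u assume u: "u \<in> B b \<inter> \<Union>(B ` W)" "u \<notin> B a"
  have T: "pair_graph T" "(b, a) \<notin> (parcs T - {(a, b), (b, a)})\<^sup>*"
    using td ab by (auto simp: tree_decomposition_def undirected_tree_iff)
  let ?X = "{t \<in> pverts T. u \<in> B t}"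
  have bT: "b \<in> pverts T" using T(1) ab by (auto simp: pair_graph_iff)
  obtain x where x: "x \<in> W" "u \<in> B x" using u by auto
  have "u \<in> pverts G" using td bT u by (auto simp: tree_decomposition_def)
  then have "connected (with_proj T \<restriction> ?X)" using td by (simp add: tree_decomposition_def)
  then have "(b, x) \<in> (parcs T \<inter> ?X \<times> ?X)\<^sup>*"
    using bT u x W by (auto simp: connected_induce_iff[OF sym_parcs[OF T(1)]])
  moreover have "parcs T \<inter> ?X \<times> ?X \<subseteq> parcs T - {(a, b), (b, a)}" using u by auto
  ultimately have 1: "(b, x) \<in> (parcs T - {(a, b), (b, a)})\<^sup>*" using rtrancl_mono by blast
  have "parcs T \<inter> W \<times> W \<subseteq> parcs T - {(a, b), (b, a)}" using b by auto
  then have "(x, a) \<in> (parcs T - {(a, b), (b, a)})\<^sup>*" using conn[OF x(1)] rtrancl_mono by blast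
  with 1 T(2) show False by (meson rtrancl_trans)
qed

lemma tree_decomposition_card:
  assumes "tree_decomposition G T B" "t \<in> pverts T"
  shows "int (card (B t)) \<le> width T B + 1"
proof -
  have "finite (pverts T)"
    using assms by (auto simp: tree_decomposition_def undirected_tree_iff pair_graph_iff)
  then show ?thesis using assms(2) by (auto simp: width_def intro!: Max_ge)
qed

section \<open>Expansions\<close>

definition add_edge :: "'a pair_pre_digraph \<Rightarrow> 'a \<Rightarrow> 'a \<Rightarrow> 'a pair_pre_digraph" where
  "add_edge G u v = G\<lparr>parcs := parcs G \<union> {(u, v), (v, u)}\<rparr>"

lemma add_edge_simps [simp]:
  "pverts (add_edge G u v) = pverts G"
  "parcs (add_edge G u v) = parcs G \<union> {(u, v), (v, u)}"
  by (simp_all add: add_edge_def)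

lemma add_edge_commute: "add_edge G u v = add_edge G v u"
  by (simp add: add_edge_def insert_commute)

text \<open>The map sends every vertex of the expansion to the original vertex that it was split off.\<close>

inductive expands :: "'a pair_pre_digraph \<Rightarrow> 'a pair_pre_digraph \<Rightarrow> ('a \<Rightarrow> 'a) \<Rightarrow> bool" for G where
  initial: "expands G G (\<lambda>x. x)"
| step: "expands G H \<pi> \<Longrightarrow> r \<in> pverts H \<Longrightarrow> S \<subseteq> neighbors H r \<Longrightarrow> r' \<notin> pverts H \<Longrightarrow>
    expands G (split_vertex H r S r') (\<pi>(r' := \<pi> r))"

lemma expands_imp_expansion: "expands G H \<pi> \<Longrightarrow> expansion G H"
proof (induction rule: expands.induct)
  case (step H \<pi> r S r')
  then have "splitting H (split_vertex H r S r')" by (auto simp: splitting_def)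
  then show ?case using step.IH unfolding expansion_def by (rule rtranclp.rtrancl_into_rtrancl[rotated])
qed (simp add: expansion_def)

lemma split_vertex_simps [simp]:
  "pverts (split_vertex G v S v') = insert v' (pverts G)"
  "parcs (split_vertex G v S v') =
     (parcs G - (S \<times> {v} \<union> {v} \<times> S)) \<union> {(v, v'), (v', v)} \<union> (S \<times> {v'} \<union> {v'} \<times> S)"
  by (simp_all add: split_vertex_def)

text \<open>By the last conjunct, contracting the fibres of \<open>\<pi>\<close> gives no edges
  beyond those of \<open>G\<close>. Hence copies of two distinct vertices that are not adjacent in
  \<open>G\<close> are not adjacent either, and an edge inserted between them is new.\<close>

lemma expands_properties:
  assumes "expands G H \<pi>" and "pair_graph G"
  shows "pair_graph H \<and> pverts G \<subseteq> pverts H \<and> (\<forall>u\<in>pverts G. \<pi> u = u) \<and>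
    (\<forall>(x, y)\<in>parcs H. \<pi> x = \<pi> y \<or> (\<pi> x, \<pi> y) \<in> parcs G)"
  using assms(1)
proof (induction rule: expands.induct)
  case initial
  then show ?case using assms(2) by auto
next
  case (step H \<pi> r S r')
  have H: "finite (pverts H)" "parcs H \<subseteq> pverts H \<times> pverts H" "sym (parcs H)" "irrefl (parcs H)"
    using step.IH by (auto simp: pair_graph_iff)
  have S: "(r, s) \<in> parcs H \<and> (s, r) \<in> parcs H \<and> s \<noteq> r \<and> s \<in> pverts H" if "s \<in> S" for s
    using that step.hyps H by (auto simp: neighbors_def irrefl_def dest: symD)
  have "pair_graph (split_vertex H r S r')"
    unfolding pair_graph_iff split_vertex_simps
  proof (intro conjI)
    show "sym (parcs H - (S \<times> {r} \<union> {r} \<times> S) \<union> {(r, r'), (r', r)} \<union> (S \<times> {r'} \<union> {r'} \<times> S))"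
      using H(3) by (auto simp: sym_def)
    show "irrefl (parcs H - (S \<times> {r} \<union> {r} \<times> S) \<union> {(r, r'), (r', r)} \<union> (S \<times> {r'} \<union> {r'} \<times> S))"
      using H(4) S step.hyps by (auto simp: irrefl_def)
    show "parcs H - (S \<times> {r} \<union> {r} \<times> S) \<union> {(r, r'), (r', r)} \<union> (S \<times> {r'} \<union> {r'} \<times> S)
        \<subseteq> insert r' (pverts H) \<times> insert r' (pverts H)"
      using H(2) S step.hyps by blast
  qed (use H in simp)
  moreover have "r' \<notin> pverts G" using step by auto
  moreover have "\<forall>(x, y)\<in>parcs (split_vertex H r S r').
      (\<pi>(r' := \<pi> r)) x = (\<pi>(r' := \<pi> r)) y \<or> ((\<pi>(r' := \<pi> r)) x, (\<pi>(r' := \<pi> r)) y) \<in> parcs G"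
  proof (intro ballI, clarify)
    fix x y assume xy: "(x, y) \<in> parcs (split_vertex H r S r')"
      and ne: "((\<pi>(r' := \<pi> r)) x, (\<pi>(r' := \<pi> r)) y) \<notin> parcs G"
    have IH: "\<pi> x = \<pi> y \<or> (\<pi> x, \<pi> y) \<in> parcs G" if "(x, y) \<in> parcs H" for x y
      using step.IH that by auto
    have r': "(x, y) \<in> parcs H \<Longrightarrow> x \<noteq> r' \<and> y \<noteq> r'" for x y using H step.hyps by auto
    \<comment> \<open>The arcs between \<open>r\<close> and \<open>r'\<close> stay within one fibre,
      and an arc between \<open>S\<close> and \<open>r'\<close> has the same image as the arc
      between \<open>S\<close> and \<open>r\<close> that it replaces.\<close>
    from xy consider "(x, y) \<in> parcs H" | "x = r" "y = r'" | "x = r'" "y = r" | "x \<in> S" "y = r'"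
      | "x = r'" "y \<in> S" by auto
    then show "(\<pi>(r' := \<pi> r)) x = (\<pi>(r' := \<pi> r)) y"
      using IH[of x y] IH[of x r] IH[of r y] S[of x] S[of y] r'[of x y] r'[of x r] r'[of r y] ne step.hyps
      by cases (auto split: if_splits)
  qed
  ultimately show ?case using step.IH by auto
qed

text \<open>
  Splittings commute with the insertion of an edge: the new edge follows its two ends through
  the splittings. So an expansion can be built up edge by edge.
\<close>

lemma expands_add_edge:
  assumes "expands G H \<pi>" and G: "pair_graph G"
    and "x \<in> pverts H" "y \<in> pverts H" "\<pi> x \<noteq> \<pi> y" "(\<pi> x, \<pi> y) \<notin> parcs G"
  shows "expands (add_edge G (\<pi> x) (\<pi> y)) (add_edge H x y) \<pi>"
  using assms(1,3-)
proof (induction arbitrary: x y rule: expands.induct)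
  case initial
  then show ?case by (intro expands.initial)
next
  case (step H \<pi> r S r')
  let ?\<pi> = "\<pi>(r' := \<pi> r)"
  have H: "pair_graph H" and adj: "\<And>x y. (x, y) \<in> parcs H \<Longrightarrow> \<pi> x = \<pi> y \<or> (\<pi> x, \<pi> y) \<in> parcs G"
    using expands_properties[OF step.hyps(1) G] by auto
  have sym: "(a, b) \<in> parcs H \<Longrightarrow> (b, a) \<in> parcs H" "(c, d) \<in> parcs G \<Longrightarrow> (d, c) \<in> parcs G" for a b c d
    using sym_parcs[OF H] sym_parcs[OF G] by (auto dest: symD)
  have in_H: "(a, b) \<in> parcs H \<Longrightarrow> a \<in> pverts H \<and> b \<in> pverts H" for a b
    using H by (auto simp: pair_graph_iff)
  \<comment> \<open>An edge that ends at the split-off vertex \<open>r'\<close> is inserted at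
    \<open>r\<close> beforehand; the other end \<open>y\<close> is added to the support, so that the
    splitting moves the edge to \<open>r'\<close>.\<close>
  have new: "expands (add_edge G (\<pi> r) (\<pi> y)) (add_edge (split_vertex H r S r') r' y) ?\<pi>"
    if y: "y \<in> pverts H" "\<pi> r \<noteq> \<pi> y" "(\<pi> r, \<pi> y) \<notin> parcs G" for y
  proof -
    have "(r, y) \<notin> parcs H" "(y, r) \<notin> parcs H" using adj[of r y] adj[of y r] sym y by auto
    then have eq: "add_edge (split_vertex H r S r') r' y = split_vertex (add_edge H r y) r (insert y S) r'"
      using y step.hyps by (auto simp: add_edge_def split_vertex_def)
    show ?thesis
      unfolding eq using y step.hyps step.IH[of r y]
      by (intro expands.step) (auto simp: neighbors_def)
  qed
  consider "x = r'" | "y = r'" | "x \<noteq> r'" "y \<noteq> r'" by auto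
  then show ?case
  proof cases
    case 1
    then have y: "y \<in> pverts H" "\<pi> r \<noteq> \<pi> y" "(\<pi> r, \<pi> y) \<notin> parcs G" and
      eq: "?\<pi> r' = \<pi> r" "?\<pi> y = \<pi> y"
      using step.prems by (auto split: if_splits)
    show ?thesis unfolding \<open>x = r'\<close> eq by (rule new[OF y])
  next
    case 2
    then have x: "x \<in> pverts H" "\<pi> r \<noteq> \<pi> x" "(\<pi> r, \<pi> x) \<notin> parcs G" and
      eq: "?\<pi> r' = \<pi> r" "?\<pi> x = \<pi> x"
      using step.prems sym(2) by (auto split: if_splits)
    show ?thesis
      unfolding \<open>y = r'\<close> eq add_edge_commute[of _ "\<pi> x"] add_edge_commute[of _ x] by (rule new[OF x])
  next
    case 3
    \<comment> \<open>Neither end is \<open>r'\<close>. Since \<open>x\<close> and \<open>y\<close>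
      are not adjacent in \<open>H\<close>, the splitting leaves the new edge in place even if one
      of them is \<open>r\<close>.\<close>
    have "(x, y) \<notin> parcs H" "(y, x) \<notin> parcs H"
      using 3 step.prems adj[of x y] adj[of y x] sym by auto
    then have eq: "add_edge (split_vertex H r S r') x y = split_vertex (add_edge H x y) r S r'"
      using 3 step.hyps sym by (auto simp: add_edge_def split_vertex_def neighbors_def)
    show ?thesis
      unfolding eq using 3 step.prems step.hyps step.IH[of x y]
      by (intro expands.step) (auto simp: neighbors_def)
  qed
qed

lemma expands_pendant:
  assumes "expands G H \<pi>" "r \<in> pverts H" "x \<notin> pverts H"
  shows "expands G \<lparr>pverts = insert x (pverts H), parcs = parcs H \<union> {(r, x), (x, r)}\<rparr> (\<pi>(x := \<pi> r))"
  using expands.step[OF assms(1,2) empty_subsetI assms(3)] by (simp add: split_vertex_def)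

section \<open>The algorithm\<close>

text \<open>
  The key \<open>(t, u)\<close> stands for vertex \<open>u\<close> at bag \<open>t\<close>. The first entry of a key in \<open>reps\<close> is its
  current representative; later entries are outdated. The new vertices are \<open>f 0, f 1, \<dots>\<close>, and
  \<open>used\<close> is the number of those already taken.
\<close>

record 'a state =
  reps :: "((nat \<times> 'a) \<times> 'a) list"
  used :: nat
  vlist :: "'a list"
  elist :: "('a \<times> 'a) list"

text \<open>A key without an entry yields its own vertex, so the copy of \<open>u\<close> starts
  with \<open>u\<close> itself.\<close>

definition rep :: "'a state \<Rightarrow> nat \<times> 'a \<Rightarrow> 'a" where
  "rep st k = (case map_of (reps st) k of None \<Rightarrow> snd k | Some r \<Rightarrow> r)"

definition grow :: "(nat \<Rightarrow> 'a) \<Rightarrow> nat \<times> 'a \<Rightarrow> 'a state \<Rightarrow> 'a state" where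
  "grow f k st = (case map_of (reps st) k of None \<Rightarrow> st
     | Some r \<Rightarrow> \<lparr>reps = (k, f (used st)) # reps st, used = Suc (used st),
         vlist = f (used st) # vlist st, elist = (r, f (used st)) # elist st\<rparr>)"

definition share :: "nat \<times> 'a \<Rightarrow> nat \<times> 'a \<Rightarrow> 'a state \<Rightarrow> 'a state" where
  "share k k' st = st\<lparr>reps := (k', rep st k) # reps st\<rparr>"

definition join :: "nat \<times> 'a \<Rightarrow> nat \<times> 'a \<Rightarrow> 'a state \<Rightarrow> 'a state" where
  "join k k' st = st\<lparr>elist := (rep st k, rep st k') # elist st\<rparr>"

text \<open>For a vertex without an entry at \<open>a\<close>, growing is idle and the entry at
  \<open>b\<close> becomes the vertex itself. With \<open>a = b\<close> the same function therefore
  sets up the root.\<close>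

definition fork :: "(nat \<Rightarrow> 'a) \<Rightarrow> nat \<Rightarrow> nat \<Rightarrow> 'a list \<Rightarrow> 'a state \<Rightarrow> 'a state" where
  "fork f a b = fold (\<lambda>u st. share (a, u) (b, u) (grow f (a, u) st))"

definition bag_of :: "(nat \<times> 'a list) list \<Rightarrow> nat \<Rightarrow> 'a list" where
  "bag_of bags t = (case map_of bags t of None \<Rightarrow> [] | Some b \<Rightarrow> b)"

fun cross :: "(nat \<Rightarrow> 'a) \<Rightarrow> (nat \<times> 'a list) list \<Rightarrow> nat \<Rightarrow> nat \<Rightarrow>
    nat list \<times> 'a state \<Rightarrow> nat list \<times> 'a state" where
  "cross f bags a b (W, st) =
     (if a \<in> set W \<and> b \<notin> set W then (b # W, fork f a b (bag_of bags b) st) else (W, st))"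

definition sweep :: "(nat \<Rightarrow> 'a) \<Rightarrow> (nat \<times> 'a list) list \<Rightarrow> (nat \<times> nat) list \<Rightarrow>
    nat list \<times> 'a state \<Rightarrow> nat list \<times> 'a state" where
  "sweep f bags = fold (\<lambda>(a, b) w. cross f bags b a (cross f bags a b w))"

fun home :: "'a \<Rightarrow> 'a \<Rightarrow> (nat \<times> 'a list) list \<Rightarrow> nat" where
  "home u v [] = 0"
| "home u v ((t, b) # bags) = (if u \<in> set b \<and> v \<in> set b then t else home u v bags)"

fun link :: "(nat \<Rightarrow> 'a) \<Rightarrow> nat \<Rightarrow> 'a \<times> 'a \<Rightarrow> 'a state \<Rightarrow> 'a state" where
  "link f t (u, v) st = join (t, u) (t, v) (grow f (t, v) (grow f (t, u) st))"

definition links :: "(nat \<Rightarrow> 'a) \<Rightarrow> (nat \<times> 'a list) list \<Rightarrow> ('a \<times> 'a) list \<Rightarrow> 'a state \<Rightarrow> 'a state" where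
  "links f bags = fold (\<lambda>(u, v). link f (home u v bags) (u, v))"

definition start :: "(nat \<Rightarrow> 'a) \<Rightarrow> (nat \<times> 'a list) list \<Rightarrow> 'a list \<Rightarrow> nat list \<times> 'a state" where
  "start f bags vs = (let (t, b) = hd bags in
     ([t], fork f t t b \<lparr>reps = [], used = 0, vlist = vs, elist = []\<rparr>))"

text \<open>The list \<open>bags\<close> also serves as a unary counter for the sweeps: each sweep
  visits a new bag unless all have been visited.\<close>

definition ternarize :: "(nat \<Rightarrow> 'a) \<Rightarrow> 'a list \<Rightarrow> ('a \<times> 'a) list \<Rightarrow> (nat \<times> nat) list \<Rightarrow>
    (nat \<times> 'a list) list \<Rightarrow> 'a state" where
  "ternarize f vs es ts bags =
     links f bags es (snd (fold (\<lambda>_. sweep f bags ts) bags (start f bags vs)))"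

declare cross.simps [simp del] link.simps [simp del]

definition graph :: "'a state \<Rightarrow> 'a pair_pre_digraph" where
  "graph st = \<lparr>pverts = set (vlist st), parcs = set (elist st) \<union> (set (elist st))\<inverse>\<rparr>"

text \<open>
  Invariant: the load is at most 3. Growing moves one unit from the use of a representative to its
  degree, and the new representative has load 2, which leaves room for a share or a join.
\<close>

definition load :: "'a state \<Rightarrow> 'a \<Rightarrow> nat" where
  "load st x = deg (graph st) x + card {k. map_of (reps st) k = Some x}"

lemma finite_map_of_eq: "finite {k. map_of xs k = Some x}"
  by (rule finite_subset[OF _ finite_dom_map_of[of xs]]) auto

lemma finite_neighbors_graph: "finite (neighbors (graph st) x)"
proof (rule finite_subset)
  show "neighbors (graph st) x \<subseteq> fst ` set (elist st) \<union> snd ` set (elist st)"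
    by (force simp: neighbors_def graph_def)
qed simp

section \<open>Invariants of the growing expansion and of its bags\<close>

locale ternarization =
  fixes G :: "'a pair_pre_digraph" and T :: "nat pair_pre_digraph" and B :: "nat \<Rightarrow> 'a set"
    and f :: "nat \<Rightarrow> 'a"
  assumes G: "pair_graph G" and td: "tree_decomposition G T B"
    and f: "inj f" "range f \<inter> pverts G = {}"
begin

abbreviation V where "V \<equiv> pverts G"

definition partial :: "'a rel \<Rightarrow> 'a pair_pre_digraph" where
  "partial E = \<lparr>pverts = V, parcs = E\<rparr>"

text \<open>\<open>E\<close> is the set of edges inserted so far. The two distinctness clauses are
  invisible in \<open>graph st\<close>, but the encoding of the output demands them. The clause
  about \<open>used\<close> makes \<open>f (used st)\<close> a new vertex, and
  \<open>\<pi> r = snd k\<close> says of which vertex a representative is a copy.\<close>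

definition inv_graph :: "'a rel \<Rightarrow> 'a state \<Rightarrow> ('a \<Rightarrow> 'a) \<Rightarrow> bool" where
  "inv_graph E st \<pi> \<longleftrightarrow>
     expands (partial E) (graph st) \<pi> \<and> distinct (vlist st) \<and>
     distinct (map (\<lambda>(u, v). {u, v}) (elist st)) \<and>
     set (vlist st) \<subseteq> V \<union> f ` {..<used st} \<and>
     (\<forall>k r. map_of (reps st) k = Some r \<longrightarrow> r \<in> set (vlist st) \<and> \<pi> r = snd k) \<and>
     (\<forall>x\<in>set (vlist st). load st x \<le> 3)"

text \<open>\<open>W\<close> is the set of visited bags; for each of them some member of
  \<open>\<B>\<close>, its slot, holds all current representatives. A vertex of \<open>G\<close>
  that no visited bag contains is present in \<open>vlist\<close>, but in no member of
  \<open>\<B>\<close>. This is why the last three clauses replace an equation for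
  \<open>\<Union>\<B>\<close>; they imply the equation once every vertex has been met.\<close>

definition inv_bags :: "nat set \<Rightarrow> 'a state \<Rightarrow> ('a \<Rightarrow> 'a) \<Rightarrow> 'a set set \<Rightarrow> bool" where
  "inv_bags W st \<pi> \<B> \<longleftrightarrow>
     bag_family \<B> \<and> \<Union>\<B> \<subseteq> set (vlist st) \<and> (\<forall>C\<in>\<B>. int (card C) \<le> width T B + 2) \<and>
     set (elist st) \<subseteq> (\<Union>C\<in>\<B>. C \<times> C) \<and>
     (\<forall>t\<in>W. (\<forall>u\<in>B t. map_of (reps st) (t, u) \<noteq> None) \<and> (\<exists>C\<in>\<B>. \<forall>u\<in>B t. rep st (t, u) \<in> C)) \<and>
     set (vlist st) - V \<subseteq> \<Union>\<B> \<and> V \<inter> \<Union>(B ` W) \<subseteq> \<Union>\<B> \<and> \<pi> ` \<Union>\<B> \<subseteq> \<Union>(B ` W)"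

definition invariant :: "nat set \<Rightarrow> 'a rel \<Rightarrow> 'a state \<Rightarrow> bool" where
  "invariant W E st \<longleftrightarrow> (\<exists>\<pi> \<B>. inv_graph E st \<pi> \<and> inv_bags W st \<pi> \<B>)"

lemma inv_bagsD:
  assumes "inv_bags W st \<pi> \<B>"
  shows "bag_family \<B>" "\<Union>\<B> \<subseteq> set (vlist st)" "\<And>C. C \<in> \<B> \<Longrightarrow> int (card C) \<le> width T B + 2"
    "set (elist st) \<subseteq> (\<Union>C\<in>\<B>. C \<times> C)"
    "\<And>t u. t \<in> W \<Longrightarrow> u \<in> B t \<Longrightarrow> map_of (reps st) (t, u) \<noteq> None"
    "\<And>t. t \<in> W \<Longrightarrow> \<exists>C\<in>\<B>. \<forall>u\<in>B t. rep st (t, u) \<in> C"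
    "set (vlist st) - V \<subseteq> \<Union>\<B>" "V \<inter> \<Union>(B ` W) \<subseteq> \<Union>\<B>" "\<pi> ` \<Union>\<B> \<subseteq> \<Union>(B ` W)"
  using assms unfolding inv_bags_def by simp_all

lemma tree: "pair_graph T" "finite (pverts T)" "parcs T \<subseteq> pverts T \<times> pverts T" "sym (parcs T)"
  using td by (auto simp: tree_decomposition_def undirected_tree_iff pair_graph_iff)

lemma bag_subset: "t \<in> pverts T \<Longrightarrow> B t \<subseteq> V"
  using td by (auto simp: tree_decomposition_def)

lemma finite_bag: "t \<in> pverts T \<Longrightarrow> finite (B t)"
  using bag_subset G by (meson finite_subset pair_graph_iff)

lemma pair_graph_partial:
  assumes "E \<subseteq> parcs G" "sym E" shows "pair_graph (partial E)"
  using assms G by (auto simp: pair_graph_iff partial_def irrefl_def)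

lemma grow_inv:
  assumes "invariant W E st" "t \<in> W" "u \<in> B t" "W \<subseteq> pverts T" "E \<subseteq> parcs G" "sym E"
  defines "x \<equiv> f (used st)"
  defines "st' \<equiv> grow f (t, u) st"
  shows "invariant W E st'" "map_of (reps st') = (map_of (reps st))((t, u) \<mapsto> x)"
    "set (vlist st') = insert x (set (vlist st))" "load st' x \<le> 2"
    "\<And>y. y \<in> set (vlist st) \<Longrightarrow> load st' y = load st y" "used st' = Suc (used st)"
proof -
  obtain \<pi> \<B> where g: "inv_graph E st \<pi>" and b: "inv_bags W st \<pi> \<B>"
    using assms(1) unfolding invariant_def by blast
  obtain r where r: "map_of (reps st) (t, u) = Some r"
    using inv_bagsD(5)[OF b assms(2,3)] by blast
  have rv: "r \<in> set (vlist st)" and \<pi>r: "\<pi> r = u" using g r by (auto simp: inv_graph_def)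
  have st': "st' = \<lparr>reps = ((t, u), x) # reps st, used = Suc (used st),
         vlist = x # vlist st, elist = (r, x) # elist st\<rparr>"
    by (simp add: st'_def grow_def r x_def)
  show reps': "map_of (reps st') = (map_of (reps st))((t, u) \<mapsto> x)"
    and vlist': "set (vlist st') = insert x (set (vlist st))" and "used st' = Suc (used st)"
    by (simp_all add: st')
  have "x \<notin> V" using f by (auto simp: x_def)
  moreover have "x \<notin> f ` {..<used st}" using f by (auto simp: x_def dest: injD)
  ultimately have x: "x \<notin> set (vlist st)" using g by (auto simp: inv_graph_def)
  then have "x \<noteq> r" using rv by auto
  have exp: "expands (partial E) (graph st) \<pi>" using g by (simp add: inv_graph_def)
  have pg: "pair_graph (graph st)"
    using expands_properties[OF exp pair_graph_partial[OF assms(5,6)]] by blast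
  then have ends: "set (elist st) \<subseteq> set (vlist st) \<times> set (vlist st)"
    by (auto simp: pair_graph_iff graph_def)
  have graph': "graph st' = \<lparr>pverts = insert x (pverts (graph st)),
      parcs = parcs (graph st) \<union> {(r, x), (x, r)}\<rparr>"
    by (auto simp: graph_def st')
  have "neighbors (graph st') x = {r}"
    using x ends by (auto simp: neighbors_def graph_def st')
  \<comment> \<open>Representatives are vertices and \<open>x\<close> is new, so no key other than
    \<open>(t, u)\<close> leads to \<open>x\<close>.\<close>
  moreover have "{k. map_of (reps st') k = Some x} \<subseteq> {(t, u)}"
    using g x by (auto simp: reps' inv_graph_def)
  then have "card {k. map_of (reps st') k = Some x} \<le> 1"
    using card_mono[of "{(t, u)}"] by fastforce
  ultimately show new: "load st' x \<le> 2" by (simp add: load_def deg_def)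
  show old: "load st' y = load st y" if y: "y \<in> set (vlist st)" for y
  proof (cases "y = r")
    case True
    have "neighbors (graph st') r = insert x (neighbors (graph st) r)"
      using \<open>x \<noteq> r\<close> by (auto simp: neighbors_def graph')
    moreover have "x \<notin> neighbors (graph st) r" using x ends by (auto simp: neighbors_def graph_def)
    ultimately have d: "deg (graph st') r = Suc (deg (graph st) r)"
      by (simp add: deg_def finite_neighbors_graph)
    have "{k. map_of (reps st) k = Some r} = insert (t, u) {k. map_of (reps st') k = Some r}"
      using r \<open>x \<noteq> r\<close> by (auto simp: reps')
    moreover have "(t, u) \<notin> {k. map_of (reps st') k = Some r}" using \<open>x \<noteq> r\<close> by (simp add: reps')
    ultimately have "card {k. map_of (reps st) k = Some r} = Suc (card {k. map_of (reps st') k = Some r})"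
      by (simp add: finite_map_of_eq)
    then show ?thesis using d True by (simp add: load_def)
  next
    case False
    have "x \<noteq> y" using x y by auto
    then have "neighbors (graph st') y = neighbors (graph st) y"
      using False by (auto simp: neighbors_def graph')
    moreover have "{k. map_of (reps st') k = Some y} = {k. map_of (reps st) k = Some y}"
      using r False \<open>x \<noteq> y\<close> by (auto simp: reps')
    ultimately show ?thesis by (simp add: load_def deg_def)
  qed
  define \<pi>' where "\<pi>' = \<pi>(x := \<pi> r)"
  have "expands (partial E) (graph st') \<pi>'"
    unfolding graph' \<pi>'_def using exp by (rule expands_pendant) (use rv x in \<open>auto simp: graph_def\<close>)
  moreover have "{r, x} \<notin> (\<lambda>(u, v). {u, v}) ` set (elist st)"
    using ends x by (auto simp: doubleton_eq_iff)
  moreover have "f ` {..<Suc (used st)} = insert x (f ` {..<used st})"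
    by (simp add: lessThan_Suc x_def)
  moreover have "\<forall>k s. map_of (reps st') k = Some s \<longrightarrow> s \<in> set (vlist st') \<and> \<pi>' s = snd k"
    using g x \<pi>r by (auto simp: reps' vlist' \<pi>'_def inv_graph_def)
  moreover have "\<forall>y\<in>set (vlist st'). load st' y \<le> 3"
    using g old new by (auto simp: vlist' inv_graph_def)
  ultimately have g': "inv_graph E st' \<pi>'"
    using g x by (auto simp: inv_graph_def st')
  \<comment> \<open>The representatives at \<open>t\<close> before the change. They lie in one old
    bag \<open>C\<close>, and \<open>x\<close> lies in none, so \<open>insert x R\<close> can be
    attached to \<open>C\<close>. It covers the edge between \<open>r\<close> and \<open>x\<close>
    and contains all representatives at \<open>t\<close> afterwards.\<close>
  define R where "R = rep st ` ({t} \<times> B t)"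
  obtain C where C: "C \<in> \<B>" "R \<subseteq> C" using inv_bagsD(6)[OF b assms(2)] unfolding R_def by blast
  have rR: "r \<in> R" using r assms(3) by (auto simp: R_def rep_def intro!: image_eqI[of _ _ "(t, u)"])
  have xB: "x \<notin> \<Union>\<B>" using x b by (auto simp: inv_bags_def)
  have tT: "t \<in> pverts T" using assms(2,4) by auto
  have "finite R" "card R \<le> card (B t)"
    using finite_bag[OF tT] card_image_le[of "{t} \<times> B t" "rep st"]
    by (auto simp: R_def card_cartesian_product_singleton)
  \<comment> \<open>\<open>R\<close> is no larger than \<open>B t\<close>, hence has at most
    \<open>width T B + 1\<close> elements; the bound leaves room for just the one vertex
    \<open>x\<close>.\<close>
  then have card: "int (card (insert x R)) \<le> width T B + 2"
    using tree_decomposition_card[OF td tT] by (simp add: card_insert_if)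
  have RV: "R \<subseteq> set (vlist st)" using inv_bagsD(2)[OF b] C by auto
  have U: "\<Union>(insert (insert x R) \<B>) = insert x (\<Union>\<B>)" using C by auto
  have slot: "\<exists>C\<in>insert (insert x R) \<B>. \<forall>v\<in>B s. rep st' (s, v) \<in> C" if "s \<in> W" for s
  proof (cases "s = t")
    case True
    then have "\<forall>v\<in>B s. rep st' (s, v) \<in> insert x R"
      by (auto simp: rep_def reps' R_def)
    then show ?thesis by blast
  next
    case False
    then have "rep st' (s, v) = rep st (s, v)" for v by (simp add: rep_def reps')
    then show ?thesis using inv_bagsD(6)[OF b that] by auto
  qed
  have "inv_bags W st' \<pi>' (insert (insert x R) \<B>)"
    unfolding inv_bags_def U vlist'
  proof (intro conjI ballI)
    show "bag_family (insert (insert x R) \<B>)"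
      using C xB inv_bagsD(1)[OF b] by (intro bag_family.attach[OF _ C(1)]) auto
    show "insert x (\<Union>\<B>) \<subseteq> insert x (set (vlist st))" using inv_bagsD(2)[OF b] by blast
    show "set (elist st') \<subseteq> (\<Union>C\<in>insert (insert x R) \<B>. C \<times> C)"
      using inv_bagsD(4)[OF b] rR by (auto simp: st')
    show "insert x (set (vlist st)) - V \<subseteq> insert x (\<Union>\<B>)" using inv_bagsD(7)[OF b] by blast
    show "V \<inter> \<Union>(B ` W) \<subseteq> insert x (\<Union>\<B>)" using inv_bagsD(8)[OF b] by blast
    have "\<pi>' x \<in> \<Union>(B ` W)" using \<pi>r assms(2,3) by (auto simp: \<pi>'_def)
    moreover have "\<pi>' y \<in> \<Union>(B ` W)" if "y \<in> \<Union>\<B>" for y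
    proof -
      have "\<pi>' y = \<pi> y" using that xB by (auto simp: \<pi>'_def)
      then show ?thesis using inv_bagsD(9)[OF b] that by blast
    qed
    ultimately show "\<pi>' ` insert x (\<Union>\<B>) \<subseteq> \<Union>(B ` W)" by blast
  next
    fix D assume "D \<in> insert (insert x R) \<B>"
    then show "int (card D) \<le> width T B + 2" using card inv_bagsD(3)[OF b] by blast
  next
    fix s v assume "s \<in> W" "v \<in> B s"
    then show "map_of (reps st') (s, v) \<noteq> None" using inv_bagsD(5)[OF b] by (simp add: reps')
  qed (rule slot)
  with g' show "invariant W E st'" by (auto simp: invariant_def)
qed

lemma inv_graph_expands: 
  assumes "inv_graph E st \<pi>" "E \<subseteq> parcs G" "sym E"
  shows "V \<subseteq> set (vlist st)" "\<And>u. u \<in> V \<Longrightarrow> \<pi> u = u"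
    "\<And>x y. (x, y) \<in> parcs (graph st) \<Longrightarrow> \<pi> x = \<pi> y \<or> (\<pi> x, \<pi> y) \<in> E"
proof -
  have "expands (partial E) (graph st) \<pi>" using assms(1) by (simp add: inv_graph_def)
  from expands_properties[OF this pair_graph_partial[OF assms(2,3)]]
  have p: "pair_graph (graph st) \<and> V \<subseteq> pverts (graph st) \<and> (\<forall>u\<in>V. \<pi> u = u) \<and>
    (\<forall>(x, y)\<in>parcs (graph st). \<pi> x = \<pi> y \<or> (\<pi> x, \<pi> y) \<in> E)"
    by (simp add: partial_def)
  then show "V \<subseteq> set (vlist st)" "\<And>u. u \<in> V \<Longrightarrow> \<pi> u = u"
    "\<And>x y. (x, y) \<in> parcs (graph st) \<Longrightarrow> \<pi> x = \<pi> y \<or> (\<pi> x, \<pi> y) \<in> E"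
    by (auto simp: graph_def)
qed

text \<open>An edge at \<open>u\<close> would put \<open>u\<close> into a member of
  \<open>\<B>\<close>, whose elements project to vertices of visited bags, while
  \<open>\<pi> u = u\<close>. A key represented by \<open>u\<close> would have \<open>u\<close> as
  its second component, by the same equation.\<close>

lemma load_eq_0:
  assumes "invariant W E st" "u \<in> V" "u \<notin> \<Union>(B ` W)" "E \<subseteq> parcs G" "sym E"
    and none: "\<And>t. map_of (reps st) (t, u) = None"
  shows "load st u = 0"
proof -
  obtain \<pi> \<B> where g: "inv_graph E st \<pi>" and b: "inv_bags W st \<pi> \<B>"
    using assms(1) unfolding invariant_def by blast
  have "u \<notin> \<Union>\<B>"
  proof
    assume "u \<in> \<Union>\<B>"
    then have "\<pi> u \<in> \<Union>(B ` W)" using inv_bagsD(9)[OF b] by blast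
    then show False using inv_graph_expands(2)[OF g assms(4,5,2)] assms(3) by simp
  qed
  moreover have "set (elist st) \<subseteq> \<Union>\<B> \<times> \<Union>\<B>" using inv_bagsD(4)[OF b] by blast
  ultimately have "neighbors (graph st) u = {}" by (auto simp: neighbors_def graph_def)
  moreover have "map_of (reps st) k \<noteq> Some u" for k
  proof
    assume k: "map_of (reps st) k = Some u"
    then have "\<pi> u = snd k" using g unfolding inv_graph_def by blast
    then show False using k none[of "fst k"] inv_graph_expands(2)[OF g assms(4,5,2)] by simp
  qed
  ultimately show ?thesis by (simp add: load_def deg_def)
qed

text \<open>Sharing leaves the graph alone and costs the representative one unit of load. As
  \<open>b\<close> is not in \<open>W\<close>, no slot depends on the new key, and the family of
  bags stays the same.\<close>

lemma share_inv:
  assumes "invariant W E st" "E \<subseteq> parcs G" "sym E" "b \<notin> W" "map_of (reps st) (b, u) = None"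
    and r: "map_of (reps st) (a, u) \<noteq> None \<or> u \<in> V" "load st (rep st (a, u)) \<le> 2"
  shows "invariant W E (share (a, u) (b, u) st)"
proof -
  obtain \<pi> \<B> where g: "inv_graph E st \<pi>" and b: "inv_bags W st \<pi> \<B>"
    using assms(1) unfolding invariant_def by blast
  let ?r = "rep st (a, u)" and ?st = "share (a, u) (b, u) st"
  have simps: "vlist ?st = vlist st" "elist ?st = elist st" "graph ?st = graph st" "used ?st = used st"
    "map_of (reps ?st) = (map_of (reps st))((b, u) \<mapsto> ?r)"
    by (simp_all add: share_def graph_def)
  have rV: "?r \<in> set (vlist st) \<and> \<pi> ?r = u"
  proof (cases "map_of (reps st) (a, u)")
    case None
    then show ?thesis using r inv_graph_expands(1,2)[OF g assms(2,3)] by (auto simp: rep_def)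
  next
    case (Some s)
    then show ?thesis using g unfolding inv_graph_def by (fastforce simp: rep_def)
  qed
  have "load ?st x \<le> 3" if "x \<in> set (vlist st)" for x
  proof (cases "x = ?r")
    case True
    have sub: "{k. map_of (reps ?st) k = Some x} \<subseteq> insert (b, u) {k. map_of (reps st) k = Some x}"
      by (auto simp: simps)
    have "card {k. map_of (reps ?st) k = Some x} \<le> Suc (card {k. map_of (reps st) k = Some x})"
      using card_mono[OF _ sub] by (simp add: finite_map_of_eq card_insert_if split: if_splits)
    then show ?thesis using r(2) True by (simp add: load_def simps(3))
  next
    case False
    then have "{k. map_of (reps ?st) k = Some x} = {k. map_of (reps st) k = Some x}"
      using assms(5) by (auto simp: simps)
    then show ?thesis using g that by (simp add: load_def simps(3) inv_graph_def)
  qed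
  then have "inv_graph E ?st \<pi>"
    using g rV by (auto simp: inv_graph_def simps)
  moreover have "rep ?st (t, v) = rep st (t, v)" "map_of (reps ?st) (t, v) = map_of (reps st) (t, v)"
    if "t \<in> W" for t v
    using that assms(4) by (auto simp: rep_def simps)
  then have "inv_bags W ?st \<pi> \<B>"
    using b by (simp add: inv_bags_def simps(1,2))
  ultimately show ?thesis unfolding invariant_def by blast
qed

text \<open>Kept for all processed vertices until the loop over the bag \<open>b\<close> ends. It
  then shows that the representatives at \<open>b\<close> meet the old bags only inside the slot of
  \<open>a\<close>.\<close>

definition shared :: "nat set \<Rightarrow> nat \<Rightarrow> nat \<Rightarrow> 'a state \<Rightarrow> 'a \<Rightarrow> bool" where
  "shared W a b st u \<longleftrightarrow> rep st (b, u) = (if a \<in> W \<and> u \<in> B a then rep st (a, u) else u)"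

text \<open>While the loop runs, only some of the keys at \<open>b\<close> have entries, so the
  invariant is kept for \<open>W\<close> without \<open>b\<close>; the domain clause records the
  progress. The induction is from the right because \<open>fork\<close> is a left fold. The
  alternative \<open>a = b\<close> with empty \<open>W\<close> is the root.\<close>

lemma fork_loop:
  assumes "invariant W E st" "W \<subseteq> pverts T" "E \<subseteq> parcs G" "sym E" "b \<in> pverts T" "b \<notin> W"
    and a: "a \<in> W \<or> a = b \<and> W = {}"
    and ri: "B b \<inter> \<Union>(B ` W) \<subseteq> (if a \<in> W then B a else {})"
    and dom: "dom (map_of (reps st)) = Sigma W B"
    and us: "distinct us" "set us \<subseteq> B b"
  shows "invariant W E (fork f a b us st) \<and>
    dom (map_of (reps (fork f a b us st))) = Sigma W B \<union> {b} \<times> set us \<and>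
    (\<forall>u\<in>set us. shared W a b (fork f a b us st) u)"
  using us
proof (induction us rule: rev_induct)
  case Nil
  then show ?case using assms(1) dom by (simp add: fork_def)
next
  case (snoc u us)
  define st1 where "st1 = fork f a b us st"
  define st2 where "st2 = grow f (a, u) st1"
  have st3: "fork f a b (us @ [u]) st = share (a, u) (b, u) st2"
    by (simp add: fork_def st1_def st2_def)
  have I1: "invariant W E st1" and dom1: "dom (map_of (reps st1)) = Sigma W B \<union> {b} \<times> set us"
    and sh1: "\<forall>v\<in>set us. shared W a b st1 v"
    using snoc by (auto simp: st1_def)
  have u: "u \<in> B b" "u \<notin> set us" "u \<in> V" using snoc.prems bag_subset[OF assms(5)] by auto
  have bu: "map_of (reps st1) (b, u) = None"
    using dom1 assms(6) u by (auto simp: domIff[symmetric] simp del: domIff)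
  have 2: "invariant W E st2 \<and> map_of (reps st2) (b, u) = None \<and>
      dom (map_of (reps st2)) = Sigma W B \<union> {b} \<times> set us \<and>
      (\<forall>v\<in>set us. shared W a b st2 v) \<and> load st2 (rep st2 (a, u)) \<le> 2 \<and>
      (a \<in> W \<and> u \<in> B a \<or> rep st2 (a, u) = u)"
  proof (cases "a \<in> W \<and> u \<in> B a")
    case True
    note gr = grow_inv[OF I1 conjunct1[OF True] conjunct2[OF True] assms(2-4), folded st2_def]
    have "b \<noteq> a" using True assms(6) by auto
    then have "shared W a b st2 v" if "v \<in> set us" for v
      using that u(2) sh1 by (auto simp: shared_def rep_def gr(2))
    moreover have "rep st2 (a, u) = f (used st1)" by (simp add: rep_def gr(2))
    ultimately show ?thesis
      using gr(1,4) True dom1 bu \<open>b \<noteq> a\<close> by (auto simp: gr(2))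
  next
    case False
    then have "map_of (reps st1) (a, u) = None"
      using a dom1 assms(6) u by (auto simp: domIff[symmetric] simp del: domIff)
    then have st2: "st2 = st1" and rep: "rep st1 (a, u) = u" by (simp_all add: st2_def grow_def rep_def)
    have "u \<notin> \<Union>(B ` W)" using False ri u a by (auto split: if_splits)
    moreover have "map_of (reps st1) (t, u) = None" for t
      using calculation dom1 u by (auto simp: domIff[symmetric] simp del: domIff)
    ultimately have "load st1 u = 0" using load_eq_0[OF I1 u(3) _ assms(3,4)] by blast
    then show ?thesis using I1 bu dom1 sh1 rep by (simp add: st2)
  qed
  have "map_of (reps st2) (a, u) \<noteq> None \<or> u \<in> V" using u by simp
  then have "invariant W E (share (a, u) (b, u) st2)"
    using share_inv[OF _ assms(3,4,6)] 2 by blast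
  moreover have m: "map_of (reps (share (a, u) (b, u) st2)) = (map_of (reps st2))((b, u) \<mapsto> rep st2 (a, u))"
    by (simp add: share_def)
  moreover have "shared W a b (share (a, u) (b, u) st2) v" if "v \<in> set (us @ [u])" for v
  proof (cases "v = u")
    case True
    have "a \<in> W \<Longrightarrow> a \<noteq> b" using assms(6) by auto
    then show ?thesis using 2 True by (auto simp: shared_def rep_def m)
  next
    case False
    then have "shared W a b st2 v" using 2 that by auto
    then show ?thesis using False by (auto simp: shared_def rep_def m)
  qed
  moreover have "dom (map_of (reps (share (a, u) (b, u) st2))) = Sigma W B \<union> {b} \<times> set (us @ [u])"
    unfolding m dom_fun_upd using 2 by auto
  ultimately show ?case unfolding st3 by blast
qed

text \<open>The set \<open>D\<close> of representatives at \<open>b\<close> is attached to the slot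
  of \<open>a\<close>. An element of \<open>D\<close> is the representative at \<open>a\<close> as
  well, or an unsplit vertex \<open>u\<close>. In the latter case an old bag containing
  \<open>u\<close> would force \<open>u\<close> into a visited bag, contrary to running
  intersection.\<close>

lemma fork_inv:
  assumes "invariant W E st" "W \<subseteq> pverts T" "E \<subseteq> parcs G" "sym E" "b \<in> pverts T" "b \<notin> W"
    and "a \<in> W \<or> a = b \<and> W = {}"
    and ri: "B b \<inter> \<Union>(B ` W) \<subseteq> (if a \<in> W then B a else {})"
    and "dom (map_of (reps st)) = Sigma W B"
    and us: "distinct us" "set us = B b"
  shows "invariant (insert b W) E (fork f a b us st)"
    "dom (map_of (reps (fork f a b us st))) = Sigma (insert b W) B"
proof -
  let ?st = "fork f a b us st"
  have st: "invariant W E ?st" and dom: "dom (map_of (reps ?st)) = Sigma W B \<union> {b} \<times> B b"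
    and sh: "\<And>u. u \<in> B b \<Longrightarrow> rep ?st (b, u) = (if a \<in> W \<and> u \<in> B a then rep ?st (a, u) else u)"
    using fork_loop[OF assms(1-9) us(1)] us(2) by (simp_all add: shared_def)
  from dom show "dom (map_of (reps ?st)) = Sigma (insert b W) B" by auto
  obtain \<pi> \<B> where g: "inv_graph E ?st \<pi>" and bg: "inv_bags W ?st \<pi> \<B>"
    using st unfolding invariant_def by blast
  define D where "D = rep ?st ` ({b} \<times> B b)"
  \<comment> \<open>At the root there is no slot yet. Any bag of the family serves as
    \<open>C\<close>, because the representatives there occur in no old bag.\<close>
  have C: "\<exists>C\<in>\<B>. a \<in> W \<longrightarrow> (\<forall>u\<in>B a. rep ?st (a, u) \<in> C)"
    using inv_bagsD(6)[OF bg] bag_family_nonempty[OF inv_bagsD(1)[OF bg]] by (cases "a \<in> W") auto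
  then obtain C where C: "C \<in> \<B>" "a \<in> W \<Longrightarrow> u \<in> B a \<Longrightarrow> rep ?st (a, u) \<in> C" for u by blast
  have \<pi>: "\<pi> u = u" if "u \<in> B b" for u
    using inv_graph_expands(2)[OF g assms(3,4)] bag_subset[OF assms(5)] that by auto
  have "D \<inter> \<Union>\<B> \<subseteq> C"
  proof
    fix x assume x: "x \<in> D \<inter> \<Union>\<B>"
    then obtain u where u: "u \<in> B b" "x = rep ?st (b, u)" by (auto simp: D_def)
    show "x \<in> C"
    proof (cases "a \<in> W \<and> u \<in> B a")
      case True
      then show ?thesis using u sh C by simp
    next
      case False
      then have "x = u" using u sh by auto
      then have "\<pi> u \<in> \<Union>(B ` W)" using x inv_bagsD(9)[OF bg] by blast
      then have "u \<in> \<Union>(B ` W)" using \<pi>[OF u(1)] by simp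
      then show ?thesis using False ri u(1) by (auto split: if_splits)
    qed
  qed
  then have fam: "bag_family (insert D \<B>)" by (rule bag_family.attach[OF inv_bagsD(1)[OF bg] C(1)])
  have rep: "rep ?st (b, u) \<in> set (vlist ?st) \<and> \<pi> (rep ?st (b, u)) = u" if "u \<in> B b" for u
  proof -
    have "(b, u) \<in> dom (map_of (reps ?st))" using dom that by auto
    then obtain r where "map_of (reps ?st) (b, u) = Some r" by auto
    then show ?thesis using g unfolding inv_graph_def by (fastforce simp: rep_def)
  qed
  have "card D \<le> card (B b)"
    using finite_bag[OF assms(5)] card_image_le[of "{b} \<times> B b" "rep ?st"]
    by (auto simp: D_def card_cartesian_product_singleton)
  then have card: "int (card D) \<le> width T B + 2"
    using tree_decomposition_card[OF td assms(5)] by simp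
  \<comment> \<open>A vertex shared with \<open>B a\<close> may have another representative at
    \<open>b\<close>, but then it lies itself in an earlier bag.\<close>
  have "B b \<subseteq> D \<union> \<Union>\<B>"
  proof
    fix u assume u: "u \<in> B b"
    show "u \<in> D \<union> \<Union>\<B>"
    proof (cases "a \<in> W \<and> u \<in> B a")
      case True
      then have "u \<in> V \<inter> \<Union>(B ` W)" using bag_subset[OF assms(5)] u by auto
      then show ?thesis using inv_bagsD(8)[OF bg] by blast
    next
      case False
      then have "rep ?st (b, u) = u" using sh[OF u] by auto
      then show ?thesis using u by (auto simp: D_def intro!: image_eqI[of _ _ "(b, u)"])
    qed
  qed
  have "inv_bags (insert b W) ?st \<pi> (insert D \<B>)"
    unfolding inv_bags_def
  proof (intro conjI ballI)
    show "bag_family (insert D \<B>)" by fact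
    show "\<Union>(insert D \<B>) \<subseteq> set (vlist ?st)" using inv_bagsD(2)[OF bg] rep by (auto simp: D_def)
    show "set (elist ?st) \<subseteq> (\<Union>C\<in>insert D \<B>. C \<times> C)" using inv_bagsD(4)[OF bg] by auto
    show "set (vlist ?st) - V \<subseteq> \<Union>(insert D \<B>)" using inv_bagsD(7)[OF bg] by auto
    show "V \<inter> \<Union>(B ` insert b W) \<subseteq> \<Union>(insert D \<B>)"
      using inv_bagsD(8)[OF bg] \<open>B b \<subseteq> D \<union> \<Union>\<B>\<close> by auto
    show "\<pi> ` \<Union>(insert D \<B>) \<subseteq> \<Union>(B ` insert b W)"
      using inv_bagsD(9)[OF bg] rep by (auto simp: D_def)
  next
    fix C' assume "C' \<in> insert D \<B>"
    then show "int (card C') \<le> width T B + 2" using card inv_bagsD(3)[OF bg] by blast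
  next
    fix s v assume "s \<in> insert b W" "v \<in> B s"
    then have "(s, v) \<in> dom (map_of (reps ?st))" using dom by auto
    then show "map_of (reps ?st) (s, v) \<noteq> None" by auto
  next
    fix s assume "s \<in> insert b W"
    moreover have "\<forall>v\<in>B b. rep ?st (b, v) \<in> D" by (auto simp: D_def)
    ultimately show "\<exists>C\<in>insert D \<B>. \<forall>v\<in>B s. rep ?st (s, v) \<in> C"
      using inv_bagsD(6)[OF bg] by blast
  qed
  with g show "invariant (insert b W) E ?st" unfolding invariant_def by blast
qed

text \<open>Both new pendant neighbours \<open>x\<close> and \<open>y\<close> are current
  representatives at \<open>t\<close>, so one member of the family already contains them and covers
  the edge between them. They are not adjacent before, since their projections \<open>u\<close> and
  \<open>v\<close> are distinct and not yet joined in \<open>E\<close>.\<close>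

lemma link_inv:
  assumes "invariant W E st" "t \<in> W" "u \<in> B t" "v \<in> B t" "W \<subseteq> pverts T" "E \<subseteq> parcs G" "sym E"
    and uv: "u \<noteq> v" "(u, v) \<notin> E"
  shows "invariant W (E \<union> {(u, v), (v, u)}) (link f t (u, v) st)"
proof -
  define st1 where "st1 = grow f (t, u) st"
  define st2 where "st2 = grow f (t, v) st1"
  define x where "x = f (used st)"
  define y where "y = f (used st1)"
  define st3 where "st3 = link f t (u, v) st"
  note g1 = grow_inv[OF assms(1-3,5-7), folded st1_def x_def]
  note g2 = grow_inv[OF g1(1) assms(2,4-7), folded st2_def y_def]
  obtain \<pi> \<B> where g: "inv_graph E st2 \<pi>" and b: "inv_bags W st2 \<pi> \<B>"
    using g2(1) unfolding invariant_def by blast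
  have rep: "rep st2 (t, u) = x" "rep st2 (t, v) = y"
    using uv by (simp_all add: rep_def g1(2) g2(2))
  have "st3 = st2\<lparr>elist := (x, y) # elist st2\<rparr>"
    by (simp add: st3_def link.simps join_def st1_def[symmetric] st2_def[symmetric] rep)
  then have simps: "vlist st3 = vlist st2" "elist st3 = (x, y) # elist st2" "used st3 = used st2"
    "reps st3 = reps st2" by simp_all
  have M: "map_of (reps st2) (t, u) = Some x" "map_of (reps st2) (t, v) = Some y"
    using uv by (auto simp: g1(2) g2(2))
  then have \<pi>: "\<pi> x = u" "\<pi> y = v" and V: "x \<in> set (vlist st2)" "y \<in> set (vlist st2)"
    using g unfolding inv_graph_def by fastforce+
  have graph: "graph st3 = add_edge (graph st2) x y"
    by (auto simp: graph_def simps add_edge_def)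
  have "x \<noteq> y" using \<pi> uv by auto
  have "sym (parcs (graph st2))" by (auto simp: graph_def sym_def)
  moreover have nadj: "(x, y) \<notin> parcs (graph st2)"
    using inv_graph_expands(3)[OF g assms(6,7)] \<pi> uv by metis
  ultimately have nadj': "(y, x) \<notin> parcs (graph st2)" by (meson symD)
  \<comment> \<open>\<open>x\<close> stems from the first growth, and the second one preserves its
    load.\<close>
  have loads: "load st2 x \<le> 2" "load st2 y \<le> 2"
    using g2(5)[of x] g1(3,4) g2(4) by auto
  have "load st3 z \<le> 3" if "z \<in> set (vlist st2)" for z
  proof (cases "z = x \<or> z = y")
    case True
    then obtain z' where "neighbors (graph st3) z \<subseteq> insert z' (neighbors (graph st2) z)"
      by (auto simp: neighbors_def graph)
    then have "deg (graph st3) z \<le> card (insert z' (neighbors (graph st2) z))"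
      unfolding deg_def by (rule card_mono[rotated]) (simp add: finite_neighbors_graph)
    also have "\<dots> \<le> Suc (deg (graph st2) z)"
      by (simp add: deg_def card_insert_if finite_neighbors_graph)
    finally show ?thesis using True loads by (auto simp: load_def simps)
  next
    case False
    then have "neighbors (graph st3) z = neighbors (graph st2) z"
      by (auto simp: neighbors_def graph)
    then show ?thesis using g that by (simp add: load_def deg_def simps inv_graph_def)
  qed
  moreover have "expands (partial (E \<union> {(u, v), (v, u)})) (graph st3) \<pi>"
  proof -
    have "partial (E \<union> {(u, v), (v, u)}) = add_edge (partial E) (\<pi> x) (\<pi> y)"
      by (simp add: partial_def add_edge_def \<pi>)
    moreover have "expands (partial E) (graph st2) \<pi>" using g by (simp add: inv_graph_def)
    from expands_add_edge[OF this pair_graph_partial[OF assms(6,7)], of x y]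
    have "expands (add_edge (partial E) (\<pi> x) (\<pi> y)) (graph st3) \<pi>"
      unfolding graph using V uv \<pi> by (simp add: graph_def partial_def)
    ultimately show ?thesis by simp
  qed
  moreover have "{x, y} \<notin> (\<lambda>(u, v). {u, v}) ` set (elist st2)"
    using nadj nadj' by (auto simp: graph_def doubleton_eq_iff)
  ultimately have g': "inv_graph (E \<union> {(u, v), (v, u)}) st3 \<pi>"
    using g by (simp add: inv_graph_def simps)
  obtain C where "C \<in> \<B>" "x \<in> C" "y \<in> C"
    using inv_bagsD(6)[OF b assms(2)] assms(3,4) rep by metis
  then have "set (elist st3) \<subseteq> (\<Union>C\<in>\<B>. C \<times> C)"
    using inv_bagsD(4)[OF b] by (auto simp: simps)
  then have "inv_bags W st3 \<pi> \<B>"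
    using b by (simp add: inv_bags_def simps(1,4) rep_def)
  with g' show ?thesis unfolding invariant_def st3_def by blast
qed

section \<open>Traversal of the decomposition tree\<close>

definition lists_bags :: "(nat \<times> 'a list) list \<Rightarrow> bool" where
  "lists_bags bags \<longleftrightarrow> distinct (map fst bags) \<and> set (map fst bags) = pverts T \<and>
     (\<forall>(t, b)\<in>set bags. distinct b \<and> set b = B t)"

text \<open>The edge set is empty because the edges of \<open>G\<close> are inserted only after the
  traversal. Connectedness of the visited set is what running intersection asks for, and the exact
  domain allows one to recognise a vertex that is met for the first time.\<close>

definition reached :: "nat list \<times> 'a state \<Rightarrow> bool" where
  "reached w \<longleftrightarrow> set (fst w) \<noteq> {} \<and> set (fst w) \<subseteq> pverts T \<and>
     (\<forall>x\<in>set (fst w). \<forall>y\<in>set (fst w). (x, y) \<in> (parcs T \<inter> set (fst w) \<times> set (fst w))\<^sup>*) \<and>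
     invariant (set (fst w)) {} (snd w) \<and> dom (map_of (reps (snd w))) = Sigma (set (fst w)) B"

lemma bag_of:
  assumes "lists_bags bags" "t \<in> pverts T"
  shows "distinct (bag_of bags t)" "set (bag_of bags t) = B t"
proof -
  obtain b where "(t, b) \<in> set bags" using assms by (force simp: lists_bags_def)
  moreover from this have "map_of bags t = Some b" using assms by (auto simp: lists_bags_def)
  ultimately show "distinct (bag_of bags t)" "set (bag_of bags t) = B t"
    using assms by (auto simp: lists_bags_def bag_of_def)
qed

lemma connected_insert:
  assumes "\<forall>x\<in>W. \<forall>y\<in>W. (x, y) \<in> (R \<inter> W \<times> W)\<^sup>*" "a \<in> W" "(a, b) \<in> R" "sym R"
  shows "\<forall>x\<in>insert b W. \<forall>y\<in>insert b W. (x, y) \<in> (R \<inter> insert b W \<times> insert b W)\<^sup>*"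
proof -
  let ?R = "R \<inter> insert b W \<times> insert b W"
  have "(R \<inter> W \<times> W)\<^sup>* \<subseteq> ?R\<^sup>*" by (rule rtrancl_mono) auto
  moreover have "(a, b) \<in> ?R" "(b, a) \<in> ?R" using assms by (auto dest: symD)
  ultimately have "(x, a) \<in> ?R\<^sup>* \<and> (a, x) \<in> ?R\<^sup>*" if "x \<in> insert b W" for x
    using assms(1,2) that by (cases "x = b") auto
  then show ?thesis by (meson rtrancl_trans)
qed

lemma cross_reached:
  assumes "reached w" "lists_bags bags" "(a, b) \<in> parcs T"
  shows "reached (cross f bags a b w)" "set (fst w) \<subseteq> set (fst (cross f bags a b w))"
    "a \<in> set (fst w) \<Longrightarrow> b \<in> set (fst (cross f bags a b w))"
proof -
  obtain ws st where w: "w = (ws, st)" by (cases w)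
  show "set (fst w) \<subseteq> set (fst (cross f bags a b w))"
    "a \<in> set (fst w) \<Longrightarrow> b \<in> set (fst (cross f bags a b w))" by (auto simp: w cross.simps)
  show "reached (cross f bags a b w)"
  proof (cases "a \<in> set ws \<and> b \<notin> set ws")
    case True
    let ?W = "set ws"
    have W: "?W \<subseteq> pverts T" and conn: "\<forall>x\<in>?W. \<forall>y\<in>?W. (x, y) \<in> (parcs T \<inter> ?W \<times> ?W)\<^sup>*"
      and I: "invariant ?W {} st" and dom: "dom (map_of (reps st)) = Sigma ?W B"
      using assms(1) by (auto simp: reached_def w)
    have b: "b \<in> pverts T" using assms(3) tree by auto
    have "B b \<inter> \<Union>(B ` ?W) \<subseteq> B a"
      using tree_decomposition_running_intersection[OF td W assms(3)] True conn by blast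
    then have "invariant (insert b ?W) {} (fork f a b (bag_of bags b) st)"
      "dom (map_of (reps (fork f a b (bag_of bags b) st))) = Sigma (insert b ?W) B"
      using fork_inv[OF I W _ _ b _ _ _ dom bag_of[OF assms(2) b], of a] True by (auto simp: sym_def)
    then show ?thesis
      using connected_insert[OF conn _ assms(3) tree(4)] True W b
      by (simp add: w cross.simps reached_def)
  next
    case False
    then have "cross f bags a b w = w" by (auto simp: w cross.simps)
    then show ?thesis using assms(1) by (simp only:)
  qed
qed

text \<open>Visited bags stay visited, so what any crossing achieves still holds at the end of the
  sweep: all neighbours of the bags visited before it have been visited.\<close>

lemma sweep_reached:
  assumes "reached w" "lists_bags bags" "set ts \<union> (set ts)\<inverse> \<subseteq> parcs T"
  shows "reached (sweep f bags ts w) \<and> set (fst w) \<subseteq> set (fst (sweep f bags ts w)) \<and>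
    (\<forall>a b. (a, b) \<in> set ts \<union> (set ts)\<inverse> \<longrightarrow> a \<in> set (fst w) \<longrightarrow>
       b \<in> set (fst (sweep f bags ts w)))"
  using assms(1,3)
proof (induction ts arbitrary: w)
  case Nil
  then show ?case by (simp add: sweep_def)
next
  case (Cons e ts)
  obtain a b where e: "e = (a, b)" by (cases e)
  have ab: "(a, b) \<in> parcs T" "(b, a) \<in> parcs T" using Cons.prems e by auto
  define w1 where "w1 = cross f bags a b w"
  define w2 where "w2 = cross f bags b a w1"
  note w1 = cross_reached[OF Cons.prems(1) assms(2) ab(1), folded w1_def]
  note w2 = cross_reached[OF w1(1) assms(2) ab(2), folded w2_def]
  have sw: "sweep f bags (e # ts) w = sweep f bags ts w2"
    by (simp add: sweep_def e w1_def w2_def)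
  have IH: "reached (sweep f bags ts w2)" "set (fst w2) \<subseteq> set (fst (sweep f bags ts w2))"
    "\<And>a b. (a, b) \<in> set ts \<union> (set ts)\<inverse> \<Longrightarrow> a \<in> set (fst w2) \<Longrightarrow> b \<in> set (fst (sweep f bags ts w2))"
    using Cons.IH[OF w2(1)] Cons.prems(2) by auto
  have main: "d \<in> set (fst (sweep f bags ts w2))"
    if "(c, d) \<in> set (e # ts) \<union> (set (e # ts))\<inverse>" "c \<in> set (fst w)" for c d
  proof -
    consider "c = a" "d = b" | "c = b" "d = a" | "(c, d) \<in> set ts \<union> (set ts)\<inverse>"
      using \<open>(c, d) \<in> _\<close> e by auto
    then show ?thesis
    proof cases
      case 1
      then show ?thesis using \<open>c \<in> _\<close> w1(3) w2(2) IH(2) by blast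
    next
      case 2
      then show ?thesis using \<open>c \<in> _\<close> w1(2) w2(3) IH(2) by blast
    next
      case 3
      then show ?thesis using \<open>c \<in> _\<close> w1(2) w2(2) IH(3) by blast
    qed
  qed
  show ?case
    unfolding sw using IH(1,2) w1(2) w2(2) main by blast
qed

text \<open>A sweep that adds nothing shows that the visited set is closed under adjacency, hence is
  the whole connected tree. Otherwise each sweep adds at least one bag, and the root is there before
  the first one.\<close>

lemma sweeps_reached:
  assumes "reached w" "lists_bags bags" "set ts \<union> (set ts)\<inverse> = parcs T"
  shows "reached (fold (\<lambda>_. sweep f bags ts) xs w) \<and>
    (set (fst (fold (\<lambda>_. sweep f bags ts) xs w)) = pverts T \<or>
     card (set (fst (fold (\<lambda>_. sweep f bags ts) xs w))) > length xs)"
proof (induction xs rule: rev_induct)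
  case Nil
  then show ?case using assms(1) by (auto simp: reached_def card_gt_0_iff)
next
  case (snoc x xs)
  define w' where "w' = fold (\<lambda>_. sweep f bags ts) xs w"
  define w2 where "w2 = sweep f bags ts w'"
  have r: "reached w'" using snoc by (simp add: w'_def)
  then have s: "reached w2" "set (fst w') \<subseteq> set (fst w2)"
    "\<And>a b. (a, b) \<in> parcs T \<Longrightarrow> a \<in> set (fst w') \<Longrightarrow> b \<in> set (fst w2)"
    using sweep_reached[OF r assms(2), of ts] assms(3) by (auto simp: w2_def)
  have sub: "set (fst w2) \<subseteq> pverts T" using s(1) by (simp add: reached_def)
  have "set (fst w2) = pverts T \<or> card (set (fst w2)) > Suc (length xs)"
  proof (cases "set (fst w2) = set (fst w')")
    case True
    obtain x where x: "x \<in> set (fst w')" "x \<in> pverts T" using r unfolding reached_def by (metis ex_in_conv subsetD)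
    have "y \<in> set (fst w2)" if "(x, y) \<in> (parcs T)\<^sup>*" for y
      using that by (induction) (use x True s in auto)
    then have "pverts T \<subseteq> set (fst w2)"
      using td x(2) by (auto simp: tree_decomposition_def undirected_tree_iff)
    then show ?thesis using sub by auto
  next
    case False
    then have "card (set (fst w')) < card (set (fst w2))"
      using s(2) by (intro psubset_card_mono) auto
    moreover have "set (fst w2) = pverts T" if "set (fst w') = pverts T"
      using that s(2) sub by auto
    ultimately show ?thesis using snoc by (fastforce simp: w'_def)
  qed
  then show ?case using s(1) by (simp add: w2_def w'_def)
qed

lemma start_reached:
  assumes "lists_bags bags" "distinct vs" "set vs = V"
  shows "reached (start f bags vs)"
proof -
  have "pverts T \<noteq> {}" using td by (auto simp: tree_decomposition_def undirected_tree_iff)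
  then have "bags \<noteq> []" using assms(1) by (auto simp: lists_bags_def)
  then obtain t b bags' where bags: "bags = (t, b) # bags'" by (cases bags) auto
  then have t: "t \<in> pverts T" and b: "distinct b" "set b = B t" using assms(1) by (auto simp: lists_bags_def)
  define st where "st = \<lparr>reps = [], used = 0, vlist = vs, elist = []\<rparr>"
  have start: "start f bags vs = ([t], fork f t t b st)" by (simp add: start_def bags st_def)
  have g: "graph st = partial {}" using assms(3) by (simp add: graph_def partial_def st_def)
  have "inv_graph {} st (\<lambda>x. x)"
    using assms expands.initial[of "partial {}"] g
    by (auto simp: inv_graph_def st_def load_def deg_def neighbors_def partial_def)
  \<comment> \<open>The family starts with the empty bag alone: nothing has been visited, and the
    vertices of the edgeless graph enter bags only when they are met.\<close>
  moreover have "inv_bags {} st (\<lambda>x. x) {{}}"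
    using assms width_ge[of T B] by (auto simp: inv_bags_def st_def intro: bag_family.single)
  ultimately have "invariant {} {} st" unfolding invariant_def by blast
  then have "invariant {t} {} (fork f t t b st)" "dom (map_of (reps (fork f t t b st))) = Sigma {t} B"
    using fork_inv[of "{}" "{}" st t t b] t b by (auto simp: sym_def st_def)
  then show ?thesis using t by (simp add: reached_def start)
qed

lemma home:
  assumes "lists_bags bags" "(u, v) \<in> parcs G"
  shows "home u v bags \<in> pverts T" "u \<in> B (home u v bags)" "v \<in> B (home u v bags)"
proof -
  have "home u v xs \<in> pverts T \<and> u \<in> B (home u v xs) \<and> v \<in> B (home u v xs)"
    if "\<exists>t\<in>set (map fst xs). u \<in> B t \<and> v \<in> B t" "set xs \<subseteq> set bags" for xs
    using that
  proof (induction xs)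
    case (Cons x xs)
    obtain t b where x: "x = (t, b)" by (cases x)
    then have tb: "(t, b) \<in> set bags" using Cons.prems by simp
    then have b: "set b = B t" using assms(1) by (auto simp: lists_bags_def)
    have "t \<in> set (map fst bags)" using tb by force
    then have t: "t \<in> pverts T" using assms(1) by (simp add: lists_bags_def)
    show ?case
    proof (cases "u \<in> B t \<and> v \<in> B t")
      case True
      then show ?thesis using b t by (simp add: x)
    next
      case False
      then have "\<exists>t\<in>set (map fst xs). u \<in> B t \<and> v \<in> B t" using Cons.prems(1) by (auto simp: x)
      moreover have "home u v (x # xs) = home u v xs" using False b by (auto simp: x)
      ultimately show ?thesis using Cons.IH Cons.prems(2) by simp
    qed
  qed simp
  moreover have "\<exists>t\<in>set (map fst bags). u \<in> B t \<and> v \<in> B t"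
  proof -
    have "\<forall>(u, v)\<in>parcs G. \<exists>t\<in>pverts T. u \<in> B t \<and> v \<in> B t"
      using td unfolding tree_decomposition_def by blast
    moreover have "set (map fst bags) = pverts T" using assms(1) by (simp add: lists_bags_def)
    ultimately show ?thesis using assms(2) by auto
  qed
  ultimately show "home u v bags \<in> pverts T" "u \<in> B (home u v bags)" "v \<in> B (home u v bags)"
    by auto
qed

lemma links_inv:
  assumes "invariant (pverts T) {} st" "lists_bags bags"
    and "distinct (map (\<lambda>(u, v). {u, v}) es)" "set es \<union> (set es)\<inverse> \<subseteq> parcs G"
  shows "invariant (pverts T) (set es \<union> (set es)\<inverse>) (links f bags es st)"
  using assms(3,4)
proof (induction es rule: rev_induct)
  case Nil
  then show ?case using assms(1) by (simp add: links_def)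
next
  case (snoc e es)
  obtain u v where e: "e = (u, v)" by (cases e)
  let ?E = "set es \<union> (set es)\<inverse>"
  have uv: "(u, v) \<in> parcs G" using snoc.prems e by auto
  then have "u \<noteq> v" using G by (auto simp: pair_graph_iff irrefl_def)
  have "{u, v} \<notin> (\<lambda>(u, v). {u, v}) ` set es" using snoc.prems e by auto
  then have "(u, v) \<notin> ?E" by (force simp: insert_commute)
  have "?E \<subseteq> parcs G" "sym ?E" using snoc.prems by (auto simp: sym_def)
  from link_inv[OF _ home[OF assms(2) uv] order_refl this \<open>u \<noteq> v\<close> \<open>(u, v) \<notin> ?E\<close>]
  have "invariant (pverts T) (?E \<union> {(u, v), (v, u)}) (link f (home u v bags) (u, v) (links f bags es st))"
    using snoc by auto
  moreover have "?E \<union> {(u, v), (v, u)} = set (es @ [e]) \<union> (set (es @ [e]))\<inverse>" by (auto simp: e)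
  ultimately show ?case by (simp add: links_def e)
qed

lemma ternarize_correct:
  assumes "distinct vs" "set vs = V"
    and "distinct (map (\<lambda>(u, v). {u, v}) es)" "set es \<union> (set es)\<inverse> = parcs G"
    and "set ts \<union> (set ts)\<inverse> = parcs T" "lists_bags bags"
  defines "st \<equiv> ternarize f vs es ts bags"
  shows "ternary_expansion G (graph st)" "treewidth (graph st) \<le> width T B + 1"
    "distinct (vlist st)" "distinct (map (\<lambda>(u, v). {u, v}) (elist st))"
proof -
  define w where "w = fold (\<lambda>_. sweep f bags ts) bags (start f bags vs)"
  have w: "reached w" "set (fst w) = pverts T \<or> card (set (fst w)) > length bags"
    using sweeps_reached[OF start_reached[OF assms(6,1,2)] assms(6,5)] by (auto simp: w_def)
  \<comment> \<open>There are as many sweeps as tree vertices, which rules out the second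
    alternative in \<open>w\<close>.\<close>
  have "length bags = card (pverts T)"
    using assms(6) by (metis distinct_card length_map lists_bags_def)
  moreover have "card (set (fst w)) \<le> card (pverts T)"
    using w(1) tree(2) by (intro card_mono) (auto simp: reached_def)
  ultimately have "set (fst w) = pverts T" using w(2) by auto
  then have "invariant (pverts T) {} (snd w)" using w(1) by (simp add: reached_def)
  from links_inv[OF this assms(6,3)] have "invariant (pverts T) (parcs G) st"
    by (simp add: assms(4) st_def ternarize_def w_def)
  then obtain \<pi> \<B> where g: "inv_graph (parcs G) st \<pi>" and b: "inv_bags (pverts T) st \<pi> \<B>"
    unfolding invariant_def by blast
  show "distinct (vlist st)" "distinct (map (\<lambda>(u, v). {u, v}) (elist st))"
    using g by (simp_all add: inv_graph_def)
  have "partial (parcs G) = G" by (simp add: partial_def)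
  then have "expands G (graph st) \<pi>" using g by (simp add: inv_graph_def)
  then have "expansion G (graph st)" by (rule expands_imp_expansion)
  moreover have "max_degree (graph st) \<le> 3"
    using g by (auto simp: max_degree_def graph_def inv_graph_def load_def dest: add_leD1)
  ultimately show "ternary_expansion G (graph st)" by (simp add: ternary_expansion_def)
  \<comment> \<open>Every vertex of \<open>G\<close> has been met, so the bags now contain precisely
    the vertices of the expansion.\<close>
  have "V \<subseteq> \<Union>(B ` pverts T)" using td by (auto simp: tree_decomposition_def)
  then have U: "\<Union>\<B> = pverts (graph st)"
    unfolding graph_def pair_pre_digraph.select_convs using inv_bagsD(2,7,8)[OF b] by blast
  have "parcs (graph st) \<subseteq> (\<Union>C\<in>\<B>. C \<times> C)"
    using inv_bagsD(4)[OF b] by (auto simp: graph_def)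
  then show "treewidth (graph st) \<le> width T B + 1"
    using treewidth_le_if_bag_family[OF inv_bagsD(1)[OF b] U, of "width T B + 1"] inv_bagsD(3)[OF b]
    by (auto simp: add.assoc)
qed

end

section \<open>Existence over infinite vertex types\<close>

lemma pair_graph_edge_list:
  assumes H: "pair_graph H"
  shows "\<exists>es. distinct (map (\<lambda>(u, v). {u, v}) es) \<and> set es \<union> (set es)\<inverse> = parcs H"
proof -
  define D where "D = (\<lambda>(u, v). {u, v}) ` parcs H"
  have "finite (parcs H)" using H finite_subset[of "parcs H" "pverts H \<times> pverts H"] by (simp add: pair_graph_iff)
  then obtain ds where ds: "set ds = D" "distinct ds" using finite_distinct_list[of D] by (auto simp: D_def)
  \<comment> \<open>Chooses one orientation of each unordered edge.\<close>
  define pick where "pick d = (SOME e. e \<in> parcs H \<and> (\<lambda>(u, v). {u, v}) e = d)" for d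
  have pick: "pick d \<in> parcs H \<and> (\<lambda>(u, v). {u, v}) (pick d) = d" if "d \<in> D" for d
    unfolding pick_def by (rule someI_ex) (use that in \<open>auto simp: D_def\<close>)
  have m: "map (\<lambda>(u, v). {u, v}) (map pick ds) = ds"
    using pick ds(1) by (auto intro!: map_idI)
  have "(u, v) \<in> set (map pick ds) \<union> (set (map pick ds))\<inverse>" if "(u, v) \<in> parcs H" for u v
  proof -
    have "{u, v} \<in> D" using that by (force simp: D_def)
    then have "pick {u, v} \<in> set (map pick ds)" "(\<lambda>(u, v). {u, v}) (pick {u, v}) = {u, v}"
      using pick[of "{u, v}"] ds(1) by simp_all
    moreover obtain a b where "pick {u, v} = (a, b)" by (cases "pick {u, v}")
    ultimately have "(a, b) \<in> set (map pick ds)" "{a, b} = {u, v}" by simp_all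
    then show ?thesis unfolding doubleton_eq_iff by blast
  qed
  moreover have "set (map pick ds) \<union> (set (map pick ds))\<inverse> \<subseteq> parcs H"
  proof -
    have "set (map pick ds) \<subseteq> parcs H" using pick ds(1) by auto
    moreover have "(parcs H)\<inverse> = parcs H" using sym_parcs[OF H] by (simp add: sym_conv_converse_eq)
    ultimately show ?thesis by blast
  qed
  ultimately have "set (map pick ds) \<union> (set (map pick ds))\<inverse> = parcs H" by auto
  then show ?thesis using m ds(2) by metis
qed

lemma exists_ternary_expansion:
  fixes G :: "'a :: infinite pair_pre_digraph"
  assumes G: "pair_graph G"
  shows "\<exists>G'. ternary_expansion G G' \<and> treewidth G' \<le> treewidth G + 1"
proof -
  obtain T :: "nat pair_pre_digraph" and B where td: "tree_decomposition G T B"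
    and w: "width T B = treewidth G"
    using treewidth_attained[OF G] by blast
  have fin: "finite (pverts G)" using G by (simp add: pair_graph_iff)
  then have "infinite (- pverts G)" using infinite_UNIV by (simp add: Compl_eq_Diff_UNIV)
  then obtain f :: "nat \<Rightarrow> 'a" where f: "inj f" "range f \<subseteq> - pverts G"
    using infinite_countable_subset by blast
  interpret ternarization G T B f
    using G td f by (intro ternarization.intro) auto
  obtain vs where "distinct vs" "set vs = pverts G" using finite_distinct_list[OF fin] by blast
  moreover obtain es where "distinct (map (\<lambda>(u, v). {u, v}) es)" "set es \<union> (set es)\<inverse> = parcs G"
    using pair_graph_edge_list[OF G] by blast
  moreover obtain ts where "set ts \<union> (set ts)\<inverse> = parcs T" using pair_graph_edge_list[OF tree(1)] by blast
  moreover obtain bags where "lists_bags bags"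
  proof -
    obtain tl where tl: "set tl = pverts T" "distinct tl" using finite_distinct_list[OF tree(2)] by blast
    have "\<forall>t\<in>pverts T. \<exists>b. distinct b \<and> set b = B t" using finite_bag finite_distinct_list by metis
    then obtain g where "\<forall>t\<in>pverts T. distinct (g t) \<and> set (g t) = B t" by metis
    then have "lists_bags (map (\<lambda>t. (t, g t)) tl)"
      using tl by (auto simp: lists_bags_def comp_def)
    then show ?thesis by (rule that)
  qed
  ultimately have "ternary_expansion G (graph (ternarize f vs es ts bags))"
    "treewidth (graph (ternarize f vs es ts bags)) \<le> width T B + 1"
    using ternarize_correct by blast+
  then show ?thesis using w by auto
qed

section \<open>The program\<close>

text \<open>The truth value true and the binary digit 1 at once; false and the digit 0 are
  \<open>Atom\<close>.\<close>

definition tt :: sexp where "tt = Cell Atom Atom"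

abbreviation (input) "True_Cell \<equiv> Cons_Cell Quote_Atom Quote_Atom"

text \<open>
  The functions are numbered as in the list \<open>prog\<close> below. A state is passed as the tree
  \<open>Cell reps (Cell next (Cell vs es))\<close>, where \<open>next\<close> is the name of the next new vertex, so that
  the output graph is the tail of its tail.
\<close>

definition main_body :: expr where
  "main_body = (let vs = Head (Head (Param 0)); es = Tail (Head (Param 0));
     ts = Tail (Head (Tail (Param 0))); bags = Tail (Tail (Param 0));
     t = Head (Head bags); b = Tail (Head bags);
     st = Cons_Cell Quote_Atom (Cons_Cell (Call 15 [Param 0, Quote_Atom]) (Cons_Cell vs Quote_Atom));
     w = Cons_Cell (Cons_Cell t Quote_Atom) (Call 7 [t, t, b, st])
   in Tail (Tail (Call 14 [bags, es, Tail (Call 10 [bags, bags, ts, w])])))"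

definition eq_body :: expr where
  "eq_body = If_Cell (Param 0)
     (If_Cell (Param 1)
       (If_Cell (Call 1 [Head (Param 0), Head (Param 1)]) (Call 1 [Tail (Param 0), Tail (Param 1)]) Quote_Atom)
       Quote_Atom)
     (If_Cell (Param 1) Quote_Atom True_Cell)"

text \<open>The whole entry is returned, because a value alone may be \<open>Atom\<close>, the
  encoding of 0 and of the empty list, and could not be told from a failure.\<close>

definition lookup_body :: expr where
  "lookup_body = If_Cell (Param 1)
     (If_Cell (Call 1 [Param 0, Head (Head (Param 1))]) (Head (Param 1)) (Call 2 [Param 0, Tail (Param 1)]))
     Quote_Atom"

definition member_body :: expr where
  "member_body = If_Cell (Param 1)
     (If_Cell (Call 1 [Param 0, Head (Param 1)]) True_Cell (Call 3 [Param 0, Tail (Param 1)]))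
     Quote_Atom"

definition rep_body :: expr where
  "rep_body = (let p = Call 2 [Param 0, Head (Param 1)] in If_Cell p (Tail p) (Tail (Param 0)))"

definition grow_body :: expr where
  "grow_body = (let x = Head (Tail (Param 1)); vs = Head (Tail (Tail (Param 1))); es = Tail (Tail (Tail (Param 1)))
   in If_Cell (Call 2 [Param 0, Head (Param 1)])
     (Cons_Cell (Cons_Cell (Cons_Cell (Param 0) x) (Head (Param 1)))
       (Cons_Cell (Cons_Cell True_Cell x)
         (Cons_Cell (Cons_Cell x vs) (Cons_Cell (Cons_Cell (Call 4 [Param 0, Param 1]) x) es))))
     (Param 1))"

definition share_body :: expr where
  "share_body = Cons_Cell
     (Cons_Cell (Cons_Cell (Param 1) (Call 4 [Param 0, Param 2])) (Head (Param 2))) (Tail (Param 2))"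

definition fork_body :: expr where
  "fork_body = (let k = Cons_Cell (Param 0) (Head (Param 2)); k' = Cons_Cell (Param 1) (Head (Param 2))
   in If_Cell (Param 2)
     (Call 7 [Param 0, Param 1, Tail (Param 2), Call 6 [k, k', Call 5 [k, Param 3]]]) (Param 3))"

text \<open>The tail of a failed lookup is \<open>Atom\<close>, the empty list, in accordance with
  \<open>bag_of\<close>.\<close>

definition cross_body :: expr where
  "cross_body = If_Cell (Call 3 [Param 1, Head (Param 3)])
     (If_Cell (Call 3 [Param 2, Head (Param 3)]) (Param 3)
       (Cons_Cell (Cons_Cell (Param 2) (Head (Param 3)))
         (Call 7 [Param 1, Param 2, Tail (Call 2 [Param 2, Param 0]), Tail (Param 3)])))
     (Param 3)"

definition sweep_body :: expr where
  "sweep_body = (let a = Head (Head (Param 1)); b = Tail (Head (Param 1))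
   in If_Cell (Param 1)
     (Call 9 [Param 0, Tail (Param 1), Call 8 [Param 0, b, a, Call 8 [Param 0, a, b, Param 2]]]) (Param 2))"

definition sweeps_body :: expr where
  "sweeps_body = If_Cell (Param 0)
     (Call 10 [Tail (Param 0), Param 1, Param 2, Call 9 [Param 1, Param 2, Param 3]]) (Param 3)"

text \<open>The final \<open>Atom\<close> encodes 0, the default of \<open>home\<close>.\<close>

definition home_body :: expr where
  "home_body = (let rec = Call 11 [Param 0, Param 1, Tail (Param 2)]; b = Tail (Head (Param 2))
   in If_Cell (Param 2)
     (If_Cell (Call 3 [Param 0, b]) (If_Cell (Call 3 [Param 1, b]) (Head (Head (Param 2))) rec) rec)
     Quote_Atom)"

definition join_body :: expr where
  "join_body = Cons_Cell (Head (Param 2)) (Cons_Cell (Head (Tail (Param 2)))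
     (Cons_Cell (Head (Tail (Tail (Param 2))))
       (Cons_Cell (Cons_Cell (Call 4 [Param 0, Param 2]) (Call 4 [Param 1, Param 2]))
         (Tail (Tail (Tail (Param 2)))))))"

definition link_body :: expr where
  "link_body = (let k = Cons_Cell (Param 0) (Param 1); k' = Cons_Cell (Param 0) (Param 2)
   in Call 12 [k, k', Call 5 [k', Call 5 [k, Param 3]]])"

definition links_body :: expr where
  "links_body = (let u = Head (Head (Param 1)); v = Tail (Head (Param 1))
   in If_Cell (Param 1)
     (Call 14 [Param 0, Tail (Param 1), Call 13 [Call 11 [u, v, Param 0], u, v, Param 2]]) (Param 2))"

text \<open>Prepends to the second argument as many digits 1 as the first argument has cells.\<close>

definition ones_body :: expr where
  "ones_body = If_Cell (Param 0)
     (Call 15 [Head (Param 0), Call 15 [Tail (Param 0), Cons_Cell True_Cell (Param 1)]]) (Param 1)"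

definition prog :: program where
  "prog = [main_body, eq_body, lookup_body, member_body, rep_body, grow_body, share_body, fork_body,
     cross_body, sweep_body, sweeps_body, home_body, join_body, link_body, links_body, ones_body]"

lemma prog_simps:
  "prog ! 0 = main_body" "prog ! 1 = eq_body" "prog ! 2 = lookup_body" "prog ! 3 = member_body"
  "prog ! 4 = rep_body" "prog ! 5 = grow_body" "prog ! 6 = share_body" "prog ! 7 = fork_body"
  "prog ! 8 = cross_body" "prog ! 9 = sweep_body" "prog ! 10 = sweeps_body" "prog ! 11 = home_body"
  "prog ! 12 = join_body" "prog ! 13 = link_body" "prog ! 14 = links_body" "prog ! 15 = ones_body"
  by (simp_all add: prog_def)

lemma length_prog [simp]: "length prog = 16"
  by (simp add: prog_def)

lemma size_tt [simp]: "size tt = 1" and tt_neq [simp]: "tt \<noteq> Atom" "Atom \<noteq> tt"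
  by (simp_all add: tt_def)

lemma length_le_size_enc_list: "length xs \<le> size (enc_list f xs)"
  by (induction xs) auto

abbreviation (input) enc_edge where "enc_edge \<equiv> enc_pair enc_nat enc_nat"
abbreviation (input) enc_reps where "enc_reps \<equiv> enc_list (enc_pair enc_edge enc_nat)"
abbreviation (input) enc_bags where "enc_bags \<equiv> enc_list (enc_pair enc_nat (enc_list enc_nat))"

definition spare :: "nat \<Rightarrow> nat \<Rightarrow> nat" where
  "spare s k = 2 ^ (s + k) - 1"

definition enc_state :: "nat \<Rightarrow> nat state \<Rightarrow> sexp" where
  "enc_state s st = Cell (enc_reps (reps st)) (Cell (enc_nat (spare s (used st)))
     (Cell (enc_list enc_nat (vlist st)) (enc_list enc_edge (elist st))))"

lemma enc_nat_0 [simp]: "enc_nat 0 = Atom"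
  by (simp add: enc_nat.simps)

text \<open>A further digit 1 at the least significant end sends \<open>n\<close> to
  \<open>2 * n + 1\<close>, and this end is the head of the encoding.\<close>

lemma enc_spare_Suc: "enc_nat (spare s (Suc k)) = Cell tt (enc_nat (spare s k))"
proof -
  obtain q where q: "(2 :: nat) ^ (s + k) = Suc q" by (metis not0_implies_Suc power_not_zero zero_neq_numeral)
  have 1: "spare s (Suc k) = 2 * q + 1" using q by (simp add: spare_def)
  have "spare s (Suc k) div 2 = spare s k" using q by (simp add: 1 spare_def)
  then show ?thesis using 1 by (subst enc_nat.simps) (simp add: tt_def)
qed

text \<open>
  With a common bound on the sizes of all values, the cost of a run is controlled by its number
  of steps.
\<close>

definition ev :: "nat \<Rightarrow> sexp list \<Rightarrow> expr \<Rightarrow> sexp \<Rightarrow> nat \<Rightarrow> bool" where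
  "ev N \<rho> e v n \<longleftrightarrow> size v < N \<and> (\<exists>c. eval prog \<rho> e v c \<and> c \<le> n * N)"

definition evlist :: "nat \<Rightarrow> sexp list \<Rightarrow> expr list \<Rightarrow> sexp list \<Rightarrow> nat \<Rightarrow> bool" where
  "evlist N \<rho> es vs n \<longleftrightarrow> (\<exists>c. evals prog \<rho> es vs c \<and> c \<le> n * N)"

definition fn :: "nat \<Rightarrow> nat \<Rightarrow> sexp list \<Rightarrow> sexp \<Rightarrow> nat \<Rightarrow> bool" where
  "fn N f xs v n \<longleftrightarrow> ev N xs (prog ! f) v n"

lemma ev_weaken: "ev N \<rho> e v n \<Longrightarrow> v = v' \<Longrightarrow> n \<le> n' \<Longrightarrow> ev N \<rho> e v' n'"
  unfolding ev_def by (meson le_trans mult_le_mono1)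

lemma fn_weaken: "fn N f xs v n \<Longrightarrow> v = v' \<Longrightarrow> n \<le> n' \<Longrightarrow> fn N f xs v' n'"
  unfolding fn_def by (rule ev_weaken)

lemma ev_Param: "i < length \<rho> \<Longrightarrow> size (\<rho> ! i) < N \<Longrightarrow> ev N \<rho> (Param i) (\<rho> ! i) 1"
  unfolding ev_def using eval_evals.Param[of i \<rho> prog] by fastforce

lemma ev_Param0: "size x < N \<Longrightarrow> ev N (x # \<rho>) (Param 0) x 1"
  and ev_Param1: "size y < N \<Longrightarrow> ev N (x # y # \<rho>) (Param 1) y 1"
  and ev_Param2: "size z < N \<Longrightarrow> ev N (x # y # z # \<rho>) (Param 2) z 1"
  and ev_Param3: "size u < N \<Longrightarrow> ev N (x # y # z # u # \<rho>) (Param 3) u 1"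
  using ev_Param[of 0 "x # \<rho>" N] ev_Param[of 1 "x # y # \<rho>" N]
    ev_Param[of 2 "x # y # z # \<rho>" N] ev_Param[of 3 "x # y # z # u # \<rho>" N]
  by (simp_all add: numeral_eq_Suc)

lemma ev_Quote_Atom: "0 < N \<Longrightarrow> ev N \<rho> Quote_Atom Atom 1"
  unfolding ev_def using eval_evals.Quote_Atom[of prog \<rho>] by force

lemma ev_Cons_Cell:
  assumes "ev N \<rho> a x n" "ev N \<rho> b y m" "size (Cell x y) < N"
  shows "ev N \<rho> (Cons_Cell a b) (Cell x y) (n + m + 1)"
proof -
  obtain c d where c: "eval prog \<rho> a x c" "c \<le> n * N" and d: "eval prog \<rho> b y d" "d \<le> m * N"
    using assms by (auto simp: ev_def)
  have "c + d + 1 + size (Cell x y) \<le> (n + m + 1) * N"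
    using c d assms(3) by (simp add: algebra_simps)
  then show ?thesis unfolding ev_def using eval_evals.Cons_Cell[OF c(1) d(1)] assms(3) by blast
qed

lemma ev_True_Cell: "1 < N \<Longrightarrow> ev N \<rho> True_Cell tt 3"
  using ev_Cons_Cell[OF ev_Quote_Atom ev_Quote_Atom, of N \<rho>] by (simp add: tt_def numeral_eq_Suc)

lemma ev_Head:
  assumes "ev N \<rho> a (Cell x y) n" shows "ev N \<rho> (Head a) x (n + 1)"
proof -
  obtain c where c: "eval prog \<rho> a (Cell x y) c" "c \<le> n * N" and s: "size (Cell x y) < N"
    using assms by (auto simp: ev_def)
  have "c + 1 + size x \<le> (n + 1) * N" using c s by (simp add: algebra_simps)
  then show ?thesis unfolding ev_def using eval_evals.Head[OF c(1)] s by (auto intro!: exI[of _ "c + 1 + size x"])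
qed

lemma ev_Tail:
  assumes "ev N \<rho> a (Cell x y) n" shows "ev N \<rho> (Tail a) y (n + 1)"
proof -
  obtain c where c: "eval prog \<rho> a (Cell x y) c" "c \<le> n * N" and s: "size (Cell x y) < N"
    using assms by (auto simp: ev_def)
  have "c + 1 + size y \<le> (n + 1) * N" using c s by (simp add: algebra_simps)
  then show ?thesis unfolding ev_def using eval_evals.Tail[OF c(1)] s by (auto intro!: exI[of _ "c + 1 + size y"])
qed

lemma ev_Tail_Atom:
  assumes "ev N \<rho> a Atom n" shows "ev N \<rho> (Tail a) Atom (n + 1)"
proof -
  obtain c where c: "eval prog \<rho> a Atom c" "c \<le> n * N" and s: "size Atom < N"
    using assms by (auto simp: ev_def)
  have "c + 1 + size Atom \<le> (n + 1) * N" using c s by (simp add: algebra_simps)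
  then show ?thesis unfolding ev_def using eval_evals.Tail[OF c(1)] s by (auto intro!: exI[of _ "c + 1"])
qed

lemma ev_If_Cell:
  assumes "ev N \<rho> a x n" "ev N \<rho> (if x \<noteq> Atom then b1 else b2) v m"
  shows "ev N \<rho> (If_Cell a b1 b2) v (n + m + 1)"
proof -
  obtain c d where c: "eval prog \<rho> a x c" "c \<le> n * N"
    and d: "eval prog \<rho> (if x \<noteq> Atom then b1 else b2) v d" "d \<le> m * N" and s: "size v < N"
    using assms by (auto simp: ev_def)
  have "c + d + 1 + size v \<le> (n + m + 1) * N" using c d s by (simp add: algebra_simps)
  then show ?thesis unfolding ev_def using eval_evals.If_Cell[OF c(1) d(1)] s by blast
qed

lemma ev_if:
  "ev N \<rho> b1 v n \<Longrightarrow> ev N \<rho> (if Cell x y \<noteq> Atom then b1 else b2) v n"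
  "ev N \<rho> b1 v n \<Longrightarrow> ev N \<rho> (if tt \<noteq> Atom then b1 else b2) v n"
  "ev N \<rho> b2 v n \<Longrightarrow> ev N \<rho> (if Atom \<noteq> Atom then b1 else b2) v n"
  by simp_all

lemma ev_Call:
  assumes "evlist N \<rho> as xs n" "fn N f xs v m" "f < 16"
  shows "ev N \<rho> (Call f as) v (n + m + 1)"
proof -
  obtain c d where c: "evals prog \<rho> as xs c" "c \<le> n * N"
    and d: "eval prog xs (prog ! f) v d" "d \<le> m * N" and s: "size v < N"
    using assms by (auto simp: ev_def fn_def evlist_def)
  have "c + d + 1 + size v \<le> (n + m + 1) * N" using c d s by (simp add: algebra_simps)
  then show ?thesis unfolding ev_def using eval_evals.Call[OF _ c(1) d(1)] s assms(3) by auto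
qed

lemma evlist_Nil: "evlist N \<rho> [] [] 0"
  unfolding evlist_def using eval_evals.evals_Nil by blast

lemma evlist_Cons: "ev N \<rho> a x n \<Longrightarrow> evlist N \<rho> as xs m \<Longrightarrow> evlist N \<rho> (a # as) (x # xs) (n + m)"
  unfolding ev_def evlist_def using eval_evals.evals_Cons by (fastforce simp: algebra_simps)

text \<open>The bodies are executed symbolically: resolution with these rules instantiates the value
  and the number of steps, which \<open>ev_weaken\<close> compares with the claimed ones. The rules
  \<open>ev_if\<close> select a branch once the value of the condition is known.\<close>

lemmas ev_rules = ev_Param0 ev_Param1 ev_Param2 ev_Param3 ev_True_Cell ev_Quote_Atom ev_Cons_Cell ev_Head ev_Tail
  ev_If_Cell ev_if ev_Call evlist_Nil evlist_Cons

text \<open>Used with the size of the encoded state as \<open>\<mu>\<close>. As no operation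
  decreases it, a bound on the final state also bounds all states before it.\<close>

lemma le_fold: "(\<And>x y. \<mu> y \<le> (\<mu> (g x y) :: nat)) \<Longrightarrow> \<mu> y \<le> \<mu> (fold g xs y)"
  by (induction xs arbitrary: y) (auto intro: le_trans)

lemma size_grow: "size (enc_state s st) \<le> size (enc_state s (grow (spare s) k st))"
  by (cases k; cases "map_of (reps st) k") (simp_all add: grow_def enc_state_def enc_spare_Suc)

lemma size_share: "size (enc_state s st) \<le> size (enc_state s (share k k' st))"
  by (simp add: share_def enc_state_def)

lemma size_join: "size (enc_state s st) \<le> size (enc_state s (join k k' st))"
  by (simp add: join_def enc_state_def)

lemma size_fork: "size (enc_state s st) \<le> size (enc_state s (fork (spare s) a b us st))"
  unfolding fork_def by (rule le_fold) (meson le_trans size_grow size_share)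

lemma size_link: "size (enc_state s st) \<le> size (enc_state s (link (spare s) t e st))"
  by (cases e) (auto simp: link.simps intro: le_trans[OF size_grow] le_trans[OF size_grow size_join])

lemma size_links: "size (enc_state s st) \<le> size (enc_state s (links (spare s) bags es st))"
  unfolding links_def by (rule le_fold) (auto simp: size_link)

definition enc_work :: "nat \<Rightarrow> nat list \<times> nat state \<Rightarrow> sexp" where
  "enc_work s w = Cell (enc_list enc_nat (fst w)) (enc_state s (snd w))"

lemma size_cross: "size (enc_work s w) \<le> size (enc_work s (cross (spare s) bags a b w))"
  by (cases w) (simp add: cross.simps enc_work_def size_fork trans_le_add2 add_mono)

lemma size_sweep: "size (enc_work s w) \<le> size (enc_work s (sweep (spare s) bags ts w))"
  unfolding sweep_def by (rule le_fold) (auto intro: le_trans[OF size_cross size_cross])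

lemma size_sweeps: "size (enc_work s w) \<le> size (enc_work s (fold (\<lambda>_. sweep (spare s) bags ts) xs w))"
  by (rule le_fold) (rule size_sweep)

lemma size_bag_of: "size (enc_list enc_nat (bag_of bags t)) \<le> size (enc_bags bags)"
proof (induction bags)
  case (Cons p bags)
  then show ?case by (cases p) (simp add: bag_of_def)
qed (simp add: bag_of_def)

lemma enc_spare_0: "enc_nat (spare n 0) = (Cell tt ^^ n) Atom"
proof (induction n)
  case (Suc n)
  have "spare (Suc n) 0 = spare n (Suc 0)" by (simp add: spare_def)
  then show ?case using Suc enc_spare_Suc[of n 0] by simp
qed (simp add: spare_def)

lemma size_funpow_tt: "size ((Cell tt ^^ n) acc) = size acc + 2 * n"
  by (induction n) auto

section \<open>Step counts of the functions of the program\<close>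

context
  fixes N :: nat
  assumes N: "10 \<le> N"
begin

lemma length_Cons_mult: "(length (x # xs) + 1) * c = (length xs + 1) * c + (c :: nat)"
  by simp

text \<open>Step counts have the form \<open>c * N ^ k\<close>. The factor 10 lets terms of lower
  order be absorbed by the slack in the constant of the leading one.\<close>

lemma N_powers: "N \<le> N ^ 2" "N ^ 2 \<le> N ^ 3" "N ^ 3 \<le> N ^ 4" "N ^ 4 \<le> N ^ 5" "10 * N \<le> N ^ 2"
    "10 * N ^ 2 \<le> N ^ 3" "10 * N ^ 3 \<le> N ^ 4" "10 * N ^ 4 \<le> N ^ 5"
proof -
  have "10 * N ^ k \<le> N ^ Suc k" for k using mult_le_mono1[OF N, of "N ^ k"] by simp
  from this[of 1] this[of 2] this[of 3] this[of 4]
  show "10 * N \<le> N ^ 2" "10 * N ^ 2 \<le> N ^ 3" "10 * N ^ 3 \<le> N ^ 4" "10 * N ^ 4 \<le> N ^ 5"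
    by (simp_all add: eval_nat_numeral)
  then show "N \<le> N ^ 2" "N ^ 2 \<le> N ^ 3" "N ^ 3 \<le> N ^ 4" "N ^ 4 \<le> N ^ 5" by linarith+
qed

text \<open>\<open>2 * size x + 1\<close> is the number of nodes of \<open>x\<close>, atoms
  included, and the comparison inspects each of them at most once.\<close>

lemma fn_eq:
  "size x < N \<Longrightarrow> size y < N \<Longrightarrow> fn N 1 [x, y] (if x = y then tt else Atom) (20 * (2 * size x + 1))"
proof (induction x arbitrary: y)
  case Atom
  show ?case
  proof (cases y)
    case Atom
    show ?thesis
      unfolding Atom fn_def prog_simps eq_body_def
      by (rule ev_weaken, (rule ev_rules | (use N in simp; fail))+)
  next
    case (Cell y1 y2)
    then have "size (Cell y1 y2) < N" using Atom.prems by simp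
    then show ?thesis
      unfolding Cell fn_def prog_simps eq_body_def
      by - (rule ev_weaken, (rule ev_rules | (use N in simp; fail))+)
  qed
next
  case (Cell x1 x2)
  show ?case
  proof (cases y)
    case Atom
    show ?thesis
      unfolding Atom fn_def prog_simps eq_body_def
      by (rule ev_weaken, (rule ev_rules | (use N Cell.prems in simp; fail))+)
  next
    case y: (Cell y1 y2)
    have sz: "size x1 + size x2 + 1 < N" "size y1 + size y2 + 1 < N" using Cell.prems y by simp_all
    have 1: "fn N 1 [x1, y1] (if x1 = y1 then tt else Atom) (20 * (2 * size x1 + 1))"
      using Cell.IH(1) sz by simp
    have 2: "fn N 1 [x2, y2] (if x2 = y2 then tt else Atom) (20 * (2 * size x2 + 1))"
      using Cell.IH(2) sz by simp
    show ?thesis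
    proof (cases "x1 = y1")
      case True
      have 3: "fn N 1 [x1, y1] tt (20 * (2 * size x1 + 1))" using 1 True by simp
      show ?thesis
        unfolding y fn_def prog_simps eq_body_def
        by (rule ev_weaken, (rule ev_rules 2 3 | (use N sz True in simp; fail))+)
    next
      case False
      have 3: "fn N 1 [x1, y1] Atom (20 * (2 * size x1 + 1))" using 1 False by simp
      show ?thesis
        unfolding y fn_def prog_simps eq_body_def
        by (rule ev_weaken, (rule ev_rules 3 | (use N sz False in simp; fail))+)
    qed
  qed
qed

lemma fn_eq_same: "size x < N \<Longrightarrow> fn N 1 [x, x] tt (40 * N)"
  by (rule fn_weaken[OF fn_eq]) auto

lemma fn_eq_diff: "x \<noteq> y \<Longrightarrow> size x < N \<Longrightarrow> size y < N \<Longrightarrow> fn N 1 [x, y] Atom (40 * N)"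
  by (rule fn_weaken[OF fn_eq]) auto

lemma fn_lookup:
  assumes inj: "\<And>x y. f x = f y \<Longrightarrow> x = y" and k: "size (f k) < N"
  shows "size (enc_list (enc_pair f g) l) < N \<Longrightarrow> fn N 2 [f k, enc_list (enc_pair f g) l]
    (case map_of l k of None \<Rightarrow> Atom | Some v \<Rightarrow> Cell (f k) (g v)) ((length l + 1) * (60 * N))"
proof (induction l)
  case Nil
  show ?case
    unfolding enc_list.simps fn_def prog_simps lookup_body_def
    by (rule ev_weaken, (rule ev_rules | (use N k in simp; fail))+)
next
  case (Cons p l)
  obtain k' v where p: "p = (k', v)" by (cases p)
  have sz: "size (f k') + size (g v) + size (enc_list (enc_pair f g) l) + 2 < N"
    using Cons.prems p by simp
  have IH: "fn N 2 [f k, enc_list (enc_pair f g) l]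
      (case map_of l k of None \<Rightarrow> Atom | Some v \<Rightarrow> Cell (f k) (g v)) ((length l + 1) * (60 * N))"
    using Cons.IH sz by simp
  show ?case
  proof (cases "k = k'")
    case True
    show ?thesis
      unfolding p True enc_list.simps enc_pair.simps fn_def prog_simps lookup_body_def
      by (rule ev_weaken, (rule ev_rules fn_eq_same | (use N k sz True in \<open>simp add: algebra_simps\<close>; fail))+)
  next
    case False
    then have ne: "f k \<noteq> f k'" using inj by blast
    show ?thesis
      unfolding p enc_list.simps enc_pair.simps fn_def prog_simps lookup_body_def
      by (rule ev_weaken, (rule ev_rules fn_eq_diff[OF ne] IH |
          (use N k sz False in \<open>simp add: algebra_simps\<close>; fail))+)
  qed
qed

text \<open>A list whose encoding is smaller than \<open>N\<close> has fewer than \<open>N\<close>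
  entries, so a pass over it costs one more factor \<open>N\<close>, the final call on the empty
  list included.\<close>

lemma list_bound: "size (enc_list f l) < N \<Longrightarrow> (length l + 1) * (c * N ^ k) \<le> c * N ^ Suc k"
  using mult_le_mono1[of "length l + 1" N "c * N ^ k"] length_le_size_enc_list[of l f]
  by (simp add: mult.left_commute)

lemma list_bound': "size (enc_list f l) < N \<Longrightarrow> k' = Suc k \<Longrightarrow> (length l + 1) * (c * N ^ k) \<le> c * N ^ k'"
  using list_bound by simp

lemma fn_lookup_reps:
  assumes "size (Cell (enc_nat t) (enc_nat u)) < N" "size (enc_reps l) < N"
  shows "map_of l (t, u) = Some r \<Longrightarrow> fn N 2 [Cell (enc_nat t) (enc_nat u), enc_reps l]
      (Cell (Cell (enc_nat t) (enc_nat u)) (enc_nat r)) (60 * N ^ 2)"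
    "map_of l (t, u) = None \<Longrightarrow> fn N 2 [Cell (enc_nat t) (enc_nat u), enc_reps l] Atom (60 * N ^ 2)"
proof -
  have *: "fn N 2 [enc_edge (t, u), enc_reps l] (case map_of l (t, u) of None \<Rightarrow> Atom
     | Some v \<Rightarrow> Cell (enc_edge (t, u)) (enc_nat v)) ((length l + 1) * (60 * N))"
    by (rule fn_lookup) (use assms enc_edge_inject in auto)
  show "map_of l (t, u) = Some r \<Longrightarrow> fn N 2 [Cell (enc_nat t) (enc_nat u), enc_reps l]
      (Cell (Cell (enc_nat t) (enc_nat u)) (enc_nat r)) (60 * N ^ 2)"
    "map_of l (t, u) = None \<Longrightarrow> fn N 2 [Cell (enc_nat t) (enc_nat u), enc_reps l] Atom (60 * N ^ 2)"
    using fn_weaken[OF * refl] list_bound[OF assms(2), of 60 1] by (simp_all add: numeral_2_eq_2)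
qed

lemma fn_lookup_bags:
  assumes "size (enc_nat t) < N" "size (enc_bags l) < N"
  shows "map_of l t = Some b \<Longrightarrow> fn N 2 [enc_nat t, enc_bags l]
      (Cell (enc_nat t) (enc_list enc_nat b)) (60 * N ^ 2)"
    "map_of l t = None \<Longrightarrow> fn N 2 [enc_nat t, enc_bags l] Atom (60 * N ^ 2)"
proof -
  have *: "fn N 2 [enc_nat t, enc_bags l] (case map_of l t of None \<Rightarrow> Atom
     | Some v \<Rightarrow> Cell (enc_nat t) (enc_list enc_nat v)) ((length l + 1) * (60 * N))"
    by (rule fn_lookup) (use assms enc_nat_inject in auto)
  show "map_of l t = Some b \<Longrightarrow> fn N 2 [enc_nat t, enc_bags l]
      (Cell (enc_nat t) (enc_list enc_nat b)) (60 * N ^ 2)"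
    "map_of l t = None \<Longrightarrow> fn N 2 [enc_nat t, enc_bags l] Atom (60 * N ^ 2)"
    using fn_weaken[OF * refl] list_bound[OF assms(2), of 60 1] by (simp_all add: numeral_2_eq_2)
qed

lemma fn_member_aux:
  assumes k: "size (enc_nat k) < N"
  shows "size (enc_list enc_nat l) < N \<Longrightarrow>
    fn N 3 [enc_nat k, enc_list enc_nat l] (if k \<in> set l then tt else Atom) ((length l + 1) * (60 * N))"
proof (induction l)
  case Nil
  show ?case
    unfolding enc_list.simps fn_def prog_simps member_body_def
    by (rule ev_weaken, (rule ev_rules | (use N k in simp; fail))+)
next
  case (Cons k' l)
  have sz: "size (enc_nat k') + size (enc_list enc_nat l) + 1 < N" using Cons.prems by simp
  have IH: "fn N 3 [enc_nat k, enc_list enc_nat l] (if k \<in> set l then tt else Atom) ((length l + 1) * (60 * N))"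
    using Cons.IH sz by simp
  show ?case
  proof (cases "k = k'")
    case True
    show ?thesis
      unfolding True enc_list.simps fn_def prog_simps member_body_def
      by (rule ev_weaken, (rule ev_rules fn_eq_same | (use N k sz True in \<open>simp add: algebra_simps\<close>; fail))+)
  next
    case False
    then have ne: "enc_nat k \<noteq> enc_nat k'" using enc_nat_inject by blast
    show ?thesis
      unfolding enc_list.simps fn_def prog_simps member_body_def
      by (rule ev_weaken, (rule ev_rules fn_eq_diff[OF ne] IH |
          (use N k sz False in \<open>simp add: algebra_simps\<close>; fail))+)
  qed
qed

lemma fn_member:
  assumes "size (enc_nat k) < N" "size (enc_list enc_nat l) < N"
  shows "k \<in> set l \<Longrightarrow> fn N 3 [enc_nat k, enc_list enc_nat l] tt (60 * N ^ 2)"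
    "k \<notin> set l \<Longrightarrow> fn N 3 [enc_nat k, enc_list enc_nat l] Atom (60 * N ^ 2)"
  using fn_weaken[OF fn_member_aux[OF assms] refl] list_bound[OF assms(2), of 60 1]
  by (simp_all add: numeral_2_eq_2)

text \<open>The \<open>let\<close> of the body is unfolded, so the lookup of
  \<open>60 * N ^ 2\<close> steps may run twice, once for the test and once for the value.\<close>

lemma fn_rep:
  assumes "size (Cell (enc_nat t) (enc_nat u)) < N" "size (enc_state s st) < N"
  shows "fn N 4 [Cell (enc_nat t) (enc_nat u), enc_state s st] (enc_nat (rep st (t, u))) (130 * N ^ 2)"
proof -
  have l: "size (enc_reps (reps st)) < N" using assms(2) by (simp add: enc_state_def)
  note sz = assms[unfolded enc_state_def]
  note look = fn_lookup_reps[OF assms(1) l]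
  show ?thesis
  proof (cases "map_of (reps st) (t, u)")
    case None
    show ?thesis
      unfolding enc_state_def fn_def prog_simps rep_body_def Let_def
      by (rule ev_weaken, (rule ev_rules look(2)[OF None] |
        (use N sz None N_powers(1,5) in \<open>simp add: rep_def\<close>; fail))+)
  next
    case (Some r)
    show ?thesis
      unfolding enc_state_def fn_def prog_simps rep_body_def Let_def
      by (rule ev_weaken, (rule ev_rules look(1)[OF Some] |
        (use N sz Some N_powers(1,5) in \<open>simp add: rep_def\<close>; fail))+)
  qed
qed

lemmas fn_rep' = fn_rep[unfolded enc_state_def]

lemma fn_grow:
  assumes "size (Cell (enc_nat t) (enc_nat u)) < N" "size (enc_state s (grow (spare s) (t, u) st)) < N"
  shows "fn N 5 [Cell (enc_nat t) (enc_nat u), enc_state s st] (enc_state s (grow (spare s) (t, u) st)) (250 * N ^ 2)"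
proof (cases "map_of (reps st) (t, u)")
  case None
  have g: "grow (spare s) (t, u) st = st" using None by (simp add: grow_def)
  have l: "size (enc_reps (reps st)) < N" using assms(2) by (simp add: enc_state_def g)
  note sz = assms[unfolded enc_state_def g]
  show ?thesis
    unfolding g enc_state_def fn_def prog_simps grow_body_def Let_def
    by (rule ev_weaken, (rule ev_rules fn_lookup_reps(2)[OF assms(1) l None] |
      (use N sz None N_powers(1,5) in simp; fail))+)
next
  case (Some r)
  have l: "size (enc_reps (reps st)) < N" using assms(2) by (simp add: enc_state_def grow_def Some)
  have sz: "size (enc_nat t) + size (enc_nat u) + 1 < N" using assms(1) by simp
  \<comment> \<open>The new name occurs four times in the grown state: as a representative, within
    the next name, as a vertex and as an end of an edge. The 11 counts the cells around the listed
    parts.\<close>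
  have sz': "size (enc_nat t) + size (enc_nat u) + size (enc_nat (spare s (used st))) + size (enc_reps (reps st)) +
      size (enc_nat (spare s (used st))) + size (enc_nat (spare s (used st))) + size (enc_list enc_nat (vlist st)) +
      size (enc_nat r) + size (enc_nat (spare s (used st))) + size (enc_list enc_edge (elist st)) + 11 < N"
    using assms(2) by (simp add: enc_state_def grow_def Some enc_spare_Suc)
  show ?thesis
    unfolding enc_state_def fn_def prog_simps grow_body_def Let_def
    by (rule ev_weaken, (rule ev_rules fn_lookup_reps(1)[OF assms(1) l Some] fn_rep' |
      (use N sz sz' Some N_powers(1,5) in \<open>simp add: grow_def rep_def enc_spare_Suc\<close>; fail))+)
qed

lemma fn_share:
  assumes "size (Cell (enc_nat a) (enc_nat u)) < N" "size (Cell (enc_nat b) (enc_nat v)) < N"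
    "size (enc_state s (share (a, u) (b, v) st)) < N"
  shows "fn N 6 [Cell (enc_nat a) (enc_nat u), Cell (enc_nat b) (enc_nat v), enc_state s st]
    (enc_state s (share (a, u) (b, v) st)) (150 * N ^ 2)"
proof -
  have "size (enc_state s st) < N" using assms(3) size_share le_less_trans by blast
  note sz = assms(1,2) this[unfolded enc_state_def] assms(3)[unfolded enc_state_def share_def, simplified]
  show ?thesis
    unfolding enc_state_def fn_def prog_simps share_body_def
    by (rule ev_weaken, (rule ev_rules fn_rep' |
      (use N sz N_powers(1,5) in \<open>simp add: share_def\<close>; fail))+)
qed

text \<open>Each vertex costs 250 units of \<open>N ^ 2\<close> for growing and 150 for sharing; the
  rest of the 450 pays for the keys and the recursive call.\<close>

lemma fn_fork:
  "size (enc_nat a) + size (enc_list enc_nat us) + 1 < N \<Longrightarrow>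
   size (enc_nat b) + size (enc_list enc_nat us) + 1 < N \<Longrightarrow>
   size (enc_state s (fork (spare s) a b us st)) < N \<Longrightarrow>
   fn N 7 [enc_nat a, enc_nat b, enc_list enc_nat us, enc_state s st]
     (enc_state s (fork (spare s) a b us st)) ((length us + 1) * (450 * N ^ 2))"
proof (induction us arbitrary: st)
  case Nil
  note sz = Nil.prems(1) Nil.prems(2,3)[unfolded fork_def, simplified]
  have f: "fork (spare s) a b [] st = st" by (simp add: fork_def)
  show ?case
    unfolding f enc_list.simps fn_def prog_simps fork_body_def Let_def
    by (rule ev_weaken, (rule ev_rules | (use N sz N_powers(1,5) in simp; fail))+)
next
  case (Cons u us)
  define st1 where "st1 = grow (spare s) (a, u) st"
  define st2 where "st2 = share (a, u) (b, u) st1"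
  have f: "fork (spare s) a b (u # us) st = fork (spare s) a b us st2"
    by (simp add: fork_def st1_def st2_def)
  have s2: "size (enc_state s st2) < N" using Cons.prems(3) size_fork le_less_trans unfolding f by blast
  then have s1: "size (enc_state s st1) < N" unfolding st2_def using size_share le_less_trans by blast
  then have s0: "size (enc_state s st) < N" unfolding st1_def using size_grow le_less_trans by blast
  have sz: "size (enc_nat a) + size (enc_nat u) + size (enc_list enc_nat us) + 2 < N"
    "size (enc_nat b) + size (enc_nat u) + size (enc_list enc_nat us) + 2 < N"
    using Cons.prems(1,2) by simp_all
  have IH: "fn N 7 [enc_nat a, enc_nat b, enc_list enc_nat us, enc_state s st2]
     (enc_state s (fork (spare s) a b us st2)) ((length us + 1) * (450 * N ^ 2))"
    by (rule Cons.IH) (use sz Cons.prems(3) f in simp_all)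
  have 1: "fn N 5 [Cell (enc_nat a) (enc_nat u), enc_state s st] (enc_state s st1) (250 * N ^ 2)"
    unfolding st1_def by (rule fn_grow) (use sz s1 in \<open>simp_all add: st1_def\<close>)
  have 2: "fn N 6 [Cell (enc_nat a) (enc_nat u), Cell (enc_nat b) (enc_nat u), enc_state s st1]
    (enc_state s st2) (150 * N ^ 2)"
    unfolding st2_def by (rule fn_share) (use sz s2 in \<open>simp_all add: st2_def\<close>)
  show ?case
    unfolding f enc_list.simps fn_def prog_simps fork_body_def Let_def
    by (rule ev_weaken, (rule ev_rules IH 1 2 |
      (use N sz s0 N_powers(1,5) in \<open>simp add: algebra_simps\<close>; fail))+)
qed

lemma fn_cross:
  assumes "size (enc_bags bags) + size (enc_nat a) + 1 < N" "size (enc_bags bags) + size (enc_nat b) + 1 < N"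
    "size (enc_work s (cross (spare s) bags a b w)) < N"
  shows "fn N 8 [enc_bags bags, enc_nat a, enc_nat b, enc_work s w]
    (enc_work s (cross (spare s) bags a b w)) (700 * N ^ 3)"
proof -
  obtain W st where w: "w = (W, st)" by (cases w)
  have wk: "enc_work s (W, st) = Cell (enc_list enc_nat W) (enc_state s st)" by (simp add: enc_work_def)
  have "size (enc_work s w) < N" using assms(3) size_cross le_less_trans by blast
  then have sw: "size (enc_list enc_nat W) + size (enc_state s st) + 1 < N" by (simp add: w enc_work_def)
  note sz = assms(1,2) sw
  have W: "size (enc_list enc_nat W) < N" using sw by simp
  have ab: "size (enc_nat a) < N" "size (enc_nat b) < N" "size (enc_bags bags) < N" using sz by simp_all
  show ?thesis
  proof (cases "a \<in> set W")
    case a: True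
    show ?thesis
    proof (cases "b \<in> set W")
      case b: True
      have c: "cross (spare s) bags a b (W, st) = (W, st)" using b by (simp add: cross.simps)
      show ?thesis
        unfolding w c wk fn_def prog_simps cross_body_def
        by (rule ev_weaken, (rule ev_rules fn_member(1)[OF ab(1) W a] fn_member(1)[OF ab(2) W b] |
          (use N sz N_powers in simp; fail))+)
    next
      case b: False
      define us where "us = bag_of bags b"
      have c: "cross (spare s) bags a b (W, st) = (b # W, fork (spare s) a b us st)"
        using a b by (simp add: cross.simps us_def)
      have us: "size (enc_list enc_nat us) \<le> size (enc_bags bags)" by (simp add: us_def size_bag_of)
      have sz': "size (enc_nat b) + size (enc_list enc_nat W) + size (enc_state s (fork (spare s) a b us st)) + 2 < N"
        using assms(3) by (simp add: w c enc_work_def)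
      have "fn N 7 [enc_nat a, enc_nat b, enc_list enc_nat us, enc_state s st]
          (enc_state s (fork (spare s) a b us st)) ((length us + 1) * (450 * N ^ 2))"
        by (rule fn_fork) (use sz sz' us in simp_all)
      moreover have "(length us + 1) * (450 * N ^ 2) \<le> 450 * N ^ 3"
        using list_bound'[of enc_nat us 3 2 450] us sz by simp
      ultimately have 1: "fn N 7 [enc_nat a, enc_nat b, enc_list enc_nat us, enc_state s st]
          (enc_state s (fork (spare s) a b us st)) (450 * N ^ 3)"
        using fn_weaken by blast
      \<comment> \<open>The number of steps depends on the outcome of the lookup, so only a bound on
        it is kept.\<close>
      have "\<exists>n\<le>60 * N ^ 2 + 10. ev N [enc_bags bags, enc_nat a, enc_nat b, Cell (enc_list enc_nat W) (enc_state s st)]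
          (Tail (Call 2 [Param 2, Param 0])) (enc_list enc_nat us) n"
      proof (cases "map_of bags b")
        case None
        then have "us = []" by (simp add: us_def bag_of_def)
        then have u: "enc_list enc_nat us = Atom" by simp
        show ?thesis
          unfolding u by (intro exI conjI[rotated], rule ev_Tail_Atom,
            (rule ev_rules fn_lookup_bags(2)[OF ab(2,3) None] | (use N sz in simp; fail))+)
      next
        case (Some c)
        then have "us = c" by (simp add: us_def bag_of_def)
        show ?thesis
          unfolding \<open>us = c\<close> by (intro exI conjI[rotated],
            (rule ev_rules fn_lookup_bags(1)[OF ab(2,3) Some] | (use N sz in simp; fail))+)
      qed
      then obtain n where n: "n \<le> 60 * N ^ 2 + 10"
        and 2: "ev N [enc_bags bags, enc_nat a, enc_nat b, Cell (enc_list enc_nat W) (enc_state s st)]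
          (Tail (Call 2 [Param 2, Param 0])) (enc_list enc_nat us) n" by blast
      have wk': "enc_work s (b # W, fork (spare s) a b us st) =
          Cell (Cell (enc_nat b) (enc_list enc_nat W)) (enc_state s (fork (spare s) a b us st))"
        by (simp add: enc_work_def)
      show ?thesis
        unfolding w c wk wk' fn_def prog_simps cross_body_def
        by (rule ev_weaken, (rule 1 2 fn_member(1)[OF ab(1) W a] fn_member(2)[OF ab(2) W b] | rule ev_rules |
          (use N sz sz' n N_powers in simp; fail))+)
    qed
  next
    case a: False
    have c: "cross (spare s) bags a b (W, st) = (W, st)" using a by (simp add: cross.simps)
    show ?thesis
      unfolding w c wk fn_def prog_simps cross_body_def
      by (rule ev_weaken, (rule ev_rules fn_member(2)[OF ab(1) W a] |
        (use N sz N_powers in simp; fail))+)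
  qed
qed

text \<open>Each listed edge is crossed in both directions, at 700 units of \<open>N ^ 3\<close> per
  crossing.\<close>

lemma fn_sweep:
  "size (enc_bags bags) + size (enc_list enc_edge ts) + 1 < N \<Longrightarrow>
   size (enc_work s (sweep (spare s) bags ts w)) < N \<Longrightarrow>
   fn N 9 [enc_bags bags, enc_list enc_edge ts, enc_work s w]
     (enc_work s (sweep (spare s) bags ts w)) ((length ts + 1) * (1500 * N ^ 3))"
proof (induction ts arbitrary: w)
  case Nil
  have f: "sweep (spare s) bags [] w = w" by (simp add: sweep_def)
  note sz = Nil.prems(1) Nil.prems(2)[unfolded f]
  show ?case
    unfolding f enc_list.simps fn_def prog_simps sweep_body_def Let_def
    by (rule ev_weaken, (rule ev_rules | (use N sz N_powers in simp; fail))+)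
next
  case (Cons e ts)
  obtain a b where e: "e = (a, b)" by (cases e)
  define w1 where "w1 = cross (spare s) bags a b w"
  define w2 where "w2 = cross (spare s) bags b a w1"
  have f: "sweep (spare s) bags (e # ts) w = sweep (spare s) bags ts w2"
    by (simp add: sweep_def w1_def w2_def e)
  have s2: "size (enc_work s w2) < N" using Cons.prems(2) size_sweep le_less_trans unfolding f by blast
  then have s1: "size (enc_work s w1) < N" unfolding w2_def using size_cross le_less_trans by blast
  then have s0: "size (enc_work s w) < N" unfolding w1_def using size_cross le_less_trans by blast
  have sz: "size (enc_bags bags) + size (enc_nat a) + size (enc_nat b) + size (enc_list enc_edge ts) + 3 < N"
    using Cons.prems(1) e by simp
  have IH: "fn N 9 [enc_bags bags, enc_list enc_edge ts, enc_work s w2]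
     (enc_work s (sweep (spare s) bags ts w2)) ((length ts + 1) * (1500 * N ^ 3))"
    by (rule Cons.IH) (use sz Cons.prems(2) f in simp_all)
  have 1: "fn N 8 [enc_bags bags, enc_nat a, enc_nat b, enc_work s w] (enc_work s w1) (700 * N ^ 3)"
    unfolding w1_def by (rule fn_cross) (use sz s1 in \<open>simp_all add: w1_def\<close>)
  have 2: "fn N 8 [enc_bags bags, enc_nat b, enc_nat a, enc_work s w1] (enc_work s w2) (700 * N ^ 3)"
    unfolding w2_def by (rule fn_cross) (use sz s2 in \<open>simp_all add: w2_def\<close>)
  show ?case
    unfolding f[unfolded e] e enc_list.simps enc_pair.simps fn_def prog_simps sweep_body_def Let_def
    by (rule ev_weaken, (rule IH 1 2 refl | rule ev_rules | (use N sz s0 in simp; fail) |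
      (simp only: length_Cons_mult, use N N_powers in linarith))+)
qed

lemma fn_sweeps:
  "size (enc_bags bags) + size (enc_list enc_edge ts) + 1 < N \<Longrightarrow>
   size (enc_list g xs) < N \<Longrightarrow>
   size (enc_work s (fold (\<lambda>_. sweep (spare s) bags ts) xs w)) < N \<Longrightarrow>
   fn N 10 [enc_list g xs, enc_bags bags, enc_list enc_edge ts, enc_work s w]
     (enc_work s (fold (\<lambda>_. sweep (spare s) bags ts) xs w)) ((length xs + 1) * (1600 * N ^ 4))"
proof (induction xs arbitrary: w)
  case Nil
  have f: "fold (\<lambda>_. sweep (spare s) bags ts) [] w = w" by simp
  note sz = Nil.prems(1) Nil.prems(3)[unfolded f]
  show ?case
    unfolding f enc_list.simps fn_def prog_simps sweeps_body_def Let_def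
    by (rule ev_weaken, (rule ev_rules | (use N sz N_powers in simp; fail))+)
next
  case (Cons x xs)
  define w1 where "w1 = sweep (spare s) bags ts w"
  have f: "fold (\<lambda>_. sweep (spare s) bags ts) (x # xs) w = fold (\<lambda>_. sweep (spare s) bags ts) xs w1"
    by (simp add: w1_def)
  have s1: "size (enc_work s w1) < N" using Cons.prems(3) size_sweeps le_less_trans unfolding f by blast
  then have s0: "size (enc_work s w) < N" unfolding w1_def using size_sweep le_less_trans by blast
  have sz: "size (enc_bags bags) + size (enc_list enc_edge ts) + 1 < N" "size (g x) + size (enc_list g xs) + 1 < N"
    using Cons.prems(1,2) by simp_all
  have IH: "fn N 10 [enc_list g xs, enc_bags bags, enc_list enc_edge ts, enc_work s w1]
     (enc_work s (fold (\<lambda>_. sweep (spare s) bags ts) xs w1)) ((length xs + 1) * (1600 * N ^ 4))"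
    by (rule Cons.IH) (use sz Cons.prems(3) f in simp_all)
  have "size (enc_list enc_edge ts) < N" using sz by simp
  then have "(length ts + 1) * (1500 * N ^ 3) \<le> 1500 * N ^ 4"
    using list_bound'[of enc_edge ts 4 3 1500] by simp
  then have 1: "fn N 9 [enc_bags bags, enc_list enc_edge ts, enc_work s w] (enc_work s w1) (1500 * N ^ 4)"
    unfolding w1_def by (rule fn_weaken[OF fn_sweep refl, rotated 2]) (use sz s1 in \<open>simp_all add: w1_def\<close>)
  show ?case
    unfolding f enc_list.simps fn_def prog_simps sweeps_body_def Let_def
    by (rule ev_weaken, (rule IH 1 | rule ev_rules |
      (use N sz s0 N_powers in \<open>simp add: algebra_simps\<close>; fail))+)
qed

lemma fn_home:
  "size (enc_bags bags) < N \<Longrightarrow> size (enc_nat u) < N \<Longrightarrow> size (enc_nat v) < N \<Longrightarrow>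
   fn N 11 [enc_nat u, enc_nat v, enc_bags bags] (enc_nat (home u v bags)) ((length bags + 1) * (150 * N ^ 2))"
proof (induction bags)
  case Nil
  have f: "enc_nat (home u v []) = Atom" by simp
  show ?case
    unfolding f enc_list.simps fn_def prog_simps home_body_def Let_def
    by (rule ev_weaken, (rule ev_rules | (use N Nil N_powers(1,5) in simp; fail))+)
next
  case (Cons p bags)
  obtain t b where p: "p = (t, b)" by (cases p)
  have sz: "size (enc_nat t) + size (enc_list enc_nat b) + size (enc_bags bags) + 2 < N"
    using Cons.prems(1) p by simp
  have b: "size (enc_list enc_nat b) < N" using sz by simp
  have IH: "fn N 11 [enc_nat u, enc_nat v, enc_bags bags] (enc_nat (home u v bags)) ((length bags + 1) * (150 * N ^ 2))"
    by (rule Cons.IH) (use sz Cons.prems in simp_all)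
  consider "u \<in> set b" "v \<in> set b" | "u \<notin> set b" | "u \<in> set b" "v \<notin> set b" by blast
  then show ?case
  proof cases
    case 1
    show ?thesis
      unfolding p enc_list.simps enc_pair.simps fn_def prog_simps home_body_def Let_def
      by (rule ev_weaken, (rule fn_member(1)[OF Cons.prems(2) b 1(1)] fn_member(1)[OF Cons.prems(3) b 1(2)]
        | rule ev_rules | (use N sz Cons.prems(2,3) 1 N_powers in \<open>simp add: algebra_simps\<close>; fail))+)
  next
    case 2
    show ?thesis
      unfolding p enc_list.simps enc_pair.simps fn_def prog_simps home_body_def Let_def
      by (rule ev_weaken, (rule fn_member(2)[OF Cons.prems(2) b 2] IH
        | rule ev_rules | (use N sz Cons.prems(2,3) 2 N_powers in \<open>simp add: algebra_simps\<close>; fail))+)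
  next
    case 3
    show ?thesis
      unfolding p enc_list.simps enc_pair.simps fn_def prog_simps home_body_def Let_def
      by (rule ev_weaken, (rule fn_member(1)[OF Cons.prems(2) b 3(1)] fn_member(2)[OF Cons.prems(3) b 3(2)] IH
        | rule ev_rules | (use N sz Cons.prems(2,3) 3 N_powers in \<open>simp add: algebra_simps\<close>; fail))+)
  qed
qed

lemma fn_join:
  assumes "size (Cell (enc_nat t) (enc_nat u)) < N" "size (Cell (enc_nat t') (enc_nat v)) < N"
    "size (enc_state s (join (t, u) (t', v) st)) < N"
  shows "fn N 12 [Cell (enc_nat t) (enc_nat u), Cell (enc_nat t') (enc_nat v), enc_state s st]
    (enc_state s (join (t, u) (t', v) st)) (300 * N ^ 2)"
proof -
  have "size (enc_state s st) < N" using assms(3) size_join le_less_trans by blast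
  note sz = assms(1,2) this[unfolded enc_state_def] assms(3)[unfolded enc_state_def join_def, simplified]
  show ?thesis
    unfolding enc_state_def fn_def prog_simps join_body_def
    by (rule ev_weaken, (rule ev_rules fn_rep' |
      (use N sz N_powers(1,5) in \<open>simp add: join_def\<close>; fail))+)
qed

lemma fn_link:
  assumes "size (Cell (enc_nat t) (enc_nat u)) < N" "size (Cell (enc_nat t) (enc_nat v)) < N"
    "size (enc_state s (link (spare s) t (u, v) st)) < N"
  shows "fn N 13 [enc_nat t, enc_nat u, enc_nat v, enc_state s st]
    (enc_state s (link (spare s) t (u, v) st)) (850 * N ^ 2)"
proof -
  define st1 where "st1 = grow (spare s) (t, u) st"
  define st2 where "st2 = grow (spare s) (t, v) st1"
  have f: "link (spare s) t (u, v) st = join (t, u) (t, v) st2" by (simp add: link.simps st1_def st2_def)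
  have s2: "size (enc_state s st2) < N" using assms(3) size_join le_less_trans unfolding f by blast
  then have s1: "size (enc_state s st1) < N" unfolding st2_def using size_grow le_less_trans by blast
  then have s0: "size (enc_state s st) < N" unfolding st1_def using size_grow le_less_trans by blast
  have 1: "fn N 5 [Cell (enc_nat t) (enc_nat u), enc_state s st] (enc_state s st1) (250 * N ^ 2)"
    unfolding st1_def by (rule fn_grow) (use assms s1 in \<open>simp_all add: st1_def\<close>)
  have 2: "fn N 5 [Cell (enc_nat t) (enc_nat v), enc_state s st1] (enc_state s st2) (250 * N ^ 2)"
    unfolding st2_def by (rule fn_grow) (use assms s2 in \<open>simp_all add: st2_def\<close>)
  have 3: "fn N 12 [Cell (enc_nat t) (enc_nat u), Cell (enc_nat t) (enc_nat v), enc_state s st2]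
    (enc_state s (join (t, u) (t, v) st2)) (300 * N ^ 2)"
    by (rule fn_join) (use assms f in simp_all)
  show ?thesis
    unfolding f fn_def prog_simps link_body_def Let_def
    by (rule ev_weaken, (rule 1 2 3 | rule ev_rules |
      (use N s0 assms(1,2) N_powers in simp; fail))+)
qed

lemma fn_links:
  "size (enc_bags bags) + size (enc_list enc_edge es) + 1 < N \<Longrightarrow>
   size (enc_state s (links (spare s) bags es st)) < N \<Longrightarrow>
   fn N 14 [enc_bags bags, enc_list enc_edge es, enc_state s st]
     (enc_state s (links (spare s) bags es st)) ((length es + 1) * (1050 * N ^ 3))"
proof (induction es arbitrary: st)
  case Nil
  have f: "links (spare s) bags [] st = st" by (simp add: links_def)
  note sz = Nil.prems(1) Nil.prems(2)[unfolded f]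
  show ?case
    unfolding f enc_list.simps fn_def prog_simps links_body_def Let_def
    by (rule ev_weaken, (rule ev_rules | (use N sz N_powers in simp; fail))+)
next
  case (Cons e es)
  obtain u v where e: "e = (u, v)" by (cases e)
  define t where "t = home u v bags"
  define st1 where "st1 = link (spare s) t (u, v) st"
  have f: "links (spare s) bags (e # es) st = links (spare s) bags es st1"
    by (simp add: links_def st1_def t_def e)
  have s1: "size (enc_state s st1) < N" using Cons.prems(2) size_links le_less_trans unfolding f by blast
  then have s0: "size (enc_state s st) < N" unfolding st1_def using size_link le_less_trans by blast
  have sz: "size (enc_bags bags) + size (enc_nat u) + size (enc_nat v) + size (enc_list enc_edge es) + 3 < N"
    using Cons.prems(1) e by simp
  have IH: "fn N 14 [enc_bags bags, enc_list enc_edge es, enc_state s st1]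
     (enc_state s (links (spare s) bags es st1)) ((length es + 1) * (1050 * N ^ 3))"
    by (rule Cons.IH) (use sz Cons.prems(2) f in simp_all)
  \<comment> \<open>The result of \<open>home\<close> is a listed tree vertex or 0, whose encoding
    has size 0.\<close>
  have "size (enc_nat (home u v bags)) \<le> size (enc_bags bags)"
  proof (induction bags)
    case (Cons p bags)
    then show ?case by (cases p) simp
  qed simp
  then have t: "size (enc_nat t) \<le> size (enc_bags bags)" by (simp add: t_def)
  have 1: "fn N 13 [enc_nat t, enc_nat u, enc_nat v, enc_state s st] (enc_state s st1) (850 * N ^ 2)"
    unfolding st1_def by (rule fn_link) (use sz t s1 in \<open>simp_all add: st1_def\<close>)
  have "size (enc_bags bags) < N" using sz by simp
  then have "(length bags + 1) * (150 * N ^ 2) \<le> 150 * N ^ 3"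
    using list_bound'[of "enc_pair enc_nat (enc_list enc_nat)" bags 3 2 150] by simp
  then have 2: "fn N 11 [enc_nat u, enc_nat v, enc_bags bags] (enc_nat t) (150 * N ^ 3)"
    unfolding t_def by (rule fn_weaken[OF fn_home refl, rotated 3]) (use sz in simp_all)
  show ?case
    unfolding f[unfolded e] e enc_list.simps enc_pair.simps fn_def prog_simps links_body_def Let_def
    by (rule ev_weaken, (rule IH 1 2 refl | rule ev_rules | (use N sz s0 in simp; fail) |
      (simp only: length_Cons_mult, use N N_powers in linarith))+)
qed

text \<open>Each cell of \<open>x\<close> contributes one digit, and a digit 1 takes two cells; this
  explains the hypothesis. All digits are equal, so the order in which the subtrees contribute is
  irrelevant to the result.\<close>

lemma fn_ones:
  "size acc + 2 * size x < N \<Longrightarrow> fn N 15 [x, acc] ((Cell tt ^^ size x) acc) (20 * (2 * size x + 1))"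
proof (induction x arbitrary: acc)
  case Atom
  show ?case
    unfolding fn_def prog_simps ones_body_def
    by (rule ev_weaken, (rule ev_rules | (use N Atom in simp; fail))+)
next
  case (Cell x y)
  have sz: "size acc + 2 * size x + 2 * size y + 2 < N" using Cell.prems by simp
  define acc1 where "acc1 = (Cell tt ^^ size y) (Cell tt acc)"
  have a1: "size acc1 = size acc + 2 + 2 * size y" by (simp add: acc1_def size_funpow_tt)
  have 1: "fn N 15 [y, Cell tt acc] acc1 (20 * (2 * size y + 1))"
    unfolding acc1_def by (rule Cell.IH(2)) (use sz in simp)
  have 2: "fn N 15 [x, acc1] ((Cell tt ^^ size x) acc1) (20 * (2 * size x + 1))"
    by (rule Cell.IH(1)) (use sz a1 in simp)
  have "(Cell tt ^^ size x) acc1 = (Cell tt ^^ size (Cell x y)) acc"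
    by (simp add: acc1_def funpow_add funpow_swap1)
  then show ?case
    unfolding fn_def prog_simps ones_body_def
    by - (rule ev_weaken, (rule 1 2 | rule ev_rules | (use N sz in simp; fail))+)
qed

text \<open>By monotonicity it suffices to bound the input with the first new name, the result of
  the traversal, and the final state. The last two are bounded separately because the list of
  visited bags is dropped in between.\<close>

lemma fn_main:
  assumes x: "x = Cell (Cell (enc_list enc_nat vs) (enc_list enc_edge es))
      (Cell (Cell y (enc_list enc_edge ts)) (enc_bags bags))" and "bags \<noteq> []"
    and sz: "2 * size x + 10 < N"
      "size (enc_work (size x) (fold (\<lambda>_. sweep (spare (size x)) bags ts) bags (start (spare (size x)) bags vs))) < N"
      "size (enc_state (size x) (ternarize (spare (size x)) vs es ts bags)) < N"
  defines "st \<equiv> ternarize (spare (size x)) vs es ts bags"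
  shows "fn N 0 [x] (Cell (enc_list enc_nat (vlist st)) (enc_list enc_edge (elist st))) (4000 * N ^ 5)"
proof -
  define s where "s = size x"
  obtain t b bags' where bags: "bags = (t, b) # bags'" using \<open>bags \<noteq> []\<close> by (cases bags) auto
  define st0 :: "nat state" where "st0 = \<lparr>reps = [], used = 0, vlist = vs, elist = []\<rparr>"
  define st1 where "st1 = fork (spare s) t t b st0"
  define w1 where "w1 = fold (\<lambda>_. sweep (spare s) bags ts) bags ([t], st1)"
  have w1: "w1 = fold (\<lambda>_. sweep (spare s) bags ts) bags (start (spare s) bags vs)"
    by (simp add: w1_def start_def bags st1_def st0_def)
  have st: "st = links (spare s) bags es (snd w1)"
    by (simp add: st_def ternarize_def w1 s_def)
  have sx: "size (enc_list enc_nat vs) + size (enc_list enc_edge es) + size y + size (enc_list enc_edge ts) +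
      size (enc_bags bags) + 4 = s" by (simp add: s_def x)
  have sb: "size (enc_bags bags) = size (enc_nat t) + size (enc_list enc_nat b) + size (enc_bags bags') + 2"
    by (simp add: bags)
  have N2: "2 * s + 10 < N" using sz(1) by (simp add: s_def)
  have sw: "size (enc_work s w1) < N" using sz(2) by (simp add: w1 s_def)
  have "size (enc_work s ([t], st1)) \<le> size (enc_work s w1)" unfolding w1_def by (rule size_sweeps)
  then have s1: "size (enc_nat t) + size (enc_state s st1) + 2 < N" using sw by (simp add: enc_work_def)
  then have s1': "size (enc_state s st1) < N" by simp
  then have s0: "size (enc_state s st0) < N" unfolding st1_def using size_fork le_less_trans by blast
  have st0: "enc_state s st0 = Cell Atom (Cell (enc_nat (spare s 0)) (Cell (enc_list enc_nat vs) Atom))"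
    by (simp add: enc_state_def st0_def)
  have wk: "enc_work s ([t], st1) = Cell (Cell (enc_nat t) Atom) (enc_state s st1)"
    by (simp add: enc_work_def)
  have wk1: "enc_work s w1 = Cell (enc_list enc_nat (fst w1)) (enc_state s (snd w1))"
    by (simp add: enc_work_def)
  have bg: "enc_bags bags = Cell (Cell (enc_nat t) (enc_list enc_nat b)) (enc_bags bags')"
    by (simp add: bags)
  have N5: "N ^ 2 \<le> N ^ 5" "N ^ 3 \<le> N ^ 5" "N \<le> N ^ 5" "10 * N \<le> N ^ 5" using N_powers by linarith+
  have 1: "fn N 15 [x, Atom] (enc_nat (spare s 0)) (40 * N)"
    by (rule fn_weaken[OF fn_ones]) (use N2 in \<open>simp_all add: s_def enc_spare_0\<close>)
  have lb: "(length b + 1) * (450 * N ^ 2) \<le> 450 * N ^ 3"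
    using list_bound'[of enc_nat b 3 2 450] sx sb N2 by simp
  have 2: "fn N 7 [enc_nat t, enc_nat t, enc_list enc_nat b, enc_state s st0] (enc_state s st1) (450 * N ^ 3)"
    unfolding st1_def by (rule fn_weaken[OF fn_fork refl lb]) (use sx sb N2 s1' in \<open>simp_all add: st1_def\<close>)
  have lbs: "(length bags + 1) * (1600 * N ^ 4) \<le> 1600 * N ^ 5"
    using list_bound'[of "enc_pair enc_nat (enc_list enc_nat)" bags 5 4 1600] sx N2 by simp
  have 3: "fn N 10 [enc_bags bags, enc_bags bags, enc_list enc_edge ts, enc_work s ([t], st1)]
      (enc_work s w1) (1600 * N ^ 5)"
    unfolding w1_def by (rule fn_weaken[OF fn_sweeps refl lbs]) (use sx N2 sw in \<open>simp_all add: w1_def\<close>)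
  have le: "(length es + 1) * (1050 * N ^ 3) \<le> 1050 * N ^ 4"
    using list_bound'[of enc_edge es 4 3 1050] sx N2 by simp
  have sst: "size (enc_state s st) < N" using sz(3) by (simp add: st_def s_def)
  have 4: "fn N 14 [enc_bags bags, enc_list enc_edge es, enc_state s (snd w1)] (enc_state s st) (1050 * N ^ 4)"
    unfolding st by (rule fn_weaken[OF fn_links refl le]) (use sx N2 sst in \<open>simp_all add: st\<close>)
  have st': "enc_state s st = Cell (enc_reps (reps st)) (Cell (enc_nat (spare s (used st)))
     (Cell (enc_list enc_nat (vlist st)) (enc_list enc_edge (elist st))))" by (simp add: enc_state_def)
  have facts: "10 \<le> N" "size (enc_list enc_nat vs) + size (enc_list enc_edge es) + size y + size (enc_list enc_edge ts) +
      size (enc_nat t) + size (enc_list enc_nat b) + size (enc_bags bags') + 16 < N"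
    "size (enc_nat t) + size (enc_state s st1) + 2 < N"
    "size (enc_nat (spare s 0)) + size (enc_list enc_nat vs) + 3 < N"
    using N N2 sx sb s1 s0[unfolded st0] by simp_all
  note calls = 1[unfolded x bg] 2[unfolded st0] 3[unfolded wk wk1 bg] 4[unfolded st' bg]
  show ?thesis
    unfolding x bg fn_def prog_simps main_body_def Let_def
    by (rule ev_weaken, (rule calls refl | rule ev_rules | (use facts in simp; fail) |
      (use N N5 N_powers in linarith))+)
qed

end

section \<open>Polynomial bounds\<close>

text \<open>A binary digit occupies one or two cells, so the size of a numeral is its length up to a
  factor 2. This lemma uses the lower bound, the next one the upper bound.\<close>

lemma less_two_power_size: "n < 2 ^ size (enc_nat n)"
proof (induction n rule: less_induct)
  case (less n)
  show ?case
  proof (cases "n = 0")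
    case False
    then have "n div 2 < 2 ^ size (enc_nat (n div 2))" using less by simp
    then have "n < 2 * 2 ^ size (enc_nat (n div 2))" by linarith
    also have "\<dots> \<le> 2 ^ size (enc_nat n)"
      using False by (subst (2) enc_nat.simps) simp
    finally show ?thesis .
  qed simp
qed

lemma size_enc_nat_le: "n < 2 ^ k \<Longrightarrow> size (enc_nat n) \<le> 2 * k"
proof (induction k arbitrary: n)
  case (Suc k)
  show ?case
  proof (cases "n = 0")
    case False
    have "size (enc_nat (n div 2)) \<le> 2 * k" using Suc by simp
    then show ?thesis using False by (subst enc_nat.simps) simp
  qed simp
qed simp

lemma size_enc_list_mem: "x \<in> set xs \<Longrightarrow> size (f x) < size (enc_list f xs)"
  by (induction xs) auto

lemma size_enc_list_le:
  "(\<And>x. x \<in> set xs \<Longrightarrow> size (f x) \<le> c) \<Longrightarrow> size (enc_list f xs) \<le> length xs * (c + 1)"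
  by (induction xs) (auto simp: add_mono algebra_simps)

definition numbers :: "nat state \<Rightarrow> nat set" where
  "numbers st = (\<Union>((t, u), r)\<in>set (reps st). {t, u, r}) \<union> set (vlist st) \<union> (\<Union>(u, v)\<in>set (elist st). {u, v})"

lemma in_numbers:
  "map_of (reps st) (t, u) = Some r \<Longrightarrow> t \<in> numbers st \<and> u \<in> numbers st \<and> r \<in> numbers st"
  "((t, u), r) \<in> set (reps st) \<Longrightarrow> t \<in> numbers st \<and> u \<in> numbers st \<and> r \<in> numbers st"
  "(u, v) \<in> set (elist st) \<Longrightarrow> u \<in> numbers st \<and> v \<in> numbers st"
  unfolding numbers_def by (fast dest: map_of_SomeD)+

text \<open>\<open>m\<close> grows by a constant with each operation, so that all sizes are polynomial in \<open>s\<close> and \<open>m\<close>.\<close>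

definition bounded_state :: "nat \<Rightarrow> nat \<Rightarrow> nat state \<Rightarrow> bool" where
  "bounded_state s m st \<longleftrightarrow>
     length (reps st) \<le> m \<and> length (vlist st) \<le> m \<and> length (elist st) \<le> m \<and> used st \<le> m \<and>
     (\<forall>n\<in>numbers st. n < 2 ^ (s + m))"

lemma less_two_power_mono: "(x :: nat) < 2 ^ (s + m) \<Longrightarrow> m \<le> m' \<Longrightarrow> x < 2 ^ (s + m')"
  by (erule less_le_trans) (simp add: power_increasing)

lemma bounded_state_mono: "bounded_state s m st \<Longrightarrow> m \<le> m' \<Longrightarrow> bounded_state s m' st"
  unfolding bounded_state_def by (meson le_trans less_two_power_mono)

lemma spare_less: "k \<le> m \<Longrightarrow> spare s k < 2 ^ (s + m)"
proof -
  assume "k \<le> m"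
  then have "(2 :: nat) ^ (s + k) \<le> 2 ^ (s + m)" by (simp add: power_increasing)
  moreover have "(0 :: nat) < 2 ^ (s + k)" by simp
  ultimately show ?thesis unfolding spare_def by linarith
qed

lemma bounded_grow:
  assumes "bounded_state s m st" shows "bounded_state s (Suc m) (grow (spare s) k st)"
proof (cases "map_of (reps st) k")
  case None
  then show ?thesis using bounded_state_mono[OF assms] by (simp add: grow_def)
next
  case (Some r)
  obtain t u where k: "k = (t, u)" by (cases k)
  \<comment> \<open>The key and the old representative occurred before, so growing contributes a
    single new number.\<close>
  have "numbers (grow (spare s) k st) = insert t (insert u (insert r (insert (spare s (used st)) (numbers st))))"
    using Some by (auto simp: grow_def k numbers_def)
  also have "\<dots> = insert (spare s (used st)) (numbers st)"
    using in_numbers(1)[of st t u r] Some k by (auto simp: insert_absorb)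
  finally have "numbers (grow (spare s) k st) = insert (spare s (used st)) (numbers st)" .
  moreover have "spare s (used st) < 2 ^ (s + Suc m)"
    using assms by (intro spare_less) (simp add: bounded_state_def)
  moreover have "\<forall>n\<in>numbers st. n < 2 ^ (s + Suc m)"
    using bounded_state_mono[OF assms, of "Suc m"] by (simp add: bounded_state_def)
  ultimately have "\<forall>n\<in>numbers (grow (spare s) k st). n < 2 ^ (s + Suc m)"
    by (simp only: ball_simps simp_thms)
  then show ?thesis using assms unfolding bounded_state_def by (simp add: grow_def Some)
qed

lemma rep_less:
  assumes "bounded_state s m st" "u < 2 ^ s" shows "rep st (t, u) < 2 ^ (s + m)"
proof (cases "map_of (reps st) (t, u)")
  case None
  then show ?thesis using less_two_power_mono[of u s 0 m] assms(2) by (simp add: rep_def)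
next
  case (Some r)
  then have "r \<in> numbers st" using in_numbers(1) by blast
  then show ?thesis using assms(1) Some by (simp add: rep_def bounded_state_def)
qed

lemma bounded_share:
  assumes "bounded_state s m st" "b < 2 ^ s" "u < 2 ^ s"
  shows "bounded_state s (Suc m) (share (a, u) (b, u) st)"
proof -
  have "bounded_state s (Suc m) st" using bounded_state_mono[OF assms(1)] by simp
  moreover have "rep st (a, u) < 2 ^ (s + Suc m)" using rep_less[OF calculation assms(3)] .
  moreover have "b < 2 ^ (s + Suc m)" "u < 2 ^ (s + Suc m)"
    using assms(2,3) less_two_power_mono[of _ s 0 "Suc m"] by simp_all
  moreover have "numbers (share (a, u) (b, u) st) = insert b (insert u (insert (rep st (a, u)) (numbers st)))"
    by (auto simp: share_def numbers_def)
  ultimately have "\<forall>n\<in>numbers (share (a, u) (b, u) st). n < 2 ^ (s + Suc m)"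
    unfolding bounded_state_def by (simp only: ball_simps simp_thms, elim conjE)
  then show ?thesis using assms(1) unfolding bounded_state_def by (simp add: share_def)
qed

lemma bounded_join:
  assumes "bounded_state s m st" "u < 2 ^ s" "v < 2 ^ s"
  shows "bounded_state s (Suc m) (join (t, u) (t', v) st)"
proof -
  have "bounded_state s (Suc m) st" using bounded_state_mono[OF assms(1)] by simp
  moreover have "rep st (t, u) < 2 ^ (s + Suc m)" "rep st (t', v) < 2 ^ (s + Suc m)"
    using rep_less[OF calculation] assms by blast+
  moreover have "numbers (join (t, u) (t', v) st) = insert (rep st (t, u)) (insert (rep st (t', v)) (numbers st))"
    by (auto simp: join_def numbers_def)
  ultimately have "\<forall>n\<in>numbers (join (t, u) (t', v) st). n < 2 ^ (s + Suc m)"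
    unfolding bounded_state_def by (simp only: ball_simps simp_thms, elim conjE)
  then show ?thesis using assms(1) unfolding bounded_state_def by (simp add: join_def)
qed

lemma bounded_fork:
  assumes "b < 2 ^ s"
  shows "bounded_state s m st \<Longrightarrow> \<forall>u\<in>set us. u < 2 ^ s \<Longrightarrow>
    bounded_state s (m + 2 * length us) (fork (spare s) a b us st)"
proof (induction us arbitrary: m st)
  case (Cons u us)
  have "bounded_state s (Suc (Suc m)) (share (a, u) (b, u) (grow (spare s) (a, u) st))"
    using bounded_share[OF bounded_grow[OF Cons.prems(1)] assms] Cons.prems(2) by simp
  from Cons.IH[OF this] Cons.prems(2) show ?case by (simp add: fork_def)
qed (simp add: fork_def)

definition bounded_work :: "nat \<Rightarrow> nat \<Rightarrow> nat list \<times> nat state \<Rightarrow> bool" where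
  "bounded_work s m w \<longleftrightarrow> length (fst w) \<le> m \<and> (\<forall>t\<in>set (fst w). t < 2 ^ s) \<and> bounded_state s m (snd w)"

definition bounded_bags :: "nat \<Rightarrow> (nat \<times> nat list) list \<Rightarrow> bool" where
  "bounded_bags s bags \<longleftrightarrow> (\<forall>(t, b)\<in>set bags. t < 2 ^ s \<and> length b \<le> s \<and> (\<forall>u\<in>set b. u < 2 ^ s))"

lemma bounded_bag_of:
  "bounded_bags s bags \<Longrightarrow> length (bag_of bags t) \<le> s \<and> (\<forall>u\<in>set (bag_of bags t). u < 2 ^ s)"
  by (cases "map_of bags t") (auto simp: bag_of_def bounded_bags_def dest!: map_of_SomeD)

text \<open>A bag has at most \<open>s\<close> vertices, and forking takes a growth and a sharing
  for each; the 1 is the new entry in the list of visited bags.\<close>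

lemma bounded_cross:
  assumes "bounded_work s m w" "bounded_bags s bags" "b < 2 ^ s"
  shows "bounded_work s (m + (2 * s + 1)) (cross (spare s) bags a b w)"
proof -
  obtain W st where w: "w = (W, st)" by (cases w)
  have st: "bounded_state s m st" using assms(1) by (simp add: w bounded_work_def)
  have "bounded_state s (m + 2 * length (bag_of bags b)) (fork (spare s) a b (bag_of bags b) st)"
    using bounded_fork[OF assms(3) st] bounded_bag_of[OF assms(2)] by simp
  then have "bounded_state s (m + (2 * s + 1)) (fork (spare s) a b (bag_of bags b) st)"
    by (rule bounded_state_mono) (use bounded_bag_of[OF assms(2), of b] in simp)
  moreover have "bounded_state s (m + (2 * s + 1)) st" using st by (rule bounded_state_mono) simp
  ultimately show ?thesis using assms by (auto simp: w cross.simps bounded_work_def)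
qed

lemma bounded_sweep:
  assumes "bounded_bags s bags"
  shows "bounded_work s m w \<Longrightarrow> \<forall>(a, b)\<in>set ts. a < 2 ^ s \<and> b < 2 ^ s \<Longrightarrow>
    bounded_work s (m + length ts * (4 * s + 2)) (sweep (spare s) bags ts w)"
proof (induction ts arbitrary: m w)
  case (Cons e ts)
  obtain a b where e: "e = (a, b)" by (cases e)
  have "bounded_work s (m + (2 * s + 1) + (2 * s + 1)) (cross (spare s) bags b a (cross (spare s) bags a b w))"
    using bounded_cross[OF bounded_cross[OF Cons.prems(1) assms] assms] Cons.prems(2) e by simp
  from Cons.IH[OF this] Cons.prems(2) show ?case by (simp add: sweep_def e algebra_simps)
qed (simp add: sweep_def)

lemma bounded_sweeps:
  assumes "bounded_bags s bags" "\<forall>(a, b)\<in>set ts. a < 2 ^ s \<and> b < 2 ^ s"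
  shows "bounded_work s m w \<Longrightarrow>
    bounded_work s (m + length xs * (length ts * (4 * s + 2))) (fold (\<lambda>_. sweep (spare s) bags ts) xs w)"
proof (induction xs arbitrary: m w)
  case (Cons x xs)
  from Cons.IH[OF bounded_sweep[OF assms(1) Cons.prems assms(2)]] show ?case
    by (simp add: algebra_simps)
qed simp

lemma bounded_link:
  assumes "bounded_state s m st" "u < 2 ^ s" "v < 2 ^ s"
  shows "bounded_state s (m + 3) (link (spare s) t (u, v) st)"
  using bounded_join[OF bounded_grow[OF bounded_grow[OF assms(1)]] assms(2,3)]
  by (simp add: link.simps numeral_3_eq_3)

lemma bounded_links:
  "bounded_state s m st \<Longrightarrow> \<forall>(u, v)\<in>set es. u < 2 ^ s \<and> v < 2 ^ s \<Longrightarrow>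
    bounded_state s (m + 3 * length es) (links (spare s) bags es st)"
proof (induction es arbitrary: m st)
  case (Cons e es)
  obtain u v where e: "e = (u, v)" by (cases e)
  have "bounded_state s (m + 3) (link (spare s) (home u v bags) (u, v) st)"
    using bounded_link[OF Cons.prems(1)] Cons.prems(2) e by simp
  from Cons.IH[OF this] Cons.prems(2) show ?case by (simp add: links_def e algebra_simps)
qed (simp add: links_def)

text \<open>With \<open>c = 2 * (s + m)\<close> as a bound on the size of one number, each of the at
  most \<open>m\<close> entries of \<open>reps\<close>, \<open>vlist\<close> and
  \<open>elist\<close> takes \<open>3 * c + 3\<close>, \<open>c + 1\<close> and
  \<open>2 * c + 2\<close> cells, which add up to \<open>12 * (s + m) + 6\<close>. The next new name
  and three cells come on top.\<close>

lemma size_bounded_state: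
  assumes "bounded_state s m st"
  shows "size (enc_state s st) \<le> m * (12 * (s + m) + 6) + 2 * (s + m) + 3"
proof -
  let ?c = "2 * (s + m)"
  have sp: "size (enc_nat (spare s (used st))) \<le> ?c"
    using assms by (intro size_enc_nat_le spare_less) (simp add: bounded_state_def)
  have "size (enc_reps (reps st)) \<le> length (reps st) * (3 * ?c + 2 + 1)"
  proof (rule size_enc_list_le)
    fix x assume "x \<in> set (reps st)"
    moreover obtain t u r where x: "x = ((t, u), r)" by (metis surj_pair)
    ultimately have "t \<in> numbers st" "u \<in> numbers st" "r \<in> numbers st"
      using in_numbers(2) by blast+
    then have "t < 2 ^ (s + m)" "u < 2 ^ (s + m)" "r < 2 ^ (s + m)"
      using assms unfolding bounded_state_def by blast+
    then have "size (enc_nat t) \<le> ?c" "size (enc_nat u) \<le> ?c" "size (enc_nat r) \<le> ?c"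
      by (simp_all only: size_enc_nat_le)
    then show "size (enc_pair enc_edge enc_nat x) \<le> 3 * ?c + 2" by (simp add: x)
  qed
  also have "\<dots> \<le> m * (3 * ?c + 2 + 1)" using assms by (intro mult_le_mono1) (simp add: bounded_state_def)
  finally have r: "size (enc_reps (reps st)) \<le> m * (3 * ?c + 3)" by (simp add: algebra_simps)
  have "size (enc_list enc_nat (vlist st)) \<le> length (vlist st) * (?c + 1)"
    by (rule size_enc_list_le, rule size_enc_nat_le) (use assms in \<open>simp add: bounded_state_def numbers_def\<close>)
  also have "\<dots> \<le> m * (?c + 1)" using assms by (intro mult_le_mono1) (simp add: bounded_state_def)
  finally have v: "size (enc_list enc_nat (vlist st)) \<le> m * (?c + 1)" .
  have "size (enc_list enc_edge (elist st)) \<le> length (elist st) * (2 * ?c + 1 + 1)"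
  proof (rule size_enc_list_le)
    fix x assume "x \<in> set (elist st)"
    moreover obtain u v where x: "x = (u, v)" by (metis surj_pair)
    ultimately have "u \<in> numbers st" "v \<in> numbers st"
      using in_numbers(3) by blast+
    then have "u < 2 ^ (s + m)" "v < 2 ^ (s + m)"
      using assms unfolding bounded_state_def by blast+
    then have "size (enc_nat u) \<le> ?c" "size (enc_nat v) \<le> ?c"
      by (simp_all only: size_enc_nat_le)
    then show "size (enc_edge x) \<le> 2 * ?c + 1" by (simp add: x)
  qed
  also have "\<dots> \<le> m * (2 * ?c + 1 + 1)" using assms by (intro mult_le_mono1) (simp add: bounded_state_def)
  finally have e: "size (enc_list enc_edge (elist st)) \<le> m * (2 * ?c + 2)" by (simp add: algebra_simps)
  show ?thesis using sp r v e by (simp add: enc_state_def algebra_simps)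
qed

lemma size_bounded_work:
  assumes "bounded_work s m w"
  shows "size (enc_work s w) \<le> m * (14 * (s + m) + 7) + 2 * (s + m) + 4"
proof -
  have "size (enc_list enc_nat (fst w)) \<le> length (fst w) * (2 * s + 1)"
    by (rule size_enc_list_le, rule size_enc_nat_le) (use assms in \<open>auto simp: bounded_work_def\<close>)
  also have "\<dots> \<le> m * (2 * s + 1)" using assms by (intro mult_le_mono1) (simp add: bounded_work_def)
  finally show ?thesis
    using assms size_bounded_state[of s m "snd w"] by (simp add: bounded_work_def enc_work_def algebra_simps)
qed

text \<open>At most \<open>s\<close> sweeps over at most \<open>s\<close> tree edges with a linear
  number of operations each make the number of entries cubic in \<open>s\<close>. The names are at
  most cubic as well, so the total size has degree 6.\<close>

definition size_bound :: "nat \<Rightarrow> nat" where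
  "size_bound s = 2000 * (s + 1) ^ 6"

lemma runs_prog:
  assumes x: "x = Cell (Cell (enc_list enc_nat vs) (enc_list enc_edge es))
      (Cell (Cell y (enc_list enc_edge ts)) (enc_bags bags))" and "bags \<noteq> []"
  defines "st \<equiv> ternarize (spare (size x)) vs es ts bags"
  shows "\<exists>c\<le>4000 * size_bound (size x) ^ 6.
    runs prog x (Cell (enc_list enc_nat (vlist st)) (enc_list enc_edge (elist st))) c"
proof -
  define s where "s = size x"
  \<comment> \<open>Of \<open>6 * s + 1\<close>, \<open>s\<close> accounts for the input vertices,
    \<open>2 * s\<close> for forking the root bag, 1 for the root in the list of visited bags, and
    \<open>3 * s\<close> for two growths and a join per edge of \<open>G\<close>. The cubic term is
    the contribution of the sweeps.\<close>
  define m where "m = 6 * s + 1 + s * (s * (4 * s + 2))"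
  obtain t b bags' where bags: "bags = (t, b) # bags'" using \<open>bags \<noteq> []\<close> by (cases bags) auto
  have sx: "size (enc_list enc_nat vs) + size (enc_list enc_edge es) + size y + size (enc_list enc_edge ts) +
      size (enc_bags bags) + 4 = s" by (simp add: s_def x)
  have num: "n < 2 ^ s" if "size (enc_nat n) \<le> s" for n
    by (rule less_le_trans[OF less_two_power_size power_increasing[OF that]]) simp
  have vs: "\<forall>v\<in>set vs. v < 2 ^ s"
  proof
    fix v assume "v \<in> set vs"
    from size_enc_list_mem[OF this, of enc_nat] show "v < 2 ^ s" by (intro num) (use sx in simp)
  qed
  have vs': "length vs \<le> s" using length_le_size_enc_list[of vs enc_nat] sx by simp
  have edges: "\<forall>(u, v)\<in>set l. u < 2 ^ s \<and> v < 2 ^ s" "length l \<le> s"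
    if l: "size (enc_list enc_edge l) \<le> s" for l
  proof -
    show "length l \<le> s" using length_le_size_enc_list[of l enc_edge] l by simp
    show "\<forall>(u, v)\<in>set l. u < 2 ^ s \<and> v < 2 ^ s"
    proof (clarify, intro conjI num)
      fix u v assume "(u, v) \<in> set l"
      from size_enc_list_mem[OF this, of enc_edge] l
      show "size (enc_nat u) \<le> s" "size (enc_nat v) \<le> s" by simp_all
    qed
  qed
  have es: "\<forall>(u, v)\<in>set es. u < 2 ^ s \<and> v < 2 ^ s" "length es \<le> s"
    and ts: "\<forall>(u, v)\<in>set ts. u < 2 ^ s \<and> v < 2 ^ s" "length ts \<le> s"
    using edges[of es] edges[of ts] sx by simp_all
  have bs: "length bags \<le> s" using length_le_size_enc_list[of bags "enc_pair enc_nat (enc_list enc_nat)"] sx by simp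
  have bb: "bounded_bags s bags"
    unfolding bounded_bags_def
  proof (clarify, intro conjI ballI)
    fix t b assume "(t, b) \<in> set bags"
    then have "size (enc_nat t) + size (enc_list enc_nat b) < s"
      using size_enc_list_mem[of "(t, b)" bags "enc_pair enc_nat (enc_list enc_nat)"] sx by simp
    then show "t < 2 ^ s" "length b \<le> s"
      using length_le_size_enc_list[of b enc_nat] by (auto intro!: num)
    fix u assume "u \<in> set b"
    from size_enc_list_mem[OF this, of enc_nat] \<open>_ < s\<close> show "u < 2 ^ s" by (intro num) simp
  qed
  then have tb: "t < 2 ^ s" "length b \<le> s" "\<forall>u\<in>set b. u < 2 ^ s" by (simp_all add: bags bounded_bags_def)
  define st0 :: "nat state" where "st0 = \<lparr>reps = [], used = 0, vlist = vs, elist = []\<rparr>"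
  have "bounded_state s s st0"
    using vs vs' less_two_power_mono[of _ s 0 s] by (simp add: bounded_state_def st0_def numbers_def)
  then have "bounded_state s (s + 2 * length b) (fork (spare s) t t b st0)"
    using bounded_fork[OF tb(1)] tb(3) by blast
  then have "bounded_state s (3 * s + 1) (fork (spare s) t t b st0)"
    by (rule bounded_state_mono) (use tb(2) in simp)
  then have w0: "bounded_work s (3 * s + 1) (start (spare s) bags vs)"
    using tb(1) by (simp add: start_def bags st0_def bounded_work_def)
  define w where "w = fold (\<lambda>_. sweep (spare s) bags ts) bags (start (spare s) bags vs)"
  define m1 where "m1 = 3 * s + 1 + length bags * (length ts * (4 * s + 2))"
  have w: "bounded_work s m1 w"
    unfolding w_def m1_def by (rule bounded_sweeps[OF bb ts(1) w0])
  have "bounded_state s (m1 + 3 * length es) (links (spare s) bags es (snd w))"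
    using w es(1) by (intro bounded_links) (auto simp: bounded_work_def)
  moreover have st: "st = links (spare s) bags es (snd w)" by (simp add: st_def ternarize_def w_def s_def)
  moreover have m1: "m1 + 3 * length es \<le> m"
    using mult_le_mono[OF bs mult_le_mono1[OF ts(2), of "4 * s + 2"]] es(2) by (simp add: m1_def m_def)
  ultimately have bst: "bounded_state s m st" using bounded_state_mono by blast
  have bw: "bounded_work s m w"
    using w m1 bounded_state_mono[of s m1 "snd w" m] by (simp add: bounded_work_def)
  define r where "r = s + 1"
  have "m \<le> 10 * r ^ 3" by (simp add: m_def r_def power3_eq_cube algebra_simps)
  moreover have "s \<le> r ^ 3" by (simp add: r_def power3_eq_cube algebra_simps)
  ultimately have sm: "s + m \<le> 11 * r ^ 3" "m \<le> 10 * r ^ 3" by simp_all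
  have r: "1 \<le> r ^ 3" by (simp add: r_def)
  \<comment> \<open>With \<open>s + m \<le> 11 * r ^ 3\<close> and \<open>m \<le> 10 * r ^ 3\<close>
    the leading coefficient is \<open>10 * (14 * 11 + 7) = 1610\<close>; the lower terms fit below
    2000.\<close>
  have "m * (14 * (s + m) + 7) \<le> 10 * r ^ 3 * (14 * (11 * r ^ 3) + 7 * r ^ 3)"
    using sm r by (intro mult_le_mono) auto
  also have "\<dots> = 1610 * r ^ 6" by (simp flip: power_add add: algebra_simps)
  finally have "m * (14 * (s + m) + 7) \<le> 1610 * r ^ 6" .
  moreover have "2 * (s + m) \<le> 22 * r ^ 3" using sm by simp
  ultimately have "m * (14 * (s + m) + 7) + 2 * (s + m) + 4 \<le> 1610 * r ^ 6 + 22 * r ^ 3 + 4"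
    by (intro add_mono) simp_all
  moreover have r36: "r ^ 3 \<le> r ^ 6" by (rule power_increasing) (simp_all add: r_def)
  ultimately have total: "m * (14 * (s + m) + 7) + 2 * (s + m) + 4 < 2000 * r ^ 6"
    using r by linarith
  have bound: "size_bound s = 2000 * r ^ 6" by (simp add: size_bound_def r_def)
  have N: "10 \<le> size_bound s" "2 * s + 10 < size_bound s"
    using r r36 \<open>s \<le> r ^ 3\<close> unfolding bound by linarith+
  have "size (enc_work s w) < size_bound s"
    using size_bounded_work[OF bw] total unfolding bound by linarith
  moreover have "m * (12 * (s + m) + 6) \<le> m * (14 * (s + m) + 7)" by (intro mult_le_mono2) simp
  then have "size (enc_state s st) < size_bound s"
    using size_bounded_state[OF bst] total unfolding bound by linarith
  ultimately have "fn (size_bound s) 0 [x] (Cell (enc_list enc_nat (vlist st)) (enc_list enc_edge (elist st)))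
      (4000 * size_bound s ^ 5)"
    using fn_main[OF N(1) x \<open>bags \<noteq> []\<close>] N(2) by (simp add: st_def w_def s_def)
  \<comment> \<open>The sixth power arises because each of the counted steps may cost as much as the
    common size bound.\<close>
  then obtain c where "eval prog [x] (prog ! 0) (Cell (enc_list enc_nat (vlist st)) (enc_list enc_edge (elist st))) c"
    "c \<le> 4000 * size_bound s ^ 5 * size_bound s" by (auto simp: fn_def ev_def)
  moreover have "4000 * size_bound s ^ 5 * size_bound s = 4000 * size_bound s ^ 6"
    using power_add[of "size_bound s" 5 1] by simp
  moreover have "prog \<noteq> []" by (simp add: prog_def)
  ultimately show ?thesis unfolding runs_def s_def by auto
qed

theorem theorem1:
  shows "(\<exists>(P :: program) (p :: nat poly).
           \<forall>(G :: nat pair_pre_digraph) (T :: nat pair_pre_digraph) (B :: nat \<Rightarrow> nat set) (x :: sexp).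
             pair_graph G \<longrightarrow> tree_decomposition G T B \<longrightarrow> encodes_instance x G T B \<longrightarrow>
             (\<exists>y c G'. runs P x y c \<and> c \<le> poly p (size x) \<and>
                encodes_graph y G' \<and> ternary_expansion G G' \<and>
                treewidth G' \<le> width T B + 1))
       \<and> (\<forall>G :: 'a :: infinite pair_pre_digraph. pair_graph G \<longrightarrow>
             (\<exists>G'. ternary_expansion G G' \<and> treewidth G' \<le> treewidth G + 1))"
proof (intro conjI allI impI)
  define p :: "nat poly" where "p = [:4000:] * ([:2000:] * [:1, 1:] ^ 6) ^ 6"
  have p: "poly p n = 4000 * size_bound n ^ 6" for n
    by (simp add: p_def size_bound_def add.commute)
  show "\<exists>(P :: program) (p :: nat poly).
           \<forall>(G :: nat pair_pre_digraph) (T :: nat pair_pre_digraph) (B :: nat \<Rightarrow> nat set) (x :: sexp).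
             pair_graph G \<longrightarrow> tree_decomposition G T B \<longrightarrow> encodes_instance x G T B \<longrightarrow>
             (\<exists>y c G'. runs P x y c \<and> c \<le> poly p (size x) \<and>
                encodes_graph y G' \<and> ternary_expansion G G' \<and>
                treewidth G' \<le> width T B + 1)"
  proof (rule exI[of _ prog], rule exI[of _ p], intro allI impI)
    fix G T :: "nat pair_pre_digraph" and B x
    assume G: "pair_graph G" and td: "tree_decomposition G T B" and enc: "encodes_instance x G T B"
    obtain vs es tvs ts bags where
      vs: "distinct vs" "set vs = pverts G"
      and es: "distinct (map (\<lambda>(u, v). {u, v}) es)" "set es \<union> (set es)\<inverse> = parcs G"
      and ts: "set ts \<union> (set ts)\<inverse> = parcs T"
      and bags: "distinct (map fst bags)" "set (map fst bags) = pverts T"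
        "\<forall>(t, b)\<in>set bags. distinct b \<and> set b = B t"
      and x: "x = Cell (Cell (enc_list enc_nat vs) (enc_list enc_edge es))
        (Cell (Cell (enc_list enc_nat tvs) (enc_list enc_edge ts)) (enc_bags bags))"
      using enc unfolding encodes_instance_def encodes_graph_def encodes_bags_def by blast
    define f where "f = spare (size x)"
    have "inj f"
      unfolding f_def
    proof (rule injI)
      fix i j assume "spare (size x) i = spare (size x) j"
      then have "(2 :: nat) ^ (size x + i) = 2 ^ (size x + j)"
        unfolding spare_def by (metis Suc_pred' pos2 zero_less_power)
      then show "i = j" by simp
    qed
    moreover have "range f \<inter> pverts G = {}"
    proof -
      \<comment> \<open>The encoding of \<open>v\<close> is strictly smaller than \<open>x\<close>.
        This strictness gives \<open>v + 1 < 2 ^ size x\<close>, which makes up for the subtraction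
        of 1 in \<open>spare\<close>.\<close>
      have "v \<noteq> f k" if "v \<in> set vs" for v k
      proof -
        have "size (enc_nat v) < size x" using size_enc_list_mem[OF that, of enc_nat] x by simp
        then have "(2 :: nat) ^ size (enc_nat v) < 2 ^ size x" by (intro power_strict_increasing) auto
        also have "(2 :: nat) ^ size x \<le> 2 ^ (size x + k)" by (simp add: power_increasing)
        finally have "v + 1 < 2 ^ (size x + k)" using less_two_power_size[of v] by linarith
        then show ?thesis by (simp add: f_def spare_def)
      qed
      then show ?thesis using vs by auto
    qed
    ultimately interpret ternarization G T B f using G td by (intro ternarization.intro)
    define st where "st = ternarize f vs es ts bags"
    have lb: "lists_bags bags" using bags by (simp add: lists_bags_def)
    note correct = ternarize_correct[OF vs es ts lb, folded st_def]
    have "pverts T \<noteq> {}" using td by (auto simp: tree_decomposition_def undirected_tree_iff)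
    then have "bags \<noteq> []" using bags by auto
    from runs_prog[OF x this] obtain c where
      "runs prog x (Cell (enc_list enc_nat (vlist st)) (enc_list enc_edge (elist st))) c"
      "c \<le> poly p (size x)" by (auto simp: p st_def f_def)
    moreover have "encodes_graph (Cell (enc_list enc_nat (vlist st)) (enc_list enc_edge (elist st))) (graph st)"
      unfolding encodes_graph_def using correct(3,4) by (auto simp: graph_def)
    ultimately show "\<exists>y c G'. runs prog x y c \<and> c \<le> poly p (size x) \<and>
        encodes_graph y G' \<and> ternary_expansion G G' \<and> treewidth G' \<le> width T B + 1"
      using correct(1,2) by blast
  qed
qed (rule exists_ternary_expansion)

end
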